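(* Let $n\ge2$, $1\le m<n$, let $\Sigma_0,\Sigma_1\in\mathrm{Sym}^+(n)$, let $\varepsilon>0$, and let $(Y_t)_{t\in[0,1]}$ be a continuously differentiable curve in $\mathbb{R}^{n\times m}$ with $Y_t$ of full column rank for all $t$. Fix $N_0$ and define $M_t$, $N_t$ as in the context. If there exists at least one admissible pair for Problem 2$'$, then Problem 2$'$ has an absolute (global) minimizer $(K^\star_t,\Phi^\star_t)_{t\in[0,1]}$ among all admissible pairs.
   Context: $\mathrm{Sym}^+(n)$ denotes the set of real symmetric positive-definite $n\times n$ matrices and $\mathrm{GL}(n)$ the group of real invertible $n\times n$ matrices. For a pair of curves $(K_t,\Phi_t)_{t\in[0,1]}$ and $\Sigma_0\in\mathrm{Sym}^+(n)$, define $J_{\rm KE}=\frac12\int_0^1\mathrm{tr}(K_t\Phi_t\Sigma_0\Phi_t^\top K_t^\top)\,dt$ and $J_{\rm A}=\frac12\int_0^1\mathrm{tr}(K_tK_t^\top)\,dt$. Fix $N_0\in\mathbb{R}^{(n-m)\times n}$ with $N_0Y_0=0$ and $\mathrm{rank}([Y_0,\,N_0^\top])=n$; let $M_t=\dot Y_t(Y_t^\top Y_t)^{-1}Y_t^\top$ and let $(N_t)$ solve $\dot N_t=-N_tM_t$ with initial value $N_0$. Problem 2$'$: minimize $J_{\rm KE}+\varepsilon J_{\rm A}$ over pairs $(K_t,\Phi_t)_{t\in[0,1]}$ with $(K_t)$ square integrable and $(\Phi_t)$ absolutely continuous with values in $\mathrm{GL}(n)$, subject to: $\Phi_0=I$ and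 $\dot\Phi_t=K_t\Phi_t$ wherever $\dot\Phi_t$ exists; $\Phi_1\Sigma_0\Phi_1^\top=\Sigma_1$; $Y_1=\Phi_1Y_0$; and $K_t=M_t+R_tN_t$ for almost all $t$ for some square-integrable curve $(R_t)$ in $\mathbb{R}^{n\times(n-m)}$. An admissible pair for Problem 2$'$ is one satisfying all these constraints with finite cost. *)

theory Defs
  imports "HOL-Analysis.Analysis"
begin

definition sym_pos_def :: "real^'n^'n \<Rightarrow> bool" where
  "sym_pos_def A \<longleftrightarrow> transpose A = A \<and> (\<forall>x. x \<noteq> 0 \<longrightarrow> x \<bullet> (A *v x) > 0)"

definition abs_continuous_on :: "real set \<Rightarrow> (real \<Rightarrow> 'a::real_normed_vector) \<Rightarrow> bool" where
  "abs_continuous_on S f \<longleftrightarrow>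
     (\<forall>e>0. \<exists>d>0. \<forall>(k::nat) (a::nat\<Rightarrow>real) b.
        (\<forall>i<k. a i \<le> b i \<and> {a i..b i} \<subseteq> S) \<and>
        (\<forall>i<k. \<forall>j<k. i \<noteq> j \<longrightarrow> b i \<le> a j \<or> b j \<le> a i) \<and>
        (\<Sum>i<k. b i - a i) < d
        \<longrightarrow> (\<Sum>i<k. norm (f (b i) - f (a i))) < e)"

definition square_integrable_on :: "real set \<Rightarrow> (real \<Rightarrow> 'a::euclidean_space) \<Rightarrow> bool" where
  "square_integrable_on S f \<longleftrightarrow> f measurable_on S \<and> (\<lambda>t. (norm (f t))^2) integrable_on S"

definition hcat :: "real^'p^'n \<Rightarrow> real^'q^'n \<Rightarrow> real^('p + 'q)^'n" where
  "hcat A B = (\<chi> i j. case j of Inl a \<Rightarrow> A $ i $ a | Inr b \<Rightarrow> B $ i $ b)"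

definition Mcurve :: "(real \<Rightarrow> real^'m^'n) \<Rightarrow> real \<Rightarrow> real^'n^'n" where
  "Mcurve Y t = vector_derivative Y (at t within {0..1}) ** matrix_inv (transpose (Y t) ** Y t) ** transpose (Y t)"

definition J_KE :: "real^'n^'n \<Rightarrow> (real \<Rightarrow> real^'n^'n) \<Rightarrow> (real \<Rightarrow> real^'n^'n) \<Rightarrow> real" where
  "J_KE \<Sigma>0 K \<Phi> = 1/2 * integral {0..1} (\<lambda>t. trace (K t ** \<Phi> t ** \<Sigma>0 ** transpose (\<Phi> t) ** transpose (K t)))"

definition J_A :: "(real \<Rightarrow> real^'n^'n) \<Rightarrow> real" where
  "J_A K = 1/2 * integral {0..1} (\<lambda>t. trace (K t ** transpose (K t)))"

definition cost2 :: "real^'n^'n \<Rightarrow> real \<Rightarrow> (real \<Rightarrow> real^'n^'n) \<Rightarrow> (real \<Rightarrow> real^'n^'n) \<Rightarrow> real" where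
  "cost2 \<Sigma>0 \<epsilon> K \<Phi> = J_KE \<Sigma>0 K \<Phi> + \<epsilon> * J_A K"

text \<open>Admissible pairs for Problem 2'. N is the curve solving N' = - N M with N(0) = N0.\<close>
definition admissible2 ::
  "real^'n^'n \<Rightarrow> real^'n^'n \<Rightarrow> (real \<Rightarrow> real^'m^'n) \<Rightarrow> (real \<Rightarrow> real^'n^'k)
   \<Rightarrow> (real \<Rightarrow> real^'n^'n) \<Rightarrow> (real \<Rightarrow> real^'n^'n) \<Rightarrow> bool" where
  "admissible2 \<Sigma>0 \<Sigma>1 Y N K \<Phi> \<longleftrightarrow>
     square_integrable_on {0..1} K \<and>
     abs_continuous_on {0..1} \<Phi> \<and>
     (\<forall>t\<in>{0..1}. invertible (\<Phi> t)) \<and>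
     \<Phi> 0 = mat 1 \<and>
     (\<forall>t\<in>{0..1}. \<forall>D. (\<Phi> has_vector_derivative D) (at t within {0..1}) \<longrightarrow> D = K t ** \<Phi> t) \<and>
     \<Phi> 1 ** \<Sigma>0 ** transpose (\<Phi> 1) = \<Sigma>1 \<and>
     Y 1 = \<Phi> 1 ** Y 0 \<and>
     (\<exists>R::real \<Rightarrow> real^'k^'n. square_integrable_on {0..1} R \<and>
        (\<exists>Z. negligible Z \<and> (\<forall>t\<in>{0..1} - Z. K t = Mcurve Y t + R t ** N t))) \<and>
     (\<lambda>t. trace (K t ** \<Phi> t ** \<Sigma>0 ** transpose (\<Phi> t) ** transpose (K t))) integrable_on {0..1} \<and>
     (\<lambda>t. trace (K t ** transpose (K t))) integrable_on {0..1}"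

end

theory Submission
  imports Defs "HOL-Complex_Analysis.Great_Picard"
begin

text \<open>
  If \<open>\<Phi>\<close> is the flow of \<open>K\<close>, the constraint \<open>K = M + R N\<close> says that \<open>K Y = Y'\<close> almost everywhere, which
  is equivalent to \<open>\<Phi> t Y 0 = Y t\<close> for all \<open>t\<close>, a condition that survives pointwise limits. Writing \<open>K \<Phi> = \<Phi>'\<close>,
  twice the cost is the integral of \<open>trace (\<Phi>' P \<Phi>'\<^sup>T)\<close> with \<open>P = \<Sigma>0 + \<epsilon> \<Phi>\<^sup>-\<^sup>1 \<Phi>\<^sup>-\<^sup>T\<close>.
  Along a minimizing sequence \<open>K\<close> is bounded in \<open>L\<^sup>2\<close>, so the flows and their inverses are uniformly bounded and
  the flows are uniformly Hoelder continuous; by Arzela-Ascoli they converge uniformly. The limit \<open>\<Phi>\<close> is absolutely continuous,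
  and \<open>K = \<Phi>' \<Phi>\<^sup>-\<^sup>1\<close> is the minimizer. Lower semicontinuity of the cost needs no weak convergence:
  on a uniform partition the Cauchy-Schwarz inequality bounds the quadratic form of the difference quotients of \<open>\<Phi>\<close>
  by the limit of the costs, and Fatou's lemma lets the mesh tend to zero.

  Absolute continuity enters through two facts that do not use bounded variation: an absolutely continuous function is
  differentiable almost everywhere, and it is the indefinite integral of its derivative.
\<close>

section \<open>Absolutely continuous functions are differentiable almost everywhere\<close>

text \<open>The kinetic term is a product of both unknowns and is not jointly convex in
  \<open>K\<close> and \<Phi>, so lower semicontinuity cannot be read off from convexity in the
  pair. In the variable \<Phi>' the integrand is a convex quadratic form whose coefficient depends
  continuously on \<Phi>. This is Tonelli's setting, and uniform convergence of the flows is what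
  controls the coefficient. The penalty \<epsilon> makes the problem coercive: the kinetic term by
  itself controls \<Phi>' but not the inverse of \<Phi>, whereas a bound on \<open>K\<close> keeps
  the limit flow from leaving GL(n). The endpoint conditions involve values of \<Phi> only and are
  closed. The relation \<Phi>' = K \<Phi> is demanded at every point of differentiability, while
  \<open>K\<close> enters the cost only up to null sets; the limiting control is therefore defined
  pointwise from the derivative of the limit flow.\<close>

lemma abs_continuous_on_division:
  fixes f :: "real \<Rightarrow> 'a::real_normed_vector"
  assumes "abs_continuous_on S f" "e > 0"
  obtains d where "d > 0"
    "\<And>p. p division_of \<Union>p \<Longrightarrow> \<Union>p \<subseteq> S \<Longrightarrow> (\<Sum>k\<in>p. Sup k - Inf k) < d
       \<Longrightarrow> (\<Sum>k\<in>p. norm (f (Sup k) - f (Inf k))) < e"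
proof -
  obtain d where "d > 0" and d0: "\<forall>(n::nat) (a::nat\<Rightarrow>real) b.
        (\<forall>i<n. a i \<le> b i \<and> {a i..b i} \<subseteq> S) \<and>
        (\<forall>i<n. \<forall>j<n. i \<noteq> j \<longrightarrow> b i \<le> a j \<or> b j \<le> a i) \<and>
        (\<Sum>i<n. b i - a i) < d \<longrightarrow> (\<Sum>i<n. norm (f (b i) - f (a i))) < e"
    using assms(1)[unfolded abs_continuous_on_def, rule_format, OF assms(2)] by (elim exE conjE)
  note d = d0[THEN spec, THEN spec, THEN spec, THEN mp, OF conjI, OF _ conjI]
  have "(\<Sum>k\<in>p. norm (f (Sup k) - f (Inf k))) < e"
    if p: "p division_of \<Union>p" and pS: "\<Union>p \<subseteq> S" and small: "(\<Sum>k\<in>p. Sup k - Inf k) < d" for p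
  proof -
    \<comment> \<open>A degenerate cell \<open>{u..u}\<close> has empty interior and may lie inside
      another cell, where the ordering of endpoints demanded by \<open>abs_continuous_on\<close>
      fails. Such cells add nothing to either sum, so only the cells of positive length are
      enumerated.\<close>
    define q where "q = {k\<in>p. Inf k < Sup k}"
    have fp: "finite p" and fq: "finite q"
      using p by (auto simp: division_of_def q_def)
    have box: "\<exists>u v. u \<le> v \<and> k = {u..v}" if "k \<in> p" for k
      using division_ofD(3,4)[OF p that] by (metis cbox_interval atLeastatMost_empty_iff)
    have boxp: "k = {Inf k..Sup k}" "Inf k \<le> Sup k" if kp: "k \<in> p" for k
    proof -
      obtain u v where "u \<le> v" "k = {u..v}" using box[OF kp] by auto
      then show "k = {Inf k..Sup k}" "Inf k \<le> Sup k" by simp_all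
    qed
    obtain h where h: "bij_betw h {..<card q} q"
      using ex_bij_betw_nat_finite[OF fq] by (metis atLeast0LessThan)
    have hq: "h i \<in> q" "h i \<in> p" if "i < card q" for i
      using h that unfolding bij_betw_def q_def by auto
    have "(\<Sum>i<card q. norm (f (Sup (h i)) - f (Inf (h i)))) < e"
    proof (rule d)
      show "\<forall>i<card q. Inf (h i) \<le> Sup (h i) \<and> {Inf (h i)..Sup (h i)} \<subseteq> S"
      proof (intro allI impI conjI)
        fix i assume i: "i < card q"
        show "Inf (h i) \<le> Sup (h i)" using boxp(2)[OF hq(2)[OF i]] .
        show "{Inf (h i)..Sup (h i)} \<subseteq> S"
          using boxp(1)[OF hq(2)[OF i], symmetric] hq(2)[OF i] pS by auto
      qed
      show "\<forall>i<card q. \<forall>j<card q. i \<noteq> j \<longrightarrow> Sup (h i) \<le> Inf (h j) \<or> Sup (h j) \<le> Inf (h i)"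
      proof (intro allI impI)
        fix i j assume ij: "i < card q" "j < card q" "i \<noteq> j"
        then have "h i \<noteq> h j"
          using h unfolding bij_betw_def inj_on_def by auto
        then have "interior {Inf (h i)..Sup (h i)} \<inter> interior {Inf (h j)..Sup (h j)} = {}"
          using division_ofD(5)[OF p hq(2)[OF ij(1)] hq(2)[OF ij(2)]] boxp(1)[OF hq(2)[OF ij(1)], symmetric]
            boxp(1)[OF hq(2)[OF ij(2)], symmetric] by simp
        moreover have "Inf (h i) < Sup (h i)" "Inf (h j) < Sup (h j)"
          using hq(1) ij by (auto simp: q_def)
        ultimately show "Sup (h i) \<le> Inf (h j) \<or> Sup (h j) \<le> Inf (h i)"
          by (auto simp: interior_atLeastAtMost_real greaterThanLessThan_empty_iff2 min_def max_def split: if_splits)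
      qed
      have "(\<Sum>i<card q. Sup (h i) - Inf (h i)) = (\<Sum>k\<in>q. Sup k - Inf k)"
        by (rule sum.reindex_bij_betw[OF h])
      also have "\<dots> \<le> (\<Sum>k\<in>p. Sup k - Inf k)"
      proof (rule sum_mono2)
        show "0 \<le> Sup k - Inf k" if "k \<in> p - q" for k using boxp(2)[of k] that by simp
      qed (use fp in \<open>auto simp: q_def\<close>)
      finally show "(\<Sum>i<card q. Sup (h i) - Inf (h i)) < d"
        using small by linarith
    qed
    also have "(\<Sum>i<card q. norm (f (Sup (h i)) - f (Inf (h i)))) = (\<Sum>k\<in>q. norm (f (Sup k) - f (Inf k)))"
      by (rule sum.reindex_bij_betw[OF h])
    also have "\<dots> = (\<Sum>k\<in>p. norm (f (Sup k) - f (Inf k)))"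
    proof (rule sum.mono_neutral_left)
      show "\<forall>k\<in>p - q. norm (f (Sup k) - f (Inf k)) = 0"
      proof
        fix k assume "k \<in> p - q"
        then have "Inf k = Sup k" using boxp(2)[of k] by (simp add: q_def)
        then show "norm (f (Sup k) - f (Inf k)) = 0" by simp
      qed
    qed (use fp in \<open>auto simp: q_def\<close>)
    finally show ?thesis .
  qed
  with \<open>d > 0\<close> show thesis
    using that by blast
qed

section \<open>Finite Vitali coverings and exceptional sets of slopes\<close>

lemma additive_division_1:
  fixes f :: "real \<Rightarrow> 'a::real_normed_vector"
  assumes "a \<le> b" and p: "p division_of {a..b}"
  shows "(\<Sum>k\<in>p. f (Sup k) - f (Inf k)) = f b - f a"
proof -
  have *: "k \<in> p \<Longrightarrow> \<exists>u v. u \<le> v \<and> k = {u..v}" for k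
    using division_ofD(3,4)[OF p] by (metis cbox_interval atLeastatMost_empty_iff)
  \<comment> \<open>Tagging each cell with its left endpoint makes the telescoping identity for
    tagged divisions applicable.\<close>
  have "(\<lambda>k. (Inf k, k)) ` p tagged_division_of {a..b}"
  proof (rule tagged_division_ofI)
    show "finite ((\<lambda>k. (Inf k, k)) ` p)" using p by auto
    show "x \<in> K" "K \<subseteq> {a..b}" "\<exists>a b. K = cbox a b" if "(x, K) \<in> (\<lambda>k. (Inf k, k)) ` p" for x K
      using that * division_ofD(2,4)[OF p] by fastforce+
    show "interior K1 \<inter> interior K2 = {}"
      if "(x1, K1) \<in> (\<lambda>k. (Inf k, k)) ` p" "(x2, K2) \<in> (\<lambda>k. (Inf k, k)) ` p" "(x1, K1) \<noteq> (x2, K2)" for x1 K1 x2 K2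
      using that division_ofD(5)[OF p] by auto
    have "{K. \<exists>x. (x, K) \<in> (\<lambda>k. (Inf k, k)) ` p} = p" by auto
    then show "\<Union> {K. \<exists>x. (x, K) \<in> (\<lambda>k. (Inf k, k)) ` p} = {a..b}"
      using division_ofD(6)[OF p] by simp
  qed
  from additive_tagged_division_1[OF \<open>a \<le> b\<close> this, of f] show ?thesis
    by (subst (asm) sum.reindex) (auto simp: inj_on_def)
qed

text \<open>Every interval is a closed ball around its midpoint, so Vitali's theorem for balls
  yields a countable disjoint family that covers \<open>S\<close> up to a null set. Continuity of
  the measure from above lets a finite subfamily do, at the price of an error \<open>e\<close>. The
  predicate \<open>P\<close> carries the slope condition, and \<open>U\<close> keeps the chosen
  intervals inside an open set of controlled measure.\<close>

lemma Vitali_covering_intervals: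
  fixes S :: "real set"
  assumes S: "S \<in> lmeasurable" and U: "open U" "S \<subseteq> U" and "e > 0"
    and cover: "\<And>x d. x \<in> S \<Longrightarrow> d > 0 \<Longrightarrow> \<exists>u v. u < v \<and> u \<le> x \<and> x \<le> v \<and> v - u < d \<and> P u v"
  obtains p where "finite p" "\<And>k. k \<in> p \<Longrightarrow> \<exists>u v. u < v \<and> P u v \<and> k = {u..v}" "\<Union>p \<subseteq> U"
    "\<And>k l. k \<in> p \<Longrightarrow> l \<in> p \<Longrightarrow> k \<noteq> l \<Longrightarrow> k \<inter> l = {}"
    "measure lebesgue (S - \<Union>p) < e"
proof (cases "S = {}")
  case True
  then show ?thesis using that[of "{}"] \<open>e > 0\<close> by auto
next
  case False
  define K where "K = {(u,v). u < v \<and> P u v \<and> {u..v} \<subseteq> U}"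
  define I where "I = (\<lambda>(u::real,v). {u..v})"
  have I: "cball ((fst i + snd i)/2) ((snd i - fst i)/2) = I i" for i
    by (cases i) (simp add: cball_eq_atLeastAtMost I_def field_simps)
  obtain C where C: "countable C" "C \<subseteq> K"
     "pairwise (\<lambda>i j. disjnt (I i) (I j)) C" "negligible (S - (\<Union>i\<in>C. I i))"
  proof (rule Vitali_covering_theorem_cballs[of K "\<lambda>i. (snd i - fst i)/2" S "\<lambda>i. (fst i + snd i)/2"])
    show "0 < (snd i - fst i) / 2" if "i \<in> K" for i
      using that by (auto simp: K_def)
    show "\<exists>i. i \<in> K \<and> x \<in> cball ((fst i + snd i) / 2) ((snd i - fst i) / 2) \<and> (snd i - fst i) / 2 < d"
      if xS: "x \<in> S" and "d > 0" for x d
    proof -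
      obtain r where r: "r > 0" "ball x r \<subseteq> U"
        using U xS openE by blast
      \<comment> \<open>An interval that contains \<open>x\<close> and is shorter than
        \<open>r\<close> lies in \<open>ball x r\<close>, hence in \<open>U\<close>.\<close>
      obtain u v where uv: "u < v" "u \<le> x" "x \<le> v" "v - u < min d r" "P u v"
        using cover[OF xS, of "min d r"] \<open>d > 0\<close> r by auto
      have "{u..v} \<subseteq> ball x r"
        using uv by (auto simp: dist_real_def abs_real_def)
      with r uv have "(u,v) \<in> K" by (auto simp: K_def)
      moreover have "x \<in> I (u,v)" using uv by (simp add: I_def)
      ultimately show ?thesis
        unfolding I using uv by (intro exI[of _ "(u,v)"]) auto
    qed
  qed (use that I in auto)
  show ?thesis
  proof (cases "C = {}")
    case True
    then show ?thesis
      using C(4) that[of "{}"] \<open>e > 0\<close> by (auto simp: negligible_imp_measure0)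
  next
    case False
    \<comment> \<open>When \<open>C\<close> is finite this enumeration repeats elements. This does
      no harm: the final family is the image of an initial segment, and disjointness is only asked
      of distinct sets.\<close>
    define c where "c = from_nat_into C"
    have rc: "range c = C"
      using range_from_nat_into[OF False C(1)] by (simp add: c_def)
    define A where "A n = S - (\<Union>i<n. I (c i))" for n :: nat
    have Am: "A n \<in> lmeasurable" for n
      unfolding A_def using S by (intro fmeasurable_Diff) (auto simp: I_def split: prod.split)
    have "(\<lambda>n. measure lebesgue (A n)) \<longlonglongrightarrow> measure lebesgue (\<Inter>n. A n)"
    proof (rule Lim_measure_decseq)
      show "range A \<subseteq> sets lebesgue" using Am by auto
      show "decseq A" unfolding A_def decseq_def
        by (intro allI impI Diff_mono UN_mono) auto
      show "emeasure lebesgue (A i) \<noteq> \<infinity>" for i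
        using Am fmeasurableD2 by (metis infinity_ennreal_def)
    qed
    moreover have "(\<Inter>n. A n) = S - (\<Union>i\<in>C. I i)"
      unfolding A_def rc[symmetric] by blast
    ultimately have "(\<lambda>n. measure lebesgue (A n)) \<longlonglongrightarrow> 0"
      using C(4) by (simp add: negligible_imp_measure0)
    then have "eventually (\<lambda>n. measure lebesgue (A n) < e) sequentially"
      using \<open>e > 0\<close> by (rule order_tendstoD)
    then obtain n where n: "measure lebesgue (A n) < e"
      using eventually_happens[of _ sequentially] by auto
    show ?thesis
    proof (rule that[of "(\<lambda>i. I (c i)) ` {..<n}"])
      have cK: "c i \<in> K" for i using rc C(2) by blast
      show "\<exists>u v. u < v \<and> P u v \<and> k = {u..v}" if "k \<in> (\<lambda>i. I (c i)) ` {..<n}" for k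
      proof -
        from that obtain i where "k = I (c i)" by blast
        with cK[of i] show ?thesis by (auto simp: K_def I_def)
      qed
      show "\<Union> ((\<lambda>i. I (c i)) ` {..<n}) \<subseteq> U"
      proof (rule UN_least)
        show "I (c i) \<subseteq> U" for i using cK[of i] by (auto simp: K_def I_def)
      qed
      show "k \<inter> l = {}" if "k \<in> (\<lambda>i. I (c i)) ` {..<n}" "l \<in> (\<lambda>i. I (c i)) ` {..<n}" "k \<noteq> l" for k l
      proof -
        from that obtain i j where ij: "k = I (c i)" "l = I (c j)" by blast
        then have "c i \<noteq> c j" using that by auto
        then show ?thesis using C(3) rc ij unfolding pairwise_def disjnt_def by blast
      qed
      show "measure lebesgue (S - \<Union> ((\<lambda>i. I (c i)) ` {..<n})) < e"
        using n by (simp add: A_def)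
    qed auto
  qed
qed

lemma disjoint_intervals:
  fixes p :: "real set set"
  assumes "finite p" and int: "\<And>k. k \<in> p \<Longrightarrow> \<exists>u v. u < v \<and> k = {u..v}"
    and disj: "\<And>k l. k \<in> p \<Longrightarrow> l \<in> p \<Longrightarrow> k \<noteq> l \<Longrightarrow> k \<inter> l = {}"
  shows "p division_of \<Union>p"
    and "measure lebesgue (\<Union>p) = (\<Sum>k\<in>p. Sup k - Inf k)"
    and "\<Union>p \<in> lmeasurable"
proof -
  show "p division_of \<Union>p"
  proof (rule division_ofI)
    show "K \<noteq> {}" "\<exists>a b. K = cbox a b" if "K \<in> p" for K
      using int[OF that] by auto
    show "interior K1 \<inter> interior K2 = {}" if "K1 \<in> p" "K2 \<in> p" "K1 \<noteq> K2" for K1 K2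
      using disj[OF that] interior_subset by blast
  qed (use assms(1) in auto)
  have m: "k \<in> lmeasurable" "measure lebesgue k = Sup k - Inf k" if "k \<in> p" for k
    using int[OF that] by auto
  then show "\<Union>p \<in> lmeasurable"
    using \<open>finite p\<close> by blast
  have "measure lebesgue (\<Union>k\<in>p. k) = (\<Sum>k\<in>p. measure lebesgue k)"
  proof (rule measure_finite_Union)
    show "disjoint_family_on (\<lambda>x. x) p"
      using disj by (auto simp: disjoint_family_on_def)
    show "emeasure lebesgue i \<noteq> \<infinity>" if "i \<in> p" for i
      using fmeasurableD2[OF m(1)[OF that]] by simp
  qed (use m(1) \<open>finite p\<close> in auto)
  then show "measure lebesgue (\<Union>p) = (\<Sum>k\<in>p. Sup k - Inf k)"
    using m(2) by simp
qed

lemma lmeasurable_Int_interval: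
  fixes u v :: real
  assumes "E \<in> sets lebesgue"
  shows "E \<inter> {u<..<v} \<in> lmeasurable"
  using fmeasurable_Int_fmeasurable[of "{u<..<v}" lebesgue E] assms lmeasurable_box[of u v]
  by (simp add: Int_commute)

text \<open>The cells \<open>G\<close> are what remains of \<open>{u..v}\<close> after disjoint
  intervals with nonpositive increment have been taken out. By telescoping, the increment of
  \<open>f\<close> over \<open>{u..v}\<close> is at most what these gaps carry. The same telescoping
  for the identity function measures their total length, because the removed intervals use up
  \<open>E\<close> to within measure \<open>e\<close>.\<close>

lemma gap_intervals:
  fixes f :: "real \<Rightarrow> real"
  assumes "u < v" and E: "E \<in> sets lebesgue" and "e > 0"
    and dn: "\<And>x d. x \<in> E \<Longrightarrow> u < x \<Longrightarrow> x < v \<Longrightarrow> d > 0 \<Longrightarrow>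
       \<exists>s t. s < t \<and> s \<le> x \<and> x \<le> t \<and> t - s < d \<and> f t - f s \<le> 0"
  obtains G where "G division_of \<Union>G" "\<Union>G \<subseteq> {u..v}"
    "f v - f u \<le> (\<Sum>k\<in>G. norm (f (Sup k) - f (Inf k)))"
    "(\<Sum>k\<in>G. Sup k - Inf k) \<le> measure lebesgue ({u..v} - E) + e"
proof -
  have S: "E \<inter> {u<..<v} \<in> lmeasurable"
    using E by (simp add: lmeasurable_Int_interval)
  obtain p where p: "finite p" "\<And>k. k \<in> p \<Longrightarrow> \<exists>s t. s < t \<and> f t - f s \<le> 0 \<and> k = {s..t}"
    "\<Union>p \<subseteq> {u<..<v}" "\<And>k l. k \<in> p \<Longrightarrow> l \<in> p \<Longrightarrow> k \<noteq> l \<Longrightarrow> k \<inter> l = {}"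
    "measure lebesgue (E \<inter> {u<..<v} - \<Union>p) < e"
    using Vitali_covering_intervals[OF S _ _ \<open>e > 0\<close>, of "{u<..<v}" "\<lambda>s t. f t - f s \<le> 0"] dn
    by auto
  have int: "\<And>k. k \<in> p \<Longrightarrow> \<exists>u v. u < v \<and> k = {u..v}" using p(2) by blast
  note pd = disjoint_intervals[OF p(1) int p(4)]
  have "\<Union>p \<subseteq> cbox u v" using p(3) by fastforce
  then obtain q where q: "p \<subseteq> q" "q division_of cbox u v"
    using partial_division_extend_interval[OF pd(1)] by blast
  have fq: "finite q" using q by auto
  have tele: "(\<Sum>k\<in>q - p. g (Sup k) - g (Inf k)) + (\<Sum>k\<in>p. g (Sup k) - g (Inf k)) = g v - g u"
    for g :: "real \<Rightarrow> real"
    using additive_division_1[of u v q g] q \<open>u < v\<close> sum.subset_diff[OF q(1) fq, of "\<lambda>k. g (Sup k) - g (Inf k)"]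
    by simp
  show ?thesis
  proof (rule that[of "q - p"])
    show qp: "q - p division_of \<Union>(q - p)"
      using division_of_subset[OF division_of_union_self[OF q(2)]] by blast
    show "\<Union>(q - p) \<subseteq> {u..v}"
      using division_ofD(6)[OF q(2)] by auto
    have "(\<Sum>k\<in>p. f (Sup k) - f (Inf k)) \<le> 0"
    proof (rule sum_nonpos)
      show "f (Sup k) - f (Inf k) \<le> 0" if "k \<in> p" for k using p(2)[OF that] by auto
    qed
    moreover have "(\<Sum>k\<in>q - p. f (Sup k) - f (Inf k)) \<le> (\<Sum>k\<in>q - p. norm (f (Sup k) - f (Inf k)))"
      by (rule sum_mono) simp
    ultimately show "f v - f u \<le> (\<Sum>k\<in>q - p. norm (f (Sup k) - f (Inf k)))"
      using tele[of f] by linarith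
    \<comment> \<open>Only the part of \<open>E\<close> inside the open interval is covered, so the
      two endpoints appear as a separate null set.\<close>
    have "measure lebesgue {u..v} \<le> measure lebesgue (({u..v} - E) \<union> (({u} \<union> {v}) \<union> ((E \<inter> {u<..<v} - \<Union>p) \<union> \<Union>p)))"
    proof (rule measure_mono_fmeasurable)
      show "({u..v} - E) \<union> (({u} \<union> {v}) \<union> ((E \<inter> {u<..<v} - \<Union>p) \<union> \<Union>p)) \<in> lmeasurable"
        using pd(3) E S by (intro fmeasurable.Un fmeasurable_Diff) (auto simp: negligible_imp_measurable)
    qed auto
    also have "\<dots> \<le> measure lebesgue ({u..v} - E) + (measure lebesgue ({u} \<union> {v}) + (measure lebesgue (E \<inter> {u<..<v} - \<Union>p) + measure lebesgue (\<Union>p)))"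
    proof -
      have sets: "{u..v} - E \<in> sets lebesgue" "{u} \<union> {v} \<in> sets lebesgue"
        "E \<inter> {u<..<v} - \<Union>p \<in> sets lebesgue" "\<Union>p \<in> sets lebesgue"
        using pd(3) E S by auto
      show ?thesis
        using measure_Un_le[OF sets(1) sets.Un[OF sets(2) sets.Un[OF sets(3,4)]]]
          measure_Un_le[OF sets(2) sets.Un[OF sets(3,4)]] measure_Un_le[OF sets(3,4)] by linarith
    qed
    also have "measure lebesgue ({u} \<union> {v}) = 0"
      by (rule negligible_imp_measure0) auto
    finally have "v - u \<le> measure lebesgue ({u..v} - E) + e + (\<Sum>k\<in>p. Sup k - Inf k)"
      using p(5) pd(2) \<open>u < v\<close> by simp
    then show "(\<Sum>k\<in>q - p. Sup k - Inf k) \<le> measure lebesgue ({u..v} - E) + e"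
      using tele[of "\<lambda>x. x"] by linarith
  qed
qed

text \<open>Cover \<open>E\<close> by disjoint intervals of slope at least \<open>c\<close>, and most of \<open>E\<close> inside them by disjoint intervals on
  which \<open>f\<close> does not increase. The total increase over the former is then carried by the remaining gaps, which have
  small total length, so absolute continuity makes it small.\<close>

lemma negligible_slopes_of_both_signs:
  fixes f :: "real \<Rightarrow> real"
  assumes ac: "abs_continuous_on {a..b} f" and E: "E \<in> sets lebesgue" "E \<subseteq> {a<..<b}" and "c > 0"
    and up: "\<And>x d. x \<in> E \<Longrightarrow> d > 0 \<Longrightarrow>
       \<exists>u v. u < v \<and> u \<le> x \<and> x \<le> v \<and> v - u < d \<and> f v - f u \<ge> c * (v - u)"
    and dn: "\<And>x d. x \<in> E \<Longrightarrow> d > 0 \<Longrightarrow>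
       \<exists>u v. u < v \<and> u \<le> x \<and> x \<le> v \<and> v - u < d \<and> f v - f u \<le> 0"
  shows "negligible E"
proof -
  have Em: "E \<in> lmeasurable"
    using lmeasurable_Int_interval[OF E(1), of a b] E(2) by (simp add: Int_absorb2)
  have "measure lebesgue E \<le> \<eta>" if "\<eta> > 0" for \<eta>
  proof -
    \<comment> \<open>The increase over the steep intervals is at least \<open>c\<close> times their
      total length, so the tolerance \<open>c * \<eta> / 2\<close> leaves them a length below
      \<open>\<eta>/2\<close>. The other \<open>\<eta>/2\<close> is the part of \<open>E\<close>
      that the covering may miss.\<close>
    obtain d where "d > 0" and d: "\<And>p. p division_of \<Union>p \<Longrightarrow> \<Union>p \<subseteq> {a..b} \<Longrightarrow> (\<Sum>k\<in>p. Sup k - Inf k) < d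
       \<Longrightarrow> (\<Sum>k\<in>p. norm (f (Sup k) - f (Inf k))) < c * \<eta> / 2"
    proof (rule abs_continuous_on_division[OF ac])
      show "c * \<eta> / 2 > 0" using \<open>c > 0\<close> \<open>\<eta> > 0\<close> by simp
    qed (rule that)
    obtain T where T: "open T" "E \<subseteq> T" "(T - E) \<in> lmeasurable" "emeasure lebesgue (T - E) < ennreal (d/2)"
      using sets_lebesgue_outer_open[OF E(1), of "d/2"] \<open>d > 0\<close> by auto
    have mT: "measure lebesgue (T - E) < d/2"
      using T(3,4) \<open>d > 0\<close> by (simp add: emeasure_eq_measure2 ennreal_less_iff)
    obtain p where p: "finite p" "\<And>k. k \<in> p \<Longrightarrow> \<exists>u v. u < v \<and> f v - f u \<ge> c * (v - u) \<and> k = {u..v}"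
      "\<Union>p \<subseteq> T \<inter> {a<..<b}" "\<And>k l. k \<in> p \<Longrightarrow> l \<in> p \<Longrightarrow> k \<noteq> l \<Longrightarrow> k \<inter> l = {}"
      "measure lebesgue (E - \<Union>p) < \<eta>/2"
    proof (rule Vitali_covering_intervals[OF Em, of "T \<inter> {a<..<b}" "\<eta>/2" "\<lambda>u v. f v - f u \<ge> c * (v - u)"])
      show "open (T \<inter> {a<..<b})" using T(1) by auto
      show "E \<subseteq> T \<inter> {a<..<b}" using T(2) E(2) by auto
      show "\<eta>/2 > 0" using \<open>\<eta> > 0\<close> by simp
    qed (use up in blast, rule that)
    have int: "\<And>k. k \<in> p \<Longrightarrow> \<exists>u v. u < v \<and> k = {u..v}" using p(2) by blast
    note pd = disjoint_intervals[OF p(1) int p(4)]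
    \<comment> \<open>Each of the \<open>card p\<close> steep intervals may contribute an error
      \<open>r\<close> to the length of the gaps. These errors sum to at most \<open>d/2\<close>,
      and the other \<open>d/2\<close> pays for the part of \<open>T\<close> outside
      \<open>E\<close>. The \<open>+ 1\<close> keeps \<open>r\<close> positive for an empty
      \<open>p\<close>.\<close>
    define r where "r = d / (2 * (real (card p) + 1))"
    have "r > 0" using \<open>d > 0\<close> by (simp add: r_def)
    define Q where "Q k G \<longleftrightarrow> G division_of \<Union>G \<and> \<Union>G \<subseteq> k \<and>
       f (Sup k) - f (Inf k) \<le> (\<Sum>l\<in>G. norm (f (Sup l) - f (Inf l))) \<and>
       (\<Sum>l\<in>G. Sup l - Inf l) \<le> measure lebesgue (k - E) + r" for k G
    have "\<forall>k\<in>p. \<exists>G. Q k G"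
    proof
      fix k assume kp: "k \<in> p"
      obtain u v where "u < v" "k = {u..v}" using int[OF kp] by blast
      obtain G where "G division_of \<Union>G" "\<Union>G \<subseteq> {u..v}"
        "f v - f u \<le> (\<Sum>k\<in>G. norm (f (Sup k) - f (Inf k)))"
        "(\<Sum>k\<in>G. Sup k - Inf k) \<le> measure lebesgue ({u..v} - E) + r"
        by (rule gap_intervals[OF \<open>u < v\<close> E(1) \<open>r > 0\<close>, of f]) (erule (1) dn, rule that)
      with \<open>u < v\<close> \<open>k = {u..v}\<close> show "\<exists>G. Q k G"
        unfolding Q_def by (intro exI[of _ G]) simp
    qed
    then obtain G where "\<forall>k\<in>p. Q k (G k)"
      by (rule bchoice[THEN exE])
    then have G: "\<And>k. k \<in> p \<Longrightarrow> G k division_of \<Union>(G k)" "\<And>k. k \<in> p \<Longrightarrow> \<Union>(G k) \<subseteq> k"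
       "\<And>k. k \<in> p \<Longrightarrow> f (Sup k) - f (Inf k) \<le> (\<Sum>l\<in>G k. norm (f (Sup l) - f (Inf l)))"
       "\<And>k. k \<in> p \<Longrightarrow> (\<Sum>l\<in>G k. Sup l - Inf l) \<le> measure lebesgue (k - E) + r"
      unfolding Q_def by blast+
    have fG: "\<forall>k\<in>p. finite (G k)" using G(1) by blast
    have Gdisj: "\<forall>k\<in>p. \<forall>k'\<in>p. k \<noteq> k' \<longrightarrow> G k \<inter> G k' = {}"
    proof (intro ballI impI)
      fix k k' assume k: "k \<in> p" "k' \<in> p" "k \<noteq> k'"
      have "l \<subseteq> {}" if "l \<in> G k" "l \<in> G k'" for l
        using G(2) k that p(4)[OF k] by blast
      then show "G k \<inter> G k' = {}"
        using division_ofD(3)[OF G(1)[OF k(1)]] by auto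
    qed
    let ?G = "\<Union>k\<in>p. G k"
    have Gdiv: "?G division_of \<Union>?G"
    proof (rule division_ofI)
      show "finite ?G" using p(1) fG by auto
      show "K \<noteq> {}" "\<exists>a b. K = cbox a b" if "K \<in> ?G" for K
        using that division_ofD(3,4)[OF G(1)] by auto
      show "interior K1 \<inter> interior K2 = {}" if K: "K1 \<in> ?G" "K2 \<in> ?G" "K1 \<noteq> K2" for K1 K2
      proof -
        obtain k1 k2 where k: "k1 \<in> p" "K1 \<in> G k1" "k2 \<in> p" "K2 \<in> G k2" using K by blast
        show ?thesis
        proof (cases "k1 = k2")
          case True
          then show ?thesis using division_ofD(5)[OF G(1)[OF k(1)]] k K(3) by blast
        next
          case False
          have "K1 \<inter> K2 = {}" using G(2) k p(4)[OF k(1,3) False] by blast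
          then show ?thesis using interior_subset by blast
        qed
      qed
    qed auto
    have Gsub: "\<Union>?G \<subseteq> {a..b}"
    proof
      fix x assume "x \<in> \<Union>?G"
      then obtain k where "k \<in> p" "x \<in> \<Union>(G k)" by blast
      then have "x \<in> \<Union>p" using G(2) by blast
      then show "x \<in> {a..b}" using p(3) by fastforce
    qed
    have sumG: "(\<Sum>l\<in>?G. h l) = (\<Sum>k\<in>p. \<Sum>l\<in>G k. h l)" for h :: "real set \<Rightarrow> real"
      by (rule sum.UNION_disjoint[OF p(1) fG Gdisj])
    have "(\<Sum>k\<in>p. measure lebesgue (k - E)) = measure lebesgue (\<Union>k\<in>p. k - E)"
    proof (rule measure_finite_Union[symmetric])
      show "disjoint_family_on (\<lambda>k. k - E) p"
        using p(4) by (auto simp: disjoint_family_on_def)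
      have km: "k - E \<in> lmeasurable" if "k \<in> p" for k
        using int[OF that] E(1) by (auto intro!: fmeasurable_Diff)
      then show "(\<lambda>k. k - E) ` p \<subseteq> sets lebesgue" by blast
      show "emeasure lebesgue (k - E) \<noteq> \<infinity>" if "k \<in> p" for k
        using fmeasurableD2[OF km[OF that]] by simp
    qed (use p(1) in auto)
    also have "\<dots> \<le> measure lebesgue (T - E)"
    proof (rule measure_mono_fmeasurable)
      show "(\<Union>k\<in>p. k - E) \<subseteq> T - E" using p(3) by blast
      have "(\<Union>k\<in>p. k - E) = \<Union>p - E" by blast
      then show "(\<Union>k\<in>p. k - E) \<in> sets lebesgue" using pd(3) E(1) by auto
    qed (rule T(3))
    finally have "(\<Sum>k\<in>p. measure lebesgue (k - E)) < d/2" using mT by linarith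
    moreover have "(\<Sum>k\<in>p. r) \<le> d/2"
      using \<open>d > 0\<close> by (simp add: r_def field_simps)
    moreover have "(\<Sum>l\<in>?G. Sup l - Inf l) \<le> (\<Sum>k\<in>p. measure lebesgue (k - E) + r)"
      unfolding sumG by (rule sum_mono) (rule G(4))
    ultimately have "(\<Sum>l\<in>?G. Sup l - Inf l) < d"
      by (simp only: sum.distrib)
    from d[OF Gdiv Gsub this] have less: "(\<Sum>k\<in>p. \<Sum>l\<in>G k. norm (f (Sup l) - f (Inf l))) < c * \<eta> / 2"
      unfolding sumG .
    have "c * (\<Sum>k\<in>p. Sup k - Inf k) \<le> (\<Sum>k\<in>p. f (Sup k) - f (Inf k))"
      unfolding sum_distrib_left
    proof (rule sum_mono)
      show "c * (Sup k - Inf k) \<le> f (Sup k) - f (Inf k)" if "k \<in> p" for k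
        using p(2)[OF that] by auto
    qed
    also have "\<dots> \<le> (\<Sum>k\<in>p. \<Sum>l\<in>G k. norm (f (Sup l) - f (Inf l)))"
      by (rule sum_mono) (rule G(3))
    finally have "c * (\<Sum>k\<in>p. Sup k - Inf k) < c * (\<eta>/2)" using less by simp
    then have "measure lebesgue (\<Union>p) < \<eta>/2"
      using \<open>c > 0\<close> pd(2) by simp
    moreover have "measure lebesgue E \<le> measure lebesgue ((E - \<Union>p) \<union> \<Union>p)"
      using Em pd(3) by (intro measure_mono_fmeasurable) auto
    moreover have "\<dots> \<le> measure lebesgue (E - \<Union>p) + measure lebesgue (\<Union>p)"
      using Em pd(3) by (intro measure_Un_le) auto
    ultimately show ?thesis using p(5) by linarith
  qed
  then show ?thesis
    using Em negligible_outer_le by blast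
qed

text \<open>Slopes of at least \<open>2/\<eta>\<close> on disjoint intervals whose increments sum to
  less than 1 force a total length below \<open>\<eta>/2\<close>. The increments are that small as
  soon as all intervals lie in a window shorter than \<open>d\<close>, so the claim is shown on
  windows of length \<open>2 * d / 3\<close>; negligibility is a local property.\<close>

lemma negligible_unbounded_slopes:
  fixes f :: "real \<Rightarrow> real"
  assumes ac: "abs_continuous_on {a..b} f" and E: "E \<in> sets lebesgue" "E \<subseteq> {a<..<b}"
    and up: "\<And>x d c. x \<in> E \<Longrightarrow> d > 0 \<Longrightarrow>
       \<exists>u v. u < v \<and> u \<le> x \<and> x \<le> v \<and> v - u < d \<and> f v - f u \<ge> c * (v - u)"
  shows "negligible E"
proof -
  obtain d where "d > 0" and d: "\<And>p. p division_of \<Union>p \<Longrightarrow> \<Union>p \<subseteq> {a..b} \<Longrightarrow> (\<Sum>k\<in>p. Sup k - Inf k) < d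
       \<Longrightarrow> (\<Sum>k\<in>p. norm (f (Sup k) - f (Inf k))) < 1"
    by (rule abs_continuous_on_division[OF ac zero_less_one]) (rule that)
  have *: "negligible (E \<inter> {y - d/3<..<y + d/3})" for y
  proof -
    let ?W = "{y - d/3<..<y + d/3}"
    let ?E = "E \<inter> ?W"
    have Em: "?E \<in> lmeasurable"
      using E by (simp add: lmeasurable_Int_interval)
    have "measure lebesgue ?E \<le> \<eta>" if "\<eta> > 0" for \<eta>
    proof -
      obtain p where p: "finite p" "\<And>k. k \<in> p \<Longrightarrow> \<exists>u v. u < v \<and> f v - f u \<ge> (2/\<eta>) * (v - u) \<and> k = {u..v}"
        "\<Union>p \<subseteq> ?W \<inter> {a<..<b}" "\<And>k l. k \<in> p \<Longrightarrow> l \<in> p \<Longrightarrow> k \<noteq> l \<Longrightarrow> k \<inter> l = {}"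
        "measure lebesgue (?E - \<Union>p) < \<eta>/2"
      proof (rule Vitali_covering_intervals[OF Em, of "?W \<inter> {a<..<b}" "\<eta>/2" "\<lambda>u v. f v - f u \<ge> (2/\<eta>) * (v - u)"])
        show "?E \<subseteq> ?W \<inter> {a<..<b}" using E(2) by auto
        show "\<eta>/2 > 0" using \<open>\<eta> > 0\<close> by simp
        show "open (?W \<inter> {a<..<b})" by auto
      qed (use up in blast, rule that)
      have int: "\<And>k. k \<in> p \<Longrightarrow> \<exists>u v. u < v \<and> k = {u..v}" using p(2) by blast
      note pd = disjoint_intervals[OF p(1) int p(4)]
      have "measure lebesgue (\<Union>p) \<le> measure lebesgue ?W"
        using p(3) pd(3) by (intro measure_mono_fmeasurable) auto
      also have "\<dots> < d" using \<open>d > 0\<close> by simp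
      finally have "(\<Sum>k\<in>p. norm (f (Sup k) - f (Inf k))) < 1"
        using p(3) by (intro d[OF pd(1)]) (auto simp: pd(2)[symmetric] less_imp_le subset_iff)
      moreover have "(2/\<eta>) * (\<Sum>k\<in>p. Sup k - Inf k) \<le> (\<Sum>k\<in>p. norm (f (Sup k) - f (Inf k)))"
        unfolding sum_distrib_left
      proof (rule sum_mono)
        fix k assume "k \<in> p"
        then obtain u v where "u < v" "f v - f u \<ge> (2/\<eta>) * (v - u)" "k = {u..v}" using p(2) by blast
        then show "(2/\<eta>) * (Sup k - Inf k) \<le> norm (f (Sup k) - f (Inf k))" by simp
      qed
      ultimately have "(2/\<eta>) * measure lebesgue (\<Union>p) < 1" using pd(2) by simp
      then have "measure lebesgue (\<Union>p) < \<eta>/2" using \<open>\<eta> > 0\<close> by (simp add: field_simps)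
      moreover have "measure lebesgue ?E \<le> measure lebesgue ((?E - \<Union>p) \<union> \<Union>p)"
        using Em pd(3) by (intro measure_mono_fmeasurable) auto
      moreover have "\<dots> \<le> measure lebesgue (?E - \<Union>p) + measure lebesgue (\<Union>p)"
        using Em pd(3) by (intro measure_Un_le) auto
      ultimately show ?thesis using p(5) by linarith
    qed
    then show ?thesis
      using Em negligible_outer_le by blast
  qed
  show ?thesis
    unfolding locally_negligible_alt[of E]
  proof
    fix x assume "x \<in> E"
    then show "\<exists>U. openin (top_of_set E) U \<and> x \<in> U \<and> negligible U"
      using * \<open>d > 0\<close> by (intro exI[of _ "E \<inter> {x - d/3<..<x + d/3}"]) (auto intro: openin_open_Int)
  qed
qed

section \<open>Absolute continuity under domination, and derivatives from straddling slopes\<close>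

lemma abs_continuous_on_bound:
  fixes f :: "real \<Rightarrow> 'a::real_normed_vector" and g :: "real \<Rightarrow> 'b::real_normed_vector"
  assumes ac: "abs_continuous_on S f"
    and le: "\<And>x y. x \<in> S \<Longrightarrow> y \<in> S \<Longrightarrow> norm (g y - g x) \<le> B * norm (f y - f x) + L * \<bar>y - x\<bar>"
  shows "abs_continuous_on S g"
  unfolding abs_continuous_on_def
proof (intro allI impI)
  fix e :: real assume "e > 0"
  \<comment> \<open>Both terms of the estimate get half of \<open>e\<close>. \<open>B\<close> and
    \<open>L\<close> may have any sign, hence the absolute values; the \<open>+ 1\<close> keeps the
    denominators positive.\<close>
  define e1 where "e1 = e / (2 * (\<bar>B\<bar> + 1))"
  define d2 where "d2 = e / (2 * (\<bar>L\<bar> + 1))"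
  have pos: "e1 > 0" "d2 > 0" using \<open>e > 0\<close> by (auto simp: e1_def d2_def)
  obtain d1 where "d1 > 0" and d1: "\<forall>(n::nat) (a::nat\<Rightarrow>real) b.
        (\<forall>i<n. a i \<le> b i \<and> {a i..b i} \<subseteq> S) \<and>
        (\<forall>i<n. \<forall>j<n. i \<noteq> j \<longrightarrow> b i \<le> a j \<or> b j \<le> a i) \<and>
        (\<Sum>i<n. b i - a i) < d1 \<longrightarrow> (\<Sum>i<n. norm (f (b i) - f (a i))) < e1"
    using ac[unfolded abs_continuous_on_def, rule_format, OF pos(1)] by (elim exE conjE)
  show "\<exists>d>0. \<forall>(n::nat) (a::nat\<Rightarrow>real) b.
        (\<forall>i<n. a i \<le> b i \<and> {a i..b i} \<subseteq> S) \<and>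
        (\<forall>i<n. \<forall>j<n. i \<noteq> j \<longrightarrow> b i \<le> a j \<or> b j \<le> a i) \<and>
        (\<Sum>i<n. b i - a i) < d \<longrightarrow> (\<Sum>i<n. norm (g (b i) - g (a i))) < e"
  proof (intro exI[of _ "min d1 d2"] conjI allI impI)
    show "min d1 d2 > 0" using \<open>d1 > 0\<close> pos by simp
    fix n and a b :: "nat \<Rightarrow> real"
    assume H: "(\<forall>i<n. a i \<le> b i \<and> {a i..b i} \<subseteq> S) \<and>
        (\<forall>i<n. \<forall>j<n. i \<noteq> j \<longrightarrow> b i \<le> a j \<or> b j \<le> a i) \<and> (\<Sum>i<n. b i - a i) < min d1 d2"
    then have *: "(\<Sum>i<n. norm (f (b i) - f (a i))) < e1"
      by (intro d1[THEN spec, THEN spec, THEN spec, THEN mp]) auto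
    have "(\<Sum>i<n. norm (g (b i) - g (a i))) \<le> (\<Sum>i<n. \<bar>B\<bar> * norm (f (b i) - f (a i)) + \<bar>L\<bar> * (b i - a i))"
    proof (rule sum_mono)
      fix i assume "i \<in> {..<n}"
      then have i0: "a i \<le> b i" "{a i..b i} \<subseteq> S" using H by auto
      then have i: "a i \<in> S" "b i \<in> S" "a i \<le> b i" by auto
      have "norm (g (b i) - g (a i)) \<le> B * norm (f (b i) - f (a i)) + L * (b i - a i)"
        using le[OF i(1,2)] i(3) by simp
      also have "\<dots> \<le> \<bar>B\<bar> * norm (f (b i) - f (a i)) + \<bar>L\<bar> * (b i - a i)"
        using i(3) by (intro add_mono mult_right_mono) auto
      finally show "norm (g (b i) - g (a i)) \<le> \<bar>B\<bar> * norm (f (b i) - f (a i)) + \<bar>L\<bar> * (b i - a i)" .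
    qed
    also have "\<dots> = \<bar>B\<bar> * (\<Sum>i<n. norm (f (b i) - f (a i))) + \<bar>L\<bar> * (\<Sum>i<n. b i - a i)"
      by (simp only: sum.distrib sum_distrib_left)
    also have "\<dots> \<le> \<bar>B\<bar> * e1 + \<bar>L\<bar> * d2"
      using * H by (intro add_mono mult_left_mono) auto
    also have "\<dots> < (\<bar>B\<bar> + 1) * e1 + (\<bar>L\<bar> + 1) * d2"
      using pos by (simp add: algebra_simps)
    also have "\<dots> = e"
    proof -
      have "\<bar>B\<bar> + 1 \<noteq> 0" "\<bar>L\<bar> + 1 \<noteq> 0" by linarith+
      then have "(\<bar>B\<bar> + 1) * e1 = e/2" "(\<bar>L\<bar> + 1) * d2 = e/2"
        by (simp_all add: e1_def d2_def divide_simps)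
      then show ?thesis by simp
    qed
    finally show "(\<Sum>i<n. norm (g (b i) - g (a i))) < e" .
  qed
qed

lemma abs_continuous_on_imp_continuous_on:
  fixes f :: "real \<Rightarrow> 'a::real_normed_vector"
  assumes ac: "abs_continuous_on {a..b} f"
  shows "continuous_on {a..b} f"
proof -
  have "\<exists>d>0. \<forall>x'\<in>{a..b}. dist x' x < d \<longrightarrow> dist (f x') (f x) < e" if "e > 0" "x \<in> {a..b}" for e x
  proof -
    obtain d where "d > 0" and d: "\<And>p. p division_of \<Union>p \<Longrightarrow> \<Union>p \<subseteq> {a..b} \<Longrightarrow> (\<Sum>k\<in>p. Sup k - Inf k) < d
       \<Longrightarrow> (\<Sum>k\<in>p. norm (f (Sup k) - f (Inf k))) < e"
      by (rule abs_continuous_on_division[OF ac \<open>e > 0\<close>]) (rule that)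
    have *: "norm (f v - f u) < e" if "u \<le> v" "u \<in> {a..b}" "v \<in> {a..b}" "v - u < d" for u v
    proof -
      have "{{u..v}} division_of \<Union>{{u..v}}"
        using that division_of_self[of u v] by (simp add: cbox_interval)
      from d[OF this] show ?thesis using that by auto
    qed
    have "dist (f y) (f x) < e" if "y \<in> {a..b}" "dist y x < d" for y
      using *[of x y] *[of y x] that \<open>x \<in> {a..b}\<close>
      by (cases "x \<le> y") (auto simp: dist_norm norm_minus_commute abs_real_def split: if_splits)
    with \<open>d > 0\<close> show ?thesis by blast
  qed
  then show ?thesis unfolding continuous_on_iff by blast
qed

text \<open>A union of open intervals is open however many there are, so the set is a countable
  intersection of open sets whatever \<open>P\<close> is, and no measurability of slopes has to be
  checked. This is why the slope sets in the proof of differentiability use intervals with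
  \<open>x\<close> strictly inside.\<close>

lemma sets_borel_finely_covered:
  fixes P :: "real \<Rightarrow> real \<Rightarrow> bool"
  shows "{x. \<forall>d>0. \<exists>u v. u < x \<and> x < v \<and> v - u < d \<and> P u v} \<in> sets borel"
proof -
  let ?A = "\<lambda>n::nat. \<Union>{{u<..<v} | u v. v - u < 1 / real (Suc n) \<and> P u v}"
  have "{x. \<forall>d>0. \<exists>u v. u < x \<and> x < v \<and> v - u < d \<and> P u v} = (\<Inter>n. ?A n)"
  proof (intro set_eqI iffI)
    fix x assume x: "x \<in> {x. \<forall>d>0. \<exists>u v. u < x \<and> x < v \<and> v - u < d \<and> P u v}"
    have "x \<in> ?A n" for n
    proof -
      have "1 / real (Suc n) > 0" by simp
      then obtain u v where "u < x" "x < v" "v - u < 1 / real (Suc n)" "P u v" using x by blast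
      then show ?thesis by (intro UnionI[of "{u<..<v}"]) auto
    qed
    then show "x \<in> (\<Inter>n. ?A n)" by blast
  next
    fix x assume x: "x \<in> (\<Inter>n. ?A n)"
    have "\<exists>u v. u < x \<and> x < v \<and> v - u < d \<and> P u v" if "d > 0" for d
    proof -
      obtain n where n: "1 / real (Suc n) < d"
        using nat_approx_posE[OF \<open>d > 0\<close>] by auto
      have "x \<in> ?A n" using x by blast
      then obtain u v where "u < x" "x < v" "v - u < 1 / real (Suc n)" "P u v" by auto
      with n show ?thesis by (intro exI[of _ u] exI[of _ v]) simp
    qed
    then show "x \<in> {x. \<forall>d>0. \<exists>u v. u < x \<and> x < v \<and> v - u < d \<and> P u v}" by blast
  qed
  moreover have "open (?A n)" for n by (rule open_Union) auto
  ultimately show ?thesis by simp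
qed

text \<open>Intervals with \<open>x\<close> strictly inside give no difference quotient based at
  \<open>x\<close>. Continuity repairs this: one endpoint \<open>y\<close> stays fixed, the other
  tends to \<open>x\<close> from the opposite side, and the estimate passes to the limit.\<close>

lemma has_real_derivative_straddle:
  fixes f :: "real \<Rightarrow> real"
  assumes cont: "isCont f x"
    and str: "\<And>e. e > 0 \<Longrightarrow> \<exists>d>0. \<forall>u v. u < x \<longrightarrow> x < v \<longrightarrow> v - u < d \<longrightarrow> \<bar>f v - f u - L * (v - u)\<bar> \<le> e * (v - u)"
  shows "(f has_real_derivative L) (at x)"
proof -
  have "\<exists>d>0. \<forall>y. norm (y - x) < d \<longrightarrow> norm (f y - f x - L * (y - x)) \<le> e * norm (y - x)" if "e > 0" for e
  proof -
    note epos = that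
    obtain d where "d > 0" and d: "\<And>u v. u < x \<Longrightarrow> x < v \<Longrightarrow> v - u < d \<Longrightarrow> \<bar>f v - f u - L * (v - u)\<bar> \<le> e * (v - u)"
      using str[OF epos] by blast
    have lim: "(f \<longlongrightarrow> f x) (at_left x)" "(f \<longlongrightarrow> f x) (at_right x)"
      using cont by (auto simp: isCont_def filterlim_at_split)
    have "\<bar>f y - f x - L * (y - x)\<bar> \<le> e * \<bar>y - x\<bar>" if y: "\<bar>y - x\<bar> < d" for y
    proof -
      consider "y = x" | "y > x" | "y < x" by linarith
      then show ?thesis
      proof cases
        case 2
        have "\<bar>f y - f x - L * (y - x)\<bar> \<le> e * (y - x)"
        proof (rule tendsto_le[OF trivial_limit_at_left_real])
          show "((\<lambda>u. e * (y - u)) \<longlongrightarrow> e * (y - x)) (at_left x)" by (intro tendsto_intros)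
          show "((\<lambda>u. \<bar>f y - f u - L * (y - u)\<bar>) \<longlongrightarrow> \<bar>f y - f x - L * (y - x)\<bar>) (at_left x)"
            by (intro tendsto_intros lim)
          have "eventually (\<lambda>u. u \<in> {y - d<..<x}) (at_left x)"
            using y 2 by (intro eventually_at_leftI[of "y - d"]) auto
          then show "\<forall>\<^sub>F u in at_left x. \<bar>f y - f u - L * (y - u)\<bar> \<le> e * (y - u)"
            by eventually_elim (use 2 in \<open>intro d, auto\<close>)
        qed
        then show ?thesis using 2 by simp
      next
        case 3
        have "\<bar>f x - f y - L * (x - y)\<bar> \<le> e * (x - y)"
        proof (rule tendsto_le[OF trivial_limit_at_right_real])
          show "((\<lambda>u. e * (u - y)) \<longlongrightarrow> e * (x - y)) (at_right x)" by (intro tendsto_intros)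
          show "((\<lambda>u. \<bar>f u - f y - L * (u - y)\<bar>) \<longlongrightarrow> \<bar>f x - f y - L * (x - y)\<bar>) (at_right x)"
            by (intro tendsto_intros lim)
          have "eventually (\<lambda>u. u \<in> {x<..<y + d}) (at_right x)"
            using y 3 by (intro eventually_at_rightI[of _ "y + d"]) auto
          then show "\<forall>\<^sub>F u in at_right x. \<bar>f u - f y - L * (u - y)\<bar> \<le> e * (u - y)"
            by eventually_elim (use 3 in \<open>intro d, auto\<close>)
        qed
        moreover have "f y - f x - L * (y - x) = - (f x - f y - L * (x - y))" by (simp add: algebra_simps)
        ultimately show ?thesis using 3 by simp
      qed simp
    qed
    with \<open>d > 0\<close> show ?thesis by auto
  qed
  then show ?thesis
    unfolding has_field_derivative_def has_derivative_at_alt by (auto intro: bounded_linear_mult_right)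
qed

text \<open>For \<open>p < q\<close> the points common to \<open>U q\<close> and \<open>D p\<close>
  form a null set; so do the points in all \<open>U (real n)\<close> and the points in all
  \<open>D (- real n)\<close>. Elsewhere the upper and the lower limit of the slopes over shrinking
  intervals are finite and agree, and their common value is the derivative.\<close>

lemma abs_continuous_differentiable_ae_real:
  fixes f :: "real \<Rightarrow> real"
  assumes ac: "abs_continuous_on {a..b} f"
  shows "negligible {x\<in>{a<..<b}. \<not> f differentiable (at x)}"
proof -
  define U where "U q = {x. \<forall>d>0. \<exists>u v. u < x \<and> x < v \<and> v - u < d \<and> f v - f u \<ge> q * (v - u)}" for q
  define D where "D q = {x. \<forall>d>0. \<exists>u v. u < x \<and> x < v \<and> v - u < d \<and> f v - f u \<le> q * (v - u)}" for q
  have UD: "U q \<in> sets borel" "D q \<in> sets borel" for q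
    unfolding U_def D_def by (rule sets_borel_finely_covered)+
  \<comment> \<open>Subtracting \<open>p * x\<close> lowers all slopes by \<open>p\<close>: at least
    \<open>q\<close> becomes at least \<open>q - p > 0\<close>, and at most \<open>p\<close> becomes
    nonpositive.\<close>
  have 1: "negligible (U q \<inter> D p \<inter> {a<..<b})" if "p < q" for p q
  proof (rule negligible_slopes_of_both_signs[of a b "\<lambda>x. f x - p * x" _ "q - p"])
    have "norm (f y - p * y - (f x - p * x)) \<le> 1 * norm (f y - f x) + \<bar>p\<bar> * \<bar>y - x\<bar>" for x y
    proof -
      have "norm (f y - p * y - (f x - p * x)) = norm ((f y - f x) - p * (y - x))"
        by (simp add: algebra_simps)
      also have "\<dots> \<le> norm (f y - f x) + norm (p * (y - x))" by (rule norm_triangle_ineq4)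
      finally show ?thesis by (simp add: abs_mult)
    qed
    then show "abs_continuous_on {a..b} (\<lambda>x. f x - p * x)"
      by (intro abs_continuous_on_bound[OF ac])
    show "U q \<inter> D p \<inter> {a<..<b} \<in> sets lebesgue" using UD by auto
    fix x d :: real assume x: "x \<in> U q \<inter> D p \<inter> {a<..<b}" and "d > 0"
    from x have xU: "x \<in> U q" and xD: "x \<in> D p" by auto
    from xU \<open>d > 0\<close> obtain u v where "u < x" "x < v" "v - u < d" "f v - f u \<ge> q * (v - u)"
      unfolding U_def by blast
    then show "\<exists>u v. u < v \<and> u \<le> x \<and> x \<le> v \<and> v - u < d \<and> (q - p) * (v - u) \<le> f v - p * v - (f u - p * u)"
      by (intro exI[of _ u] exI[of _ v]) (auto simp: algebra_simps)
    from xD \<open>d > 0\<close> obtain u v where "u < x" "x < v" "v - u < d" "f v - f u \<le> p * (v - u)"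
      unfolding D_def by blast
    then show "\<exists>u v. u < v \<and> u \<le> x \<and> x \<le> v \<and> v - u < d \<and> f v - p * v - (f u - p * u) \<le> 0"
      by (intro exI[of _ u] exI[of _ v]) (auto simp: algebra_simps)
  qed (use \<open>p < q\<close> in auto)
  have dec: "U q \<subseteq> U p" "D p \<subseteq> D q" if "p \<le> q" for p q
  proof -
    have le: "p * (v - u) \<le> q * (v - u)" if "u < x" "x < v" for u v x
      using that \<open>p \<le> q\<close> by (intro mult_right_mono) auto
    show "U q \<subseteq> U p"
    proof
      fix x assume xU: "x \<in> U q"
      have "\<exists>u v. u < x \<and> x < v \<and> v - u < d \<and> f v - f u \<ge> p * (v - u)" if "d > 0" for d
      proof -
        obtain u v where "u < x" "x < v" "v - u < d" "f v - f u \<ge> q * (v - u)"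
          using xU \<open>d > 0\<close> unfolding U_def by blast
        with le[OF \<open>u < x\<close> \<open>x < v\<close>] show ?thesis by (intro exI[of _ u] exI[of _ v] conjI) linarith+
      qed
      then show "x \<in> U p" by (simp add: U_def)
    qed
    show "D p \<subseteq> D q"
    proof
      fix x assume xD: "x \<in> D p"
      have "\<exists>u v. u < x \<and> x < v \<and> v - u < d \<and> f v - f u \<le> q * (v - u)" if "d > 0" for d
      proof -
        obtain u v where "u < x" "x < v" "v - u < d" "f v - f u \<le> p * (v - u)"
          using xD \<open>d > 0\<close> unfolding D_def by blast
        with le[OF \<open>u < x\<close> \<open>x < v\<close>] show ?thesis by (intro exI[of _ u] exI[of _ v] conjI) linarith+
      qed
      then show "x \<in> D q" by (simp add: D_def)
    qed
  qed
  have 2: "negligible ((\<Inter>n::nat. U (real n)) \<inter> {a<..<b})"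
  proof (rule negligible_unbounded_slopes[OF ac])
    show "(\<Inter>n::nat. U (real n)) \<inter> {a<..<b} \<in> sets lebesgue"
      using UD by (intro sets.Int sets.countable_INT) auto
    fix x d c assume x: "x \<in> (\<Inter>n::nat. U (real n)) \<inter> {a<..<b}" "(d::real) > 0"
    obtain n where "c \<le> real n" using real_arch_simple by blast
    then have "x \<in> U c" using dec(1) x by blast
    then obtain u v where "u < x" "x < v" "v - u < d" "f v - f u \<ge> c * (v - u)"
      unfolding U_def using \<open>d > 0\<close> by blast
    then show "\<exists>u v. u < v \<and> u \<le> x \<and> x \<le> v \<and> v - u < d \<and> c * (v - u) \<le> f v - f u"
      by (intro exI[of _ u] exI[of _ v]) auto
  qed auto
  have 3: "negligible ((\<Inter>n::nat. D (- real n)) \<inter> {a<..<b})"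
  proof (rule negligible_unbounded_slopes[of a b "\<lambda>x. - f x"])
    show "abs_continuous_on {a..b} (\<lambda>x. - f x)"
      by (rule abs_continuous_on_bound[OF ac, of _ 1 0]) auto
    show "(\<Inter>n::nat. D (- real n)) \<inter> {a<..<b} \<in> sets lebesgue"
      using UD by (intro sets.Int sets.countable_INT) auto
    fix x d c assume x: "x \<in> (\<Inter>n::nat. D (- real n)) \<inter> {a<..<b}" "(d::real) > 0"
    obtain n where "c \<le> real n" using real_arch_simple by blast
    then have "- real n \<le> - c" by simp
    then have "x \<in> D (- c)" using dec(2) x by blast
    then obtain u v where "u < x" "x < v" "v - u < d" "f v - f u \<le> - c * (v - u)"
      unfolding D_def using \<open>d > 0\<close> by blast
    then show "\<exists>u v. u < v \<and> u \<le> x \<and> x \<le> v \<and> v - u < d \<and> c * (v - u) \<le> - f v - - f u"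
      by (intro exI[of _ u] exI[of _ v]) auto
  qed auto
  define Z where "Z = (\<Union>(p,q)\<in>{(p,q). p \<in> \<rat> \<and> q \<in> \<rat> \<and> p < q}. U q \<inter> D p \<inter> {a<..<b})"
  have "countable {(p::real,q). p \<in> \<rat> \<and> q \<in> \<rat> \<and> p < q}"
    by (rule countable_subset[of _ "\<rat> \<times> \<rat>"]) (auto simp: countable_rat)
  then have "negligible Z"
    unfolding Z_def using 1 by (intro negligible_countable_Union) auto
  moreover have "{x\<in>{a<..<b}. \<not> f differentiable (at x)} \<subseteq>
     Z \<union> ((\<Inter>n::nat. U (real n)) \<inter> {a<..<b}) \<union> ((\<Inter>n::nat. D (- real n)) \<inter> {a<..<b})"
  proof (rule subsetI, rule ccontr)
    fix x assume x: "x \<in> {x\<in>{a<..<b}. \<not> f differentiable (at x)}"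
      and nx: "x \<notin> Z \<union> ((\<Inter>n::nat. U (real n)) \<inter> {a<..<b}) \<union> ((\<Inter>n::nat. D (- real n)) \<inter> {a<..<b})"
    have nZ: "x \<notin> D p" if "p \<in> \<rat>" "q \<in> \<rat>" "p < q" "x \<in> U q" for p q
      using nx x that unfolding Z_def by blast
    \<comment> \<open>The infimum of \<open>A\<close> is the upper limit of the slopes at
      \<open>x\<close>. \<open>A\<close> is nonempty and bounded below because \<open>x\<close>
      avoids the two null sets of unbounded slopes.\<close>
    define A where "A = {q. x \<notin> U q}"
    obtain q0 p0 where q0: "q0 \<in> A" and p0: "x \<notin> D p0"
      using nx x unfolding A_def by blast
    have lb: "p0 \<le> q" if qA: "q \<in> A" for q
    proof (rule ccontr)
      assume c: "\<not> p0 \<le> q"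
      obtain d1 where d1: "d1 > 0" "\<And>u v. u < x \<Longrightarrow> x < v \<Longrightarrow> v - u < d1 \<Longrightarrow> f v - f u < q * (v - u)"
        using qA unfolding A_def U_def by (auto simp: not_le)
      obtain d2 where d2: "d2 > 0" "\<And>u v. u < x \<Longrightarrow> x < v \<Longrightarrow> v - u < d2 \<Longrightarrow> f v - f u > p0 * (v - u)"
        using p0 unfolding D_def by (auto simp: not_le)
      \<comment> \<open>The interval \<open>{x - h..x + h}\<close> has length \<open>2 * h\<close>,
        below both \<open>d1\<close> and \<open>d2\<close>, so both slope bounds apply to it and
        contradict each other.\<close>
      define h where "h = min d1 d2 / 3"
      have "h > 0" "2 * h < d1" "2 * h < d2" using d1(1) d2(1) by (auto simp: h_def)
      then have "f (x + h) - f (x - h) < q * (2*h)" "p0 * (2*h) < f (x + h) - f (x - h)"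
        using d1(2)[of "x - h" "x + h"] d2(2)[of "x - h" "x + h"] by simp_all
      then have "p0 * (2*h) < q * (2*h)" by linarith
      then show False using c \<open>h > 0\<close> by (simp add: mult_less_cancel_right)
    qed
    define L where "L = Inf A"
    have bdd: "bdd_below A" using lb by (rule bdd_belowI)
    have up: "x \<notin> U q" if qL: "q > L" for q
    proof -
      obtain q' where "q' \<in> A" "q' < q"
        using qL cInf_lessD[of A q] q0 unfolding L_def by blast
      then show ?thesis using dec(1)[of q' q] unfolding A_def by auto
    qed
    have lo: "x \<notin> D p" if pL: "p < L" for p
    proof -
      \<comment> \<open>Two rationals are needed between \<open>p\<close> and \<open>L\<close>:
        \<open>x\<close> belongs to \<open>U q'\<close> because \<open>q' < L\<close>, and then
        \<open>Z\<close> excludes \<open>D p'\<close> for the smaller one.\<close>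
      obtain p' where p': "p' \<in> \<rat>" "p < p'" "p' < L" using Rats_dense_in_real[OF pL] by blast
      obtain q' where q': "q' \<in> \<rat>" "p' < q'" "q' < L" using Rats_dense_in_real[OF p'(3)] by blast
      have "q' \<notin> A"
        using cInf_lower[OF _ bdd, of q'] q'(3) unfolding L_def by auto
      then have "x \<in> U q'" by (simp add: A_def)
      then have "x \<notin> D p'" using nZ p' q' by blast
      then show ?thesis using dec(2)[of p p'] p'(2) by auto
    qed
    have "(f has_real_derivative L) (at x)"
    proof (rule has_real_derivative_straddle)
      show "isCont f x"
        using abs_continuous_on_imp_continuous_on[OF ac] x
        by (intro continuous_on_interior[of "{a..b}"]) auto
      fix e :: real assume "e > 0"
      obtain d1 where d1: "d1 > 0" "\<And>u v. u < x \<Longrightarrow> x < v \<Longrightarrow> v - u < d1 \<Longrightarrow> f v - f u < (L + e) * (v - u)"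
        using up[of "L + e"] \<open>e > 0\<close> unfolding U_def by (auto simp: not_le)
      obtain d2 where d2: "d2 > 0" "\<And>u v. u < x \<Longrightarrow> x < v \<Longrightarrow> v - u < d2 \<Longrightarrow> f v - f u > (L - e) * (v - u)"
        using lo[of "L - e"] \<open>e > 0\<close> unfolding D_def by (auto simp: not_le)
      show "\<exists>d>0. \<forall>u v. u < x \<longrightarrow> x < v \<longrightarrow> v - u < d \<longrightarrow> \<bar>f v - f u - L * (v - u)\<bar> \<le> e * (v - u)"
      proof (intro exI[of _ "min d1 d2"] conjI allI impI)
        show "min d1 d2 > 0" using d1(1) d2(1) by simp
        fix u v assume "u < x" "x < v" "v - u < min d1 d2"
        then show "\<bar>f v - f u - L * (v - u)\<bar> \<le> e * (v - u)"
          using d1(2)[of u v] d2(2)[of u v] by (auto simp: abs_le_iff algebra_simps)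
      qed
    qed
    then show False using x real_differentiable_def by blast
  qed
  ultimately show ?thesis
    using 2 3 by (meson negligible_Un negligible_subset)
qed

lemma abs_continuous_differentiable_ae:
  fixes f :: "real \<Rightarrow> 'a::euclidean_space"
  assumes ac: "abs_continuous_on {a..b} f"
  shows "negligible {x\<in>{a..b}. \<not> f differentiable (at x within {a..b})}"
proof -
  have aci: "abs_continuous_on {a..b} (\<lambda>x. f x \<bullet> i)" if "i \<in> Basis" for i
  proof (rule abs_continuous_on_bound[OF ac, of _ 1 0])
    show "norm (f y \<bullet> i - f x \<bullet> i) \<le> 1 * norm (f y - f x) + 0 * \<bar>y - x\<bar>" for x y
      using Basis_le_norm[OF that, of "f y - f x"] by (simp add: inner_diff_left)
  qed
  \<comment> \<open>The real-valued result concerns two-sided derivatives in the open interval, so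
    the endpoints join the null set.\<close>
  let ?Z = "{a} \<union> ({b} \<union> (\<Union>i\<in>Basis. {x\<in>{a<..<b}. \<not> (\<lambda>x. f x \<bullet> i) differentiable (at x)}))"
  have "negligible ?Z"
    using abs_continuous_differentiable_ae_real[OF aci] by (intro negligible_Un negligible_Union) auto
  moreover have "{x\<in>{a..b}. \<not> f differentiable (at x within {a..b})} \<subseteq> ?Z"
  proof
    fix x assume "x \<in> {x\<in>{a..b}. \<not> f differentiable (at x within {a..b})}"
    then have x: "x \<in> {a..b}" "\<not> f differentiable (at x within {a..b})" by auto
    then obtain i where i: "i \<in> Basis" "\<not> (\<lambda>x. f x \<bullet> i) differentiable (at x within {a..b})"
      using differentiable_componentwise_within[of f x "{a..b}"] by blast
    then have "\<not> (\<lambda>x. f x \<bullet> i) differentiable (at x)"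
      using differentiable_at_withinI by blast
    then show "x \<in> ?Z" using i x by auto
  qed
  ultimately show ?thesis by (rule negligible_subset)
qed

section \<open>The fundamental theorem of calculus for absolutely continuous functions\<close>

text \<open>The linearization errors at \<open>u\<close> and at \<open>v\<close> are subtracted;
  since \<open>x\<close> lies between the two points, their bounds add up to exactly
  \<open>e * (v - u)\<close>.\<close>

lemma has_vector_derivative_straddle:
  fixes f :: "real \<Rightarrow> 'a::real_normed_vector"
  assumes der: "(f has_vector_derivative D) (at x within S)" and x: "x \<in> S" and "e > 0"
  obtains d where "d > 0" "\<And>u v. u \<in> S \<Longrightarrow> v \<in> S \<Longrightarrow> u \<le> x \<Longrightarrow> x \<le> v \<Longrightarrow> v - u < d \<Longrightarrow>
    norm (f v - f u - (v - u) *\<^sub>R D) \<le> e * (v - u)"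
proof -
  obtain d where "d > 0" and d: "\<And>y. y \<in> S \<Longrightarrow> \<bar>y - x\<bar> < d \<Longrightarrow> norm (f y - f x - (y - x) *\<^sub>R D) \<le> e * \<bar>y - x\<bar>"
    using der \<open>e > 0\<close> unfolding has_vector_derivative_def has_derivative_within_alt by fastforce
  show thesis
  proof (rule that[OF \<open>d > 0\<close>])
    fix u v assume uv: "u \<in> S" "v \<in> S" "u \<le> x" "x \<le> v" "v - u < d"
    have "norm ((f v - f x - (v - x) *\<^sub>R D) - (f u - f x - (u - x) *\<^sub>R D)) \<le> e * \<bar>v - x\<bar> + e * \<bar>u - x\<bar>"
      using d[of v] d[of u] uv norm_triangle_ineq4[of "f v - f x - (v - x) *\<^sub>R D" "f u - f x - (u - x) *\<^sub>R D"] by linarith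
    also have "\<dots> = e * (v - u)" using uv by (simp add: algebra_simps)
    also have "(f v - f x - (v - x) *\<^sub>R D) - (f u - f x - (u - x) *\<^sub>R D) = f v - f u - (v - u) *\<^sub>R D"
      by (simp add: algebra_simps)
    finally show "norm (f v - f u - (v - u) *\<^sub>R D) \<le> e * (v - u)" .
  qed
qed

text \<open>The gauge is the straddle gauge off \<open>Z\<close>; tags in \<open>Z\<close> are confined to an open set of small measure, where absolute
  continuity controls the increments.\<close>

lemma abs_continuous_has_integral:
  fixes f :: "real \<Rightarrow> 'a::euclidean_space"
  assumes ac: "abs_continuous_on {a..b} f" and "a \<le> b" and Z: "negligible Z"
    and der: "\<And>x. x \<in> {a..b} - Z \<Longrightarrow> (f has_vector_derivative g x) (at x within {a..b})"
  shows "(g has_integral f b - f a) {a..b}"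
proof -
  \<comment> \<open>The values of \<open>g\<close> on \<open>Z\<close> are arbitrary. Setting them
    to 0 leaves only the increments of \<open>f\<close> to be estimated at tags in
    \<open>Z\<close>.\<close>
  define h where "h x = (if x \<in> Z then 0 else g x)" for x
  have "(h has_integral f b - f a) (cbox a b)"
    unfolding has_integral
  proof (intro allI impI)
    fix e :: real assume "e > 0"
    obtain d where "d > 0" and d: "\<And>p. p division_of \<Union>p \<Longrightarrow> \<Union>p \<subseteq> {a..b} \<Longrightarrow> (\<Sum>k\<in>p. Sup k - Inf k) < d
       \<Longrightarrow> (\<Sum>k\<in>p. norm (f (Sup k) - f (Inf k))) < e/2"
    proof (rule abs_continuous_on_division[OF ac])
      show "e/2 > 0" using \<open>e > 0\<close> by simp
    qed (rule that)
    have Zs: "Z \<in> sets lebesgue" using Z by (rule negligible_imp_sets)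
    obtain T where T: "open T" "Z \<subseteq> T" "(T - Z) \<in> lmeasurable" "emeasure lebesgue (T - Z) < ennreal d"
      using sets_lebesgue_outer_open[OF Zs \<open>d > 0\<close>] by blast
    have Tm: "T \<in> lmeasurable"
      using fmeasurable.Un[OF T(3) negligible_imp_measurable[OF Z]] T(2) by (simp add: Un_absorb2)
    have "measure lebesgue T = measure lebesgue (T - Z)"
      using Z by (simp add: measure_Diff_null_set negligible_iff_null_sets fmeasurableD[OF Tm])
    then have mT: "measure lebesgue T < d"
      using T(3,4) \<open>d > 0\<close> by (simp add: emeasure_eq_measure2 ennreal_less_iff)
    \<comment> \<open>Summed over a division, the errors off \<open>Z\<close> amount to at most
      \<open>e1 * (b - a) < e/2\<close>; the \<open>+ 1\<close> allows \<open>a = b\<close>.\<close>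
    define e1 where "e1 = e / (2 * (b - a + 1))"
    have "e1 > 0" using \<open>e > 0\<close> \<open>a \<le> b\<close> by (simp add: e1_def)
    have "\<exists>\<delta>>0. x \<in> {a..b} - Z \<longrightarrow> (\<forall>u\<in>{a..b}. \<forall>v\<in>{a..b}. u \<le> x \<longrightarrow> x \<le> v \<longrightarrow> v - u < \<delta> \<longrightarrow>
        norm (f v - f u - (v - u) *\<^sub>R g x) \<le> e1 * (v - u))" for x
    proof (cases "x \<in> {a..b} - Z")
      case True
      then have x: "x \<in> {a..b}" by blast
      obtain \<delta> where "\<delta> > 0" "\<And>u v. u \<in> {a..b} \<Longrightarrow> v \<in> {a..b} \<Longrightarrow> u \<le> x \<Longrightarrow> x \<le> v \<Longrightarrow> v - u < \<delta> \<Longrightarrow>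
        norm (f v - f u - (v - u) *\<^sub>R g x) \<le> e1 * (v - u)"
        by (rule has_vector_derivative_straddle[OF der[OF True] x \<open>e1 > 0\<close>]) (rule that)
      then show ?thesis by (intro exI[of _ \<delta>]) simp
    qed (auto intro: exI[of _ 1])
    then have "\<forall>x. \<exists>\<delta>>0. x \<in> {a..b} - Z \<longrightarrow> (\<forall>u\<in>{a..b}. \<forall>v\<in>{a..b}. u \<le> x \<longrightarrow> x \<le> v \<longrightarrow> v - u < \<delta> \<longrightarrow>
        norm (f v - f u - (v - u) *\<^sub>R g x) \<le> e1 * (v - u))" by (rule allI)
    from choice[OF this] obtain \<delta> where \<delta>: "\<And>x. \<delta> x > 0"
      "\<And>x u v. x \<in> {a..b} - Z \<Longrightarrow> u \<in> {a..b} \<Longrightarrow> v \<in> {a..b} \<Longrightarrow> u \<le> x \<Longrightarrow> x \<le> v \<Longrightarrow> v - u < \<delta> x \<Longrightarrow>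
        norm (f v - f u - (v - u) *\<^sub>R g x) \<le> e1 * (v - u)"
      by blast
    define \<gamma> where "\<gamma> x = (if x \<in> Z then T else ball x (\<delta> x / 2))" for x
    have "gauge \<gamma>"
      using T(1,2) \<delta>(1) by (auto simp: gauge_def \<gamma>_def)
    moreover have "norm ((\<Sum>(x,k)\<in>D. measure lborel k *\<^sub>R h x) - (f b - f a)) < e"
      if D: "D tagged_division_of cbox a b" and fine: "\<gamma> fine D" for D
    proof -
      define D1 where "D1 = {(x,k)\<in>D. x \<in> Z}"
      have fD: "finite D" and D1D: "D1 \<subseteq> D" using D by (auto simp: D1_def)
      have box: "\<exists>u v. u \<le> v \<and> u \<le> x \<and> x \<le> v \<and> a \<le> u \<and> v \<le> b \<and> k = {u..v}" if xk: "(x,k) \<in> D" for x k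
      proof -
        obtain u v where uv: "k = cbox u v" using tagged_division_ofD(4)[OF D xk] by blast
        moreover have "x \<in> k" "k \<subseteq> cbox a b" using tagged_division_ofD(2,3)[OF D xk] by auto
        ultimately show ?thesis by (intro exI[of _ u] exI[of _ v]) (auto simp: cbox_interval)
      qed
      have D1t: "D1 tagged_division_of \<Union>(snd ` D1)"
        using tagged_partial_division_of_Union_self tagged_partial_division_subset[OF _ D1D] D
        unfolding tagged_division_of_def by blast
      have D1d: "snd ` D1 division_of \<Union>(snd ` D1)"
        by (rule division_of_tagged_division[OF D1t])
      have D1sub: "\<Union>(snd ` D1) \<subseteq> {a..b}" "\<Union>(snd ` D1) \<subseteq> T"
      proof -
        show "\<Union>(snd ` D1) \<subseteq> {a..b}" using tagged_division_ofD(3)[OF D] D1D by fastforce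
        show "\<Union>(snd ` D1) \<subseteq> T" using fine unfolding fine_def \<gamma>_def D1_def by fastforce
      qed
      have len: "Sup k - Inf k = measure lborel k" if "k \<in> snd ` D" for k
        using box that by fastforce
      \<comment> \<open>A cell carries two tags only if it is degenerate, where \<open>F\<close>
        vanishes, so the sum over tagged pairs is a sum over cells. In \<open>?d\<close> the empty
        set gets the value 0 because \<open>Sup {}\<close> and \<open>Inf {}\<close> are
        unspecified, whereas the library lemma asks for 0 on every box without interior.\<close>
      have over: "(\<Sum>(x,k)\<in>D1. F (Sup k) (Inf k)) = (\<Sum>k\<in>snd ` D1. F (Sup k) (Inf k))"
        if "\<And>u. F u u = 0" for F :: "real \<Rightarrow> real \<Rightarrow> real"
      proof -
        let ?d = "\<lambda>k. if k = {} then 0 else F (Sup k) (Inf k)"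
        have "(\<Sum>(x,k)\<in>D1. ?d k) = (\<Sum>k\<in>snd ` D1. ?d k)"
        proof (rule sum.over_tagged_division_lemma[OF D1t])
          fix u v :: real assume "box u v = {}"
          then have "cbox u v = {} \<or> u = v" by (auto simp: cbox_interval box_real)
          then show "?d (cbox u v) = 0" using that by auto
        qed
        moreover have "k \<noteq> {}" if "k \<in> snd ` D1" for k
          using division_ofD(3)[OF D1d that] .
        ultimately show ?thesis by (simp add: case_prod_unfold)
      qed
      have "(\<Sum>k\<in>snd ` D1. Sup k - Inf k) = measure lebesgue (\<Union>(snd ` D1))"
      proof -
        have "(\<Sum>k\<in>snd ` D1. Sup k - Inf k) = (\<Sum>k\<in>snd ` D1. measure lebesgue k)"
          using len D1D box by (intro sum.cong) fastforce+
        also have "\<dots> = measure lebesgue (\<Union>(snd ` D1))"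
          using content_division[OF D1d] by simp
        finally show ?thesis .
      qed
      also have "\<dots> \<le> measure lebesgue T"
        using D1sub(2) Tm lmeasurable_division[OF D1d] by (intro measure_mono_fmeasurable) auto
      finally have "(\<Sum>k\<in>snd ` D1. norm (f (Sup k) - f (Inf k))) < e/2"
        using mT by (intro d[OF D1d D1sub(1)]) linarith
      then have Z1: "(\<Sum>(x,k)\<in>D1. norm (measure lborel k *\<^sub>R h x - (f (Sup k) - f (Inf k)))) < e/2"
      proof -
        have "(\<Sum>(x,k)\<in>D1. norm (measure lborel k *\<^sub>R h x - (f (Sup k) - f (Inf k)))) = (\<Sum>(x,k)\<in>D1. norm (f (Sup k) - f (Inf k)))"
          by (rule sum.cong) (auto simp: D1_def h_def norm_minus_commute)
        then show ?thesis
          using over[of "\<lambda>u v. norm (f u - f v)"] \<open>(\<Sum>k\<in>snd ` D1. norm (f (Sup k) - f (Inf k))) < e/2\<close> by simp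
      qed
      have Z2: "(\<Sum>(x,k)\<in>D - D1. norm (measure lborel k *\<^sub>R h x - (f (Sup k) - f (Inf k)))) \<le> (\<Sum>(x,k)\<in>D - D1. e1 * measure lborel k)"
      proof (rule sum_mono, clarify)
        fix x k assume xk: "(x,k) \<in> D" and "(x,k) \<notin> D1"
        then have xZ: "x \<notin> Z" by (auto simp: D1_def)
        obtain u v where uv: "u \<le> v" "u \<le> x" "x \<le> v" "a \<le> u" "v \<le> b" "k = {u..v}" using box[OF xk] by blast
        have "{u..v} \<subseteq> ball x (\<delta> x / 2)" using fine xk xZ uv(6) unfolding fine_def \<gamma>_def by fastforce
        moreover have "u \<in> {u..v}" "v \<in> {u..v}" using uv by auto
        ultimately have "u \<in> ball x (\<delta> x / 2)" "v \<in> ball x (\<delta> x / 2)" by blast+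
        then have "\<bar>x - u\<bar> < \<delta> x / 2" "\<bar>x - v\<bar> < \<delta> x / 2" by (auto simp: dist_real_def)
        then have "v - u < \<delta> x" by linarith
        then have "norm (f v - f u - (v - u) *\<^sub>R g x) \<le> e1 * (v - u)"
          using uv xZ by (intro \<delta>(2)) auto
        then have "norm ((v - u) *\<^sub>R h x - (f v - f u)) \<le> e1 * (v - u)"
          using xZ by (simp add: h_def norm_minus_commute)
        then show "norm (measure lborel k *\<^sub>R h x - (f (Sup k) - f (Inf k))) \<le> e1 * measure lborel k"
          using uv by simp
      qed
      also have "\<dots> \<le> (\<Sum>(x,k)\<in>D. e1 * measure lborel k)"
        using fD \<open>e1 > 0\<close> by (intro sum_mono2) auto
      also have "\<dots> = e1 * (b - a)"
        using additive_content_tagged_division[OF D] \<open>a \<le> b\<close>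
        by (simp add: sum_distrib_left[symmetric] case_prod_unfold)
      also have "\<dots> < e/2"
        using \<open>e > 0\<close> \<open>a \<le> b\<close> by (simp add: e1_def field_simps)
      finally have Z3: "(\<Sum>(x,k)\<in>D - D1. norm (measure lborel k *\<^sub>R h x - (f (Sup k) - f (Inf k)))) < e/2" .
      have "(\<Sum>(x,k)\<in>D. measure lborel k *\<^sub>R h x) - (f b - f a) = (\<Sum>(x,k)\<in>D. measure lborel k *\<^sub>R h x - (f (Sup k) - f (Inf k)))"
        using additive_tagged_division_1[OF \<open>a \<le> b\<close>, of D f] D
        by (simp add: sum_subtractf case_prod_unfold cbox_interval)
      also have "norm \<dots> \<le> (\<Sum>(x,k)\<in>D. norm (measure lborel k *\<^sub>R h x - (f (Sup k) - f (Inf k))))"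
        using norm_sum[of "\<lambda>(x,k). measure lborel k *\<^sub>R h x - (f (Sup k) - f (Inf k))" D]
        by (simp add: case_prod_unfold)
      also have "\<dots> = (\<Sum>(x,k)\<in>D - D1. norm (measure lborel k *\<^sub>R h x - (f (Sup k) - f (Inf k)))) + (\<Sum>(x,k)\<in>D1. norm (measure lborel k *\<^sub>R h x - (f (Sup k) - f (Inf k))))"
        by (rule sum.subset_diff[OF D1D fD])
      also have "\<dots> < e" using Z1 Z3 by linarith
      finally show ?thesis .
    qed
    ultimately show "\<exists>\<gamma>. gauge \<gamma> \<and> (\<forall>\<D>. \<D> tagged_division_of cbox a b \<and> \<gamma> fine \<D> \<longrightarrow>
        norm ((\<Sum>(x,k)\<in>\<D>. measure lborel k *\<^sub>R h x) - (f b - f a)) < e)"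
      by (intro exI[of _ \<gamma>]) simp
  qed
  then show ?thesis
    unfolding cbox_interval
    by (rule has_integral_spike[OF Z, rotated]) (auto simp: h_def)
qed

section \<open>Matrices and linear flows\<close>

text \<open>On intervals of length at most \<open>1 / p\<close> the increment is at most half of the maximum of \<open>norm \<circ> v\<close>, so \<open>norm \<circ> v\<close> varies by a
  factor of at most 2 there. This replaces Gronwall's inequality and also bounds from below.\<close>

lemma norm_growth_bound:
  fixes v :: "real \<Rightarrow> 'a::real_normed_vector"
  assumes cont: "continuous_on {0..1} v" and "C \<ge> 0" and p: "p > 0" "4 * C\<^sup>2 \<le> real p"
    and step: "\<And>s t m. 0 \<le> s \<Longrightarrow> s \<le> t \<Longrightarrow> t \<le> 1 \<Longrightarrow> (\<And>r. r \<in> {s..t} \<Longrightarrow> norm (v r) \<le> m) \<Longrightarrow>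
      norm (v t - v s) \<le> C * m * sqrt (t - s)"
    and st: "s \<in> {0..1}" "t \<in> {0..1}"
  shows "norm (v t) \<le> 2 ^ p * norm (v s)"
proof -
  have short: "norm (v y) \<le> 2 * norm (v x)" if xy: "x \<in> {0..1}" "y \<in> {0..1}" "\<bar>y - x\<bar> \<le> 1 / real p" for x y
  proof -
    define l u where "l = min x y" and "u = max x y"
    have lu: "0 \<le> l" "l \<le> u" "u \<le> 1" "u - l \<le> 1 / real p" "x \<in> {l..u}" "y \<in> {l..u}"
      using xy by (auto simp: l_def u_def min_def max_def)
    have "continuous_on {l..u} (\<lambda>r. norm (v r))"
      using lu by (intro continuous_on_norm continuous_on_subset[OF cont]) auto
    \<comment> \<open>The maximum \<open>norm (v z)\<close> over the short interval serves as
      \<open>m\<close> in \<open>step\<close>; the bound then occurs on both sides and can be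
      absorbed.\<close>
    then obtain z where z: "z \<in> {l..u}" "\<And>r. r \<in> {l..u} \<Longrightarrow> norm (v r) \<le> norm (v z)"
      using continuous_attains_sup[of "{l..u}" "\<lambda>r. norm (v r)"] lu by auto
    have half: "norm (v b - v a) \<le> norm (v z) / 2" if ab: "a \<in> {l..u}" "b \<in> {l..u}" "a \<le> b" for a b
    proof -
      have "norm (v b - v a) \<le> C * norm (v z) * sqrt (b - a)"
        using ab lu z by (intro step) auto
      also have "\<dots> = norm (v z) * (C * sqrt (b - a))" by simp
      also have "\<dots> \<le> norm (v z) * (1/2)"
      proof (intro mult_left_mono)
        have "(C * sqrt (b - a))\<^sup>2 = C\<^sup>2 * (b - a)" using ab by (simp add: power_mult_distrib)
        also have "\<dots> \<le> C\<^sup>2 * (1 / real p)" using ab lu by (intro mult_left_mono) auto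
        also have "\<dots> \<le> (1/2)\<^sup>2" using p by (simp add: field_simps power2_eq_square)
        finally show "C * sqrt (b - a) \<le> 1/2" by (rule power2_le_imp_le) simp
      qed simp
      finally show ?thesis by simp
    qed
    have "norm (v z - v x) \<le> norm (v z) / 2"
      using half[of x z] half[of z x] z(1) lu(5) by (cases "x \<le> z") (auto simp: norm_minus_commute)
    then have "norm (v z) \<le> 2 * norm (v x)"
      using norm_triangle_ineq2[of "v z" "v x"] by linarith
    then show ?thesis using z(2)[OF lu(6)] by linarith
  qed
  have "\<forall>s\<in>{0..1}. \<forall>t\<in>{0..1}. \<bar>t - s\<bar> \<le> real k / real p \<longrightarrow> norm (v t) \<le> 2 ^ k * norm (v s)" for k
  proof (induction k)
    case 0
    then show ?case by auto
  next
    case (Suc k)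
    show ?case
    proof (intro ballI impI)
      fix s t :: real assume st: "s \<in> {0..1}" "t \<in> {0..1}" "\<bar>t - s\<bar> \<le> real (Suc k) / real p"
      \<comment> \<open>\<open>w\<close> divides the way from \<open>s\<close> to \<open>t\<close>
        in the ratio \<open>k : 1\<close>. The first part is left to the induction hypothesis, the
        second has length at most \<open>1 / p\<close>; after \<open>p\<close> steps the whole unit
        interval is reached.\<close>
      define w where "w = s + (t - s) * (real k / real (Suc k))"
      have ws: "w - s = (t - s) * (real k / real (Suc k))" by (simp add: w_def)
      have tw: "t - w = (t - s) * (1 / real (Suc k))" by (simp add: w_def field_simps)
      define c where "c = real k / real (Suc k)"
      have c: "0 \<le> c" "c \<le> 1" by (auto simp: c_def)
      have "w = (1 - c) *\<^sub>R s + c *\<^sub>R t"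
        unfolding w_def c_def[symmetric] by (simp add: algebra_simps)
      then have w01: "w \<in> {0..1}"
        using convexD[OF convex_real_interval(5)[of 0 1] st(1,2), of "1 - c" c] c by simp
      have "\<bar>w - s\<bar> \<le> (real (Suc k) / real p) * (real k / real (Suc k))"
        unfolding ws abs_mult using st(3) by (intro mult_mono) auto
      also have "\<dots> = real k / real p" by (simp del: of_nat_Suc)
      finally have a: "\<bar>w - s\<bar> \<le> real k / real p" .
      have "\<bar>t - w\<bar> \<le> (real (Suc k) / real p) * (1 / real (Suc k))"
        unfolding tw abs_mult using st(3) by (intro mult_mono) auto
      also have "\<dots> = 1 / real p" by (simp del: of_nat_Suc)
      finally have b: "\<bar>t - w\<bar> \<le> 1 / real p" .
      have "norm (v t) \<le> 2 * norm (v w)" by (rule short[OF w01 st(2) b])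
      also have "\<dots> \<le> 2 * (2 ^ k * norm (v s))" using Suc st(1) w01 a by simp
      finally show "norm (v t) \<le> 2 ^ Suc k * norm (v s)" by simp
    qed
  qed
  from this[of p] show ?thesis using st p by auto
qed

text \<open>With \<open>c\<close> the mean value of \<open>G\<close>, nonnegativity of
  \<open>B (G x - c) (G x - c)\<close> gives \<open>2 * B c (G x) - B c c \<le> \<phi> x\<close>.
  The left side is affine in \<open>G\<close>, and its integral is
  \<open>B \<Delta> \<Delta> / (t - s)\<close>. Integrability is asked of the majorant
  \<open>\<phi>\<close>, and \<open>B\<close> may be degenerate; it is used with the inner product
  and with the trace form of the cost.\<close>

lemma Cauchy_Schwarz_has_integral:
  fixes G :: "real \<Rightarrow> 'a::euclidean_space" and B :: "'a \<Rightarrow> 'a \<Rightarrow> real"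
  assumes B: "bounded_bilinear B" and sym: "\<And>x y. B x y = B y x" and psd: "\<And>x. B x x \<ge> 0"
    and G: "(G has_integral \<Delta>) {s..t}" and \<phi>: "\<phi> integrable_on {s..t}" and "s \<le> t"
    and le: "\<And>x. x \<in> {s..t} \<Longrightarrow> B (G x) (G x) \<le> \<phi> x"
  shows "B \<Delta> \<Delta> \<le> (t - s) * integral {s..t} \<phi>"
proof (cases "s = t")
  case True
  then have "(G has_integral 0) {s..t}" by (simp add: has_integral_refl)
  then have "\<Delta> = 0" using has_integral_unique[OF G] by blast
  then show ?thesis using True bounded_bilinear.zero_left[OF B] by simp
next
  case False
  then have "s < t" using \<open>s \<le> t\<close> by simp
  define c where "c = \<Delta> /\<^sub>R (t - s)"
  have "((\<lambda>x. B c (G x)) has_integral B c \<Delta>) {s..t}"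
    using has_integral_linear[OF G bounded_bilinear.bounded_linear_right[OF B, of c]] by (simp add: o_def)
  then have "((\<lambda>x. 2 * B c (G x) - B c c) has_integral 2 * B c \<Delta> - (t - s) *\<^sub>R B c c) {s..t}"
    using \<open>s \<le> t\<close> has_integral_const_real[of "B c c" s t]
    by (intro has_integral_diff has_integral_mult_right) simp_all
  then have "2 * B c \<Delta> - (t - s) *\<^sub>R B c c \<le> integral {s..t} \<phi>"
  proof (rule has_integral_le[OF _ integrable_integral[OF \<phi>]])
    fix x assume x: "x \<in> {s..t}"
    have "0 \<le> B (G x - c) (G x - c)" by (rule psd)
    also have "\<dots> = B (G x) (G x) - 2 * B c (G x) + B c c"
      using sym[of "G x" c] by (simp add: bounded_bilinear.diff_left[OF B] bounded_bilinear.diff_right[OF B])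
    finally show "2 * B c (G x) - B c c \<le> \<phi> x" using le[OF x] by linarith
  qed
  moreover have "2 * B c \<Delta> - (t - s) *\<^sub>R B c c = B \<Delta> \<Delta> / (t - s)"
  proof -
    have "B c \<Delta> = B \<Delta> \<Delta> / (t - s)" "B c c = B \<Delta> \<Delta> / (t - s) / (t - s)"
      unfolding c_def by (simp_all add: bounded_bilinear.scaleR_left[OF B] bounded_bilinear.scaleR_right[OF B] divide_inverse)
    then show ?thesis using \<open>s < t\<close> by simp
  qed
  ultimately have "B \<Delta> \<Delta> / (t - s) \<le> integral {s..t} \<phi>" by simp
  then show ?thesis using \<open>s < t\<close> by (simp add: pos_divide_le_eq mult.commute)
qed

section \<open>Frobenius norm, trace forms and inverses of matrix curves\<close>

lemma norm_matrix_power2: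
  fixes A :: "real^'n^'m"
  shows "(norm A)\<^sup>2 = (\<Sum>i\<in>UNIV. \<Sum>j\<in>UNIV. (A $ i $ j)\<^sup>2)"
  by (simp add: norm_vec_def L2_set_def sum_nonneg)

lemma norm_matrix_mult_le:
  fixes A :: "real^'n^'m" and B :: "real^'p^'n"
  shows "norm (A ** B) \<le> norm A * norm B"
proof -
  have "(norm (A ** B))\<^sup>2 = (\<Sum>i\<in>UNIV. \<Sum>j\<in>UNIV. (A $ i \<bullet> column j B)\<^sup>2)"
    by (simp add: norm_matrix_power2 matrix_matrix_mult_def inner_vec_def column_def)
  also have "\<dots> \<le> (\<Sum>i\<in>UNIV. \<Sum>j\<in>UNIV. (norm (A $ i))\<^sup>2 * (norm (column j B))\<^sup>2)"
    using Cauchy_Schwarz_ineq by (intro sum_mono) (auto simp: power2_norm_eq_inner)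
  also have "\<dots> = (\<Sum>i\<in>UNIV. (norm (A $ i))\<^sup>2) * (\<Sum>j\<in>UNIV. (norm (column j B))\<^sup>2)"
    by (simp add: sum_product)
  also have "(\<Sum>i\<in>UNIV. (norm (A $ i))\<^sup>2) = (norm A)\<^sup>2"
    by (simp add: norm_matrix_power2) (simp add: norm_vec_def L2_set_def sum_nonneg)
  also have "(\<Sum>j\<in>UNIV. (norm (column j B))\<^sup>2) = (norm B)\<^sup>2"
    unfolding norm_matrix_power2 by (subst sum.swap) (simp add: norm_vec_def L2_set_def sum_nonneg column_def)
  finally show ?thesis
    by (metis (no_types) power_mult_distrib power2_le_imp_le mult_nonneg_nonneg norm_ge_zero)
qed

lemma norm_matrix_vector_mult_le:
  fixes A :: "real^'n^'m"
  shows "norm (A *v x) \<le> norm A * norm x"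
proof -
  have "(norm (A *v x))\<^sup>2 = (\<Sum>i\<in>UNIV. (A $ i \<bullet> x)\<^sup>2)"
    by (simp add: norm_vec_def L2_set_def sum_nonneg matrix_vector_mul_component)
  also have "\<dots> \<le> (\<Sum>i\<in>UNIV. (norm (A $ i))\<^sup>2 * (norm x)\<^sup>2)"
    using Cauchy_Schwarz_ineq by (intro sum_mono) (auto simp: power2_norm_eq_inner)
  also have "\<dots> = (norm A)\<^sup>2 * (norm x)\<^sup>2"
    by (simp add: sum_distrib_right[symmetric]) (simp add: norm_vec_def L2_set_def sum_nonneg)
  finally show ?thesis
    by (metis (no_types) power_mult_distrib power2_le_imp_le mult_nonneg_nonneg norm_ge_zero)
qed

lemma norm_transpose: "norm (transpose A) = norm (A :: real^'n^'m)"
proof -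
  have "(norm (transpose A))\<^sup>2 = (norm A)\<^sup>2"
    unfolding norm_matrix_power2 transpose_def by simp (rule sum.swap)
  then show ?thesis by simp
qed

lemma bounded_bilinear_matrix_mult:
  "bounded_bilinear ((**) :: real^'n^'m \<Rightarrow> real^'p^'n \<Rightarrow> real^'p^'m)"
proof
  show "(A + A') ** B = A ** B + A' ** B" for A A' :: "real^'n^'m" and B :: "real^'p^'n"
    by (simp add: matrix_matrix_mult_def vec_eq_iff sum.distrib algebra_simps)
  show "A ** (B + B') = A ** B + A ** B'" for A :: "real^'n^'m" and B B' :: "real^'p^'n"
    by (rule matrix_add_ldistrib)
  show "(r *\<^sub>R A) ** B = r *\<^sub>R (A ** B)" for r and A :: "real^'n^'m" and B :: "real^'p^'n"
    by (simp add: matrix_matrix_mult_def vec_eq_iff sum_distrib_left mult.assoc)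
  show "A ** (r *\<^sub>R B) = r *\<^sub>R (A ** B)" for r and A :: "real^'n^'m" and B :: "real^'p^'n"
    by (simp add: matrix_matrix_mult_def vec_eq_iff sum_distrib_left mult.left_commute)
  show "\<exists>K. \<forall>A B. norm ((A::real^'n^'m) ** (B::real^'p^'n)) \<le> norm A * norm B * K"
    using norm_matrix_mult_le by (intro exI[of _ 1]) auto
qed

lemmas tendsto_matrix_mult = bounded_bilinear.tendsto[OF bounded_bilinear_matrix_mult]
lemmas continuous_on_matrix_mult = bounded_bilinear.continuous_on[OF bounded_bilinear_matrix_mult]

lemma bounded_linear_transpose: "bounded_linear (transpose :: real^'n^'m \<Rightarrow> real^'m^'n)"
  by (rule bounded_linear_intro[of _ 1]) (auto simp: transpose_def vec_eq_iff norm_transpose[unfolded transpose_def])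

text \<open>The rows decouple, so symmetry, positivity and bounds of the trace form reduce to those
  of the form of \<open>P\<close> on vectors.\<close>

lemma trace_quadratic_form:
  fixes A B :: "real^'n^'m" and P :: "real^'n^'n"
  shows "trace (A ** P ** transpose B) = (\<Sum>i\<in>UNIV. A $ i \<bullet> (P *v (B $ i)))"
proof -
  have "(A ** P ** transpose B) $ i $ i = A $ i \<bullet> (P *v (B $ i))" for i
  proof -
    have "(A ** P ** transpose B) $ i $ i = (A ** (P ** transpose B)) $ i $ i"
      by (simp add: matrix_mul_assoc)
    then show ?thesis
      by (simp add: matrix_matrix_mult_def transpose_def inner_vec_def matrix_vector_mult_def)
  qed
  then show ?thesis by (simp add: trace_def)
qed

text \<open>The norm of \<open>real^'n^'m\<close> is the Frobenius norm, so the integrand of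
  \<open>J_A\<close> is the squared norm of the control.\<close>

lemma trace_mult_transpose: "trace (A ** transpose A) = (norm (A::real^'n^'m))\<^sup>2"
  unfolding norm_matrix_power2 by (simp add: trace_def matrix_matrix_mult_def transpose_def power2_eq_square)

lemma bounded_bilinear_trace_form:
  fixes P :: "real^'n^'n"
  shows "bounded_bilinear (\<lambda>A B::real^'n^'m. trace (A ** P ** transpose B))"
proof -
  have "bilinear (\<lambda>A B::real^'n^'m. trace (A ** P ** transpose B))"
    unfolding bilinear_def trace_quadratic_form
  proof (intro conjI allI)
    show "linear (\<lambda>B::real^'n^'m. \<Sum>i\<in>UNIV. A $ i \<bullet> (P *v (B $ i)))" for A
    proof (rule linearI)
      fix B B' :: "real^'n^'m" and r :: real
      show "(\<Sum>i\<in>UNIV. A $ i \<bullet> (P *v ((B + B') $ i))) = (\<Sum>i\<in>UNIV. A $ i \<bullet> (P *v (B $ i))) + (\<Sum>i\<in>UNIV. A $ i \<bullet> (P *v (B' $ i)))"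
        by (simp only: vector_add_component matrix_vector_right_distrib inner_add_right sum.distrib)
      show "(\<Sum>i\<in>UNIV. A $ i \<bullet> (P *v ((r *\<^sub>R B) $ i))) = r *\<^sub>R (\<Sum>i\<in>UNIV. A $ i \<bullet> (P *v (B $ i)))"
        by (simp only: vector_scaleR_component matrix_vector_mult_scaleR inner_scaleR_right sum_distrib_left real_scaleR_def)
    qed
    show "linear (\<lambda>A::real^'n^'m. \<Sum>i\<in>UNIV. A $ i \<bullet> (P *v (B $ i)))" for B
      by (rule linearI) (simp_all add: inner_add_left sum.distrib sum_distrib_left)
  qed
  then show ?thesis by (simp add: bilinear_conv_bounded_bilinear)
qed

lemma trace_form_le:
  fixes A :: "real^'n^'m" and P :: "real^'n^'n"
  shows "\<bar>trace (A ** P ** transpose A)\<bar> \<le> norm P * (norm A)\<^sup>2"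
proof -
  have "\<bar>trace (A ** P ** transpose A)\<bar> \<le> (\<Sum>i\<in>UNIV. norm P * (norm (A $ i))\<^sup>2)"
    unfolding trace_quadratic_form
  proof (rule order_trans[OF sum_abs sum_mono])
    fix i
    have "\<bar>A $ i \<bullet> (P *v (A $ i))\<bar> \<le> norm (A $ i) * norm (P *v (A $ i))" by (rule Cauchy_Schwarz_ineq2)
    also have "\<dots> \<le> norm (A $ i) * (norm P * norm (A $ i))"
      by (intro mult_left_mono norm_matrix_vector_mult_le) simp
    finally show "\<bar>A $ i \<bullet> (P *v (A $ i))\<bar> \<le> norm P * (norm (A $ i))\<^sup>2" by (simp add: power2_eq_square mult_ac)
  qed
  also have "\<dots> = norm P * (norm A)\<^sup>2"
    by (simp add: sum_distrib_left[symmetric]) (simp add: norm_vec_def L2_set_def sum_nonneg)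
  finally show ?thesis .
qed

lemma matrix_inv_mult:
  assumes "invertible A"
  shows "A ** matrix_inv A = mat 1" "matrix_inv A ** A = mat 1"
  using assms[unfolded invertible_def] unfolding matrix_inv_def by (metis (mono_tags, lifting) someI_ex)+

text \<open>Cramer's rule writes every entry of the inverse as a quotient of determinants, that is,
  of polynomials in the entries, with nonvanishing denominator.\<close>

lemma continuous_on_matrix_inv:
  fixes A :: "'a::topological_space \<Rightarrow> real^'n^'n"
  assumes "continuous_on S A" and inv: "\<And>t. t \<in> S \<Longrightarrow> invertible (A t)"
  shows "continuous_on S (\<lambda>t. matrix_inv (A t))"
proof -
  have "matrix_inv (A t) = (\<chi> k j. det (\<chi> i l. if l = k then axis j 1 $ i else A t $ i $ l) / det (A t))"
    if "t \<in> S" for t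
  proof -
    have d: "det (A t) \<noteq> 0" using inv[OF that] by (simp add: invertible_det_nz)
    have "matrix_inv (A t) *v axis j 1 = (\<chi> k. det (\<chi> i l. if l = k then axis j 1 $ i else A t $ i $ l) / det (A t))" for j
      using cramer[OF d, of "matrix_inv (A t) *v axis j 1" "axis j 1"] matrix_inv_mult(1)[OF inv[OF that]]
      by (simp add: matrix_vector_mul_assoc)
    then show ?thesis
      by (simp add: vec_eq_iff matrix_vector_mult_basis column_def)
  qed
  moreover have "continuous_on S (\<lambda>t. \<chi> k j. det (\<chi> i l. if l = k then (axis j 1 :: real^'n) $ i else A t $ i $ l) / det (A t))"
  proof (intro continuous_on_vec_lambda continuous_on_divide)
    have Aij: "continuous_on S (\<lambda>t. A t $ i $ l)" for i l
      by (intro continuous_on_component assms(1))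
    show "continuous_on S (\<lambda>t. det (A t))"
      unfolding det_def by (intro continuous_intros Aij)
    show "continuous_on S (\<lambda>t. det (\<chi> i l. if l = k then (axis j 1 :: real^'n) $ i else A t $ i $ l))" for k j
    proof -
      have "continuous_on S (\<lambda>t. if l = k then (axis j 1 :: real^'n) $ i else A t $ i $ l)" for i l
        using Aij by (cases "l = k") auto
      then show ?thesis unfolding det_def by (auto intro!: continuous_intros)
    qed
    show "\<forall>t\<in>S. det (A t) \<noteq> 0" using inv by (simp add: invertible_det_nz)
  qed
  ultimately show ?thesis by (simp cong: continuous_on_cong)
qed

text \<open>Cauchy-Schwarz bounds the increment of \<open>v\<close> over \<open>{s..t}\<close> by
  \<open>sqrt C * m * sqrt (t - s)\<close>. The resulting factor depends on \<open>K\<close> only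
  through \<open>C\<close>, and \<open>s\<close>, \<open>t\<close> may come in either order: forward
  it bounds solutions, backward it keeps them away from 0. The number of columns is free, so the
  lemma serves the flow and the tracking error alike.\<close>

lemma linear_flow_growth:
  fixes v :: "real \<Rightarrow> real^'p^'n"
  assumes cont: "continuous_on {0..1} v"
    and K: "(\<lambda>t. (norm (K t))\<^sup>2) integrable_on {0..1}" "integral {0..1} (\<lambda>t. (norm (K t))\<^sup>2) \<le> C"
    and p: "p > 0" "4 * C \<le> real p"
    and flow: "\<And>s t. 0 \<le> s \<Longrightarrow> s \<le> t \<Longrightarrow> t \<le> 1 \<Longrightarrow> ((\<lambda>r. K r ** v r) has_integral v t - v s) {s..t}"
    and st: "s \<in> {0..1}" "t \<in> {0..1}"
  shows "norm (v t) \<le> 2 ^ p * norm (v s)"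
proof (rule norm_growth_bound[OF cont, of "sqrt C"])
  have "0 \<le> integral {0..1} (\<lambda>t. (norm (K t))\<^sup>2)" by (rule integral_nonneg[OF K(1)]) simp
  then have C: "C \<ge> 0" using K(2) by linarith
  then show "4 * (sqrt C)\<^sup>2 \<le> real p" "sqrt C \<ge> 0" using p by simp_all
  fix s t m assume s: "(0::real) \<le> s" "s \<le> t" "t \<le> 1" and m: "\<And>r. r \<in> {s..t} \<Longrightarrow> norm (v r) \<le> m"
  have "m \<ge> 0" using m[of s] s norm_ge_zero[of "v s"] by (metis atLeastAtMost_iff order_refl order_trans)
  have Kst: "(\<lambda>t. (norm (K t))\<^sup>2) integrable_on {s..t}"
    using integrable_subinterval_real[OF K(1)] s by auto
  then have int: "(\<lambda>r. m\<^sup>2 * (norm (K r))\<^sup>2) integrable_on {s..t}" by (rule integrable_on_mult_right)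
  have "(v t - v s) \<bullet> (v t - v s) \<le> (t - s) * integral {s..t} (\<lambda>r. m\<^sup>2 * (norm (K r))\<^sup>2)"
  proof (rule Cauchy_Schwarz_has_integral[OF bounded_bilinear_inner inner_commute inner_ge_zero flow[OF s] int s(2)])
    fix r assume r: "r \<in> {s..t}"
    have "norm (K r ** v r) \<le> norm (K r) * m"
      using norm_matrix_mult_le[of "K r" "v r"] mult_left_mono[OF m[OF r], of "norm (K r)"] by simp
    then have "(norm (K r ** v r))\<^sup>2 \<le> (norm (K r) * m)\<^sup>2" by (intro power_mono) auto
    then show "(K r ** v r) \<bullet> (K r ** v r) \<le> m\<^sup>2 * (norm (K r))\<^sup>2"
      by (simp add: power2_norm_eq_inner[symmetric] power_mult_distrib mult.commute)
  qed
  also have "integral {s..t} (\<lambda>r. m\<^sup>2 * (norm (K r))\<^sup>2) = m\<^sup>2 * integral {s..t} (\<lambda>r. (norm (K r))\<^sup>2)" by simp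
  also have "(t - s) * \<dots> \<le> (t - s) * (m\<^sup>2 * C)"
  proof (intro mult_left_mono)
    have "integral {s..t} (\<lambda>r. (norm (K r))\<^sup>2) \<le> integral {0..1} (\<lambda>r. (norm (K r))\<^sup>2)"
      using s by (intro integral_subset_le Kst K(1)) auto
    then show "integral {s..t} (\<lambda>r. (norm (K r))\<^sup>2) \<le> C" using K(2) by linarith
  qed (use s in auto)
  also have "\<dots> = (sqrt C * m * sqrt (t - s))\<^sup>2"
    using C s by (simp add: power_mult_distrib)
  finally have "(norm (v t - v s))\<^sup>2 \<le> (sqrt C * m * sqrt (t - s))\<^sup>2"
    by (simp add: power2_norm_eq_inner)
  then show "norm (v t - v s) \<le> sqrt C * m * sqrt (t - s)"
    by (rule power2_le_imp_le) (use C s \<open>m \<ge> 0\<close> in auto)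
qed (use p st in auto)

lemma abs_continuous_on_subset:
  assumes "abs_continuous_on S f" "T \<subseteq> S"
  shows "abs_continuous_on T f"
  unfolding abs_continuous_on_def
proof (intro allI impI)
  fix e :: real assume "e > 0"
  then obtain d where "d > 0" and d: "\<forall>(n::nat) (a::nat\<Rightarrow>real) b.
        (\<forall>i<n. a i \<le> b i \<and> {a i..b i} \<subseteq> S) \<and>
        (\<forall>i<n. \<forall>j<n. i \<noteq> j \<longrightarrow> b i \<le> a j \<or> b j \<le> a i) \<and>
        (\<Sum>i<n. b i - a i) < d \<longrightarrow> (\<Sum>i<n. norm (f (b i) - f (a i))) < e"
    using assms(1)[unfolded abs_continuous_on_def, rule_format, OF \<open>e > 0\<close>] by (elim exE conjE)
  show "\<exists>d>0. \<forall>(n::nat) (a::nat\<Rightarrow>real) b.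
        (\<forall>i<n. a i \<le> b i \<and> {a i..b i} \<subseteq> T) \<and>
        (\<forall>i<n. \<forall>j<n. i \<noteq> j \<longrightarrow> b i \<le> a j \<or> b j \<le> a i) \<and>
        (\<Sum>i<n. b i - a i) < d \<longrightarrow> (\<Sum>i<n. norm (f (b i) - f (a i))) < e"
  proof (intro exI[of _ d] conjI allI impI \<open>d > 0\<close>)
    fix n and a b :: "nat \<Rightarrow> real"
    assume "(\<forall>i<n. a i \<le> b i \<and> {a i..b i} \<subseteq> T) \<and>
        (\<forall>i<n. \<forall>j<n. i \<noteq> j \<longrightarrow> b i \<le> a j \<or> b j \<le> a i) \<and> (\<Sum>i<n. b i - a i) < d"
    then show "(\<Sum>i<n. norm (f (b i) - f (a i))) < e"
      using assms(2) by (intro d[THEN spec, THEN spec, THEN spec, THEN mp]) (simp, meson subset_trans)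
  qed
qed

text \<open>The differential equation is required only where \<Phi> is differentiable, which for an
  absolutely continuous curve is almost everywhere. That suffices for the integral form, including
  the integrability of \<open>K r ** \<Phi> r\<close>.\<close>

lemma flow_has_integral:
  fixes \<Phi> :: "real \<Rightarrow> real^'p^'n"
  assumes ac: "abs_continuous_on {0..1} \<Phi>"
    and der: "\<forall>t\<in>{0..1}. \<forall>D. (\<Phi> has_vector_derivative D) (at t within {0..1}) \<longrightarrow> D = K t ** \<Phi> t"
    and st: "0 \<le> s" "s \<le> t" "t \<le> 1"
  shows "((\<lambda>r. K r ** \<Phi> r) has_integral \<Phi> t - \<Phi> s) {s..t}"
proof (rule abs_continuous_has_integral[OF abs_continuous_on_subset[OF ac] st(2) abs_continuous_differentiable_ae[OF ac]])
  fix x assume x: "x \<in> {s..t} - {x\<in>{0..1}. \<not> \<Phi> differentiable (at x within {0..1})}"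
  then have x01: "x \<in> {0..1}" and "\<Phi> differentiable (at x within {0..1})" using st by auto
  then have "(\<Phi> has_vector_derivative vector_derivative \<Phi> (at x within {0..1})) (at x within {0..1})"
    by (simp add: vector_derivative_works)
  moreover from this have "vector_derivative \<Phi> (at x within {0..1}) = K x ** \<Phi> x"
    using der x01 by blast
  ultimately have "(\<Phi> has_vector_derivative K x ** \<Phi> x) (at x within {0..1})" by simp
  then show "(\<Phi> has_vector_derivative K x ** \<Phi> x) (at x within {s..t})"
    by (rule has_vector_derivative_within_subset) (use st in auto)
qed (use st in auto)

section \<open>Square integrable matrix curves\<close>

lemma square_integrable_on_iff:
  fixes f :: "real \<Rightarrow> 'a::euclidean_space"
  shows "square_integrable_on {a..b} f \<longleftrightarrow>
    f \<in> borel_measurable (lebesgue_on {a..b}) \<and> (\<lambda>t. (norm (f t))\<^sup>2) integrable_on {a..b}"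
  by (simp add: square_integrable_on_def measurable_on_iff_borel_measurable)

lemma integrable_on_dominated:
  fixes f g :: "real \<Rightarrow> real"
  assumes "f \<in> borel_measurable (lebesgue_on {a..b})" "g integrable_on {a..b}"
    and "\<And>t. t \<in> {a..b} \<Longrightarrow> \<bar>f t\<bar> \<le> g t"
  shows "f integrable_on {a..b}"
  by (rule measurable_bounded_by_integrable_imp_integrable[OF assms(1,2)]) (use assms(3) in auto)

lemma borel_measurable_matrix_mult:
  fixes f :: "'a \<Rightarrow> real^'n^'m" and g :: "'a \<Rightarrow> real^'p^'n"
  assumes "f \<in> borel_measurable M" "g \<in> borel_measurable M"
  shows "(\<lambda>t. f t ** g t) \<in> borel_measurable M"
  by (rule borel_measurable_continuous_Pair[OF assms])
     (intro continuous_on_matrix_mult continuous_intros)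

lemma borel_measurable_norm_power2:
  fixes f :: "'a \<Rightarrow> 'b::euclidean_space"
  assumes "f \<in> borel_measurable M"
  shows "(\<lambda>t. (norm (f t))\<^sup>2) \<in> borel_measurable M"
  using assms by measurable

lemma borel_measurable_trace_form:
  fixes f :: "'a \<Rightarrow> real^'n^'m" and g :: "'a \<Rightarrow> real^'n^'n"
  assumes "f \<in> borel_measurable M" "g \<in> borel_measurable M"
  shows "(\<lambda>t. trace (f t ** g t ** transpose (f t))) \<in> borel_measurable M"
  by (rule borel_measurable_continuous_Pair[OF assms])
     (auto simp: trace_def intro!: continuous_on_matrix_mult continuous_intros bounded_linear.continuous_on[OF bounded_linear_transpose])

lemma continuous_on_bounded_Icc:
  fixes A :: "real \<Rightarrow> 'a::real_normed_vector"
  assumes "continuous_on {a..b} A"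
  obtains B where "B > 0" "\<And>t. t \<in> {a..b} \<Longrightarrow> norm (A t) \<le> B"
proof -
  have "bounded (A ` {a..b})"
    using assms by (intro compact_imp_bounded compact_continuous_image) auto
  then show ?thesis using that by (auto simp: bounded_pos)
qed

lemma square_integrable_on_mult_continuous:
  fixes f :: "real \<Rightarrow> real^'n^'m" and A :: "real \<Rightarrow> real^'p^'n"
  assumes f: "square_integrable_on {a..b} f" and A: "continuous_on {a..b} A"
  shows "square_integrable_on {a..b} (\<lambda>t. f t ** A t)"
proof -
  obtain B where B: "B > 0" "\<And>t. t \<in> {a..b} \<Longrightarrow> norm (A t) \<le> B"
    by (rule continuous_on_bounded_Icc[OF A]) (rule that)
  have m: "(\<lambda>t. f t ** A t) \<in> borel_measurable (lebesgue_on {a..b})"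
    using f continuous_imp_measurable_on_sets_lebesgue[OF A]
    by (intro borel_measurable_matrix_mult) (auto simp: square_integrable_on_iff)
  have "(\<lambda>t. (norm (f t ** A t))\<^sup>2) integrable_on {a..b}"
  proof (rule integrable_on_dominated)
    show "(\<lambda>t. B\<^sup>2 * (norm (f t))\<^sup>2) integrable_on {a..b}"
      using f by (intro integrable_on_mult_right) (simp add: square_integrable_on_iff)
    fix t assume t: "t \<in> {a..b}"
    have "norm (f t ** A t) \<le> norm (f t) * B"
      using norm_matrix_mult_le[of "f t" "A t"] mult_left_mono[OF B(2)[OF t], of "norm (f t)"] by simp
    then have "(norm (f t ** A t))\<^sup>2 \<le> (norm (f t) * B)\<^sup>2" by (intro power_mono) auto
    then show "\<bar>(norm (f t ** A t))\<^sup>2\<bar> \<le> B\<^sup>2 * (norm (f t))\<^sup>2"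
      by (simp add: power_mult_distrib mult.commute)
  qed (rule borel_measurable_norm_power2[OF m])
  then show ?thesis using m by (simp add: square_integrable_on_iff)
qed

lemma square_integrable_on_diff_continuous:
  fixes f :: "real \<Rightarrow> 'a::euclidean_space"
  assumes f: "square_integrable_on {a..b} f" and A: "continuous_on {a..b} A"
  shows "square_integrable_on {a..b} (\<lambda>t. f t - A t)"
proof -
  obtain B where B: "B > 0" "\<And>t. t \<in> {a..b} \<Longrightarrow> norm (A t) \<le> B"
    by (rule continuous_on_bounded_Icc[OF A]) (rule that)
  have m: "(\<lambda>t. f t - A t) \<in> borel_measurable (lebesgue_on {a..b})"
    using f continuous_imp_measurable_on_sets_lebesgue[OF A]
    by (intro borel_measurable_diff) (auto simp: square_integrable_on_iff)
  have "(\<lambda>t. (norm (f t - A t))\<^sup>2) integrable_on {a..b}"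
  proof (rule integrable_on_dominated)
    show "(\<lambda>t. 2 * (norm (f t))\<^sup>2 + 2 * B\<^sup>2) integrable_on {a..b}"
      using f by (intro integrable_add integrable_on_mult_right integrable_const_ivl) (auto simp: square_integrable_on_iff)
    fix t assume t: "t \<in> {a..b}"
    have "norm (f t - A t) \<le> norm (f t) + B"
      using norm_triangle_ineq4[of "f t" "A t"] B(2)[OF t] by linarith
    then have "(norm (f t - A t))\<^sup>2 \<le> (norm (f t) + B)\<^sup>2" by (intro power_mono) auto
    also have "\<dots> \<le> 2 * (norm (f t))\<^sup>2 + 2 * B\<^sup>2"
      using sum_squares_bound[of "norm (f t)" B] by (simp add: power2_eq_square algebra_simps)
    finally show "\<bar>(norm (f t - A t))\<^sup>2\<bar> \<le> 2 * (norm (f t))\<^sup>2 + 2 * B\<^sup>2" by simp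
  qed (rule borel_measurable_norm_power2[OF m])
  then show ?thesis using m by (simp add: square_integrable_on_iff)
qed

section \<open>Gram matrices and factorization through an annihilator\<close>

lemma gram_invertible:
  fixes A :: "real^'m^'n"
  assumes "\<And>x. A *v x = 0 \<Longrightarrow> x = 0"
  shows "invertible (transpose A ** A)"
proof -
  have "x = 0" if "(transpose A ** A) *v x = 0" for x
  proof -
    have "(A *v x) \<bullet> (A *v x) = (transpose A *v (A *v x)) \<bullet> x"
      using dot_lmul_matrix[of "A *v x" A x] by simp
    also have "\<dots> = 0" using that by (simp add: matrix_vector_mul_assoc del: transpose_matrix_vector)
    finally show ?thesis using assms by simp
  qed
  then have "\<exists>B. B ** (transpose A ** A) = mat 1" by (simp add: matrix_left_invertible_ker)
  then show ?thesis by (simp add: invertible_left_inverse)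
qed

lemma hcat_mult_vector:
  fixes A :: "real^'p^'n" and B :: "real^'q^'n"
  shows "hcat A B *v z = A *v (\<chi> a. z $ Inl a) + B *v (\<chi> b. z $ Inr b)"
proof -
  have "(\<Sum>j\<in>UNIV. f j) = (\<Sum>a\<in>UNIV. f (Inl a)) + (\<Sum>b\<in>UNIV. f (Inr b))" for f :: "'p + 'q \<Rightarrow> real"
    unfolding UNIV_Plus_UNIV[symmetric] by (subst sum.Plus) (auto simp: o_def)
  then show ?thesis
    by (simp add: vec_eq_iff matrix_vector_mult_def hcat_def)
qed

lemma full_column_rank_iff:
  fixes A :: "real^'n^'m"
  shows "rank A = CARD('n) \<longleftrightarrow> (\<forall>x. A *v x = 0 \<longrightarrow> x = 0)"
  using full_rank_injective[of A] matrix_left_invertible_injective[of A] matrix_left_invertible_ker[of A] by blast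

text \<open>\<open>transpose N ** matrix_inv (N ** transpose N) ** N\<close> is the orthogonal
  projection onto the row space of \<open>N\<close>. By \<open>card\<close> that space is the whole
  orthogonal complement of the column space of \<open>Y\<close>. \<open>A\<close> vanishes on the
  latter, so composing it with the projection does not change it.\<close>

lemma factor_through_annihilator:
  fixes A :: "real^'n^'l" and Y :: "real^'m^'n" and N :: "real^'n^'k"
  assumes card: "CARD('k) + CARD('m) = CARD('n)"
    and NY: "N ** Y = 0" and AY: "A ** Y = 0"
    and Y: "\<And>x. Y *v x = 0 \<Longrightarrow> x = 0" and N: "\<And>x. transpose N *v x = 0 \<Longrightarrow> x = 0"
  shows "A = A ** transpose N ** matrix_inv (N ** transpose N) ** N"
proof -
  have inv: "invertible (N ** transpose N)"
    using gram_invertible[of "transpose N", OF N] by (simp only: transpose_transpose)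
  have YN: "transpose Y ** transpose N = 0"
    unfolding matrix_transpose_mul[symmetric] NY by (simp add: transpose_def vec_eq_iff)
  \<comment> \<open>The columns of \<open>Y\<close> are orthogonal to those of
    \<open>transpose N\<close>, so multiplying by \<open>transpose Y\<close> isolates
    \<open>\<alpha>\<close>.\<close>
  have split0: "\<alpha> = 0" if "Y *v \<alpha> + transpose N *v \<beta> = 0" for \<alpha> \<beta>
  proof -
    have "0 = transpose Y *v (Y *v \<alpha> + transpose N *v \<beta>)" using that by simp
    also have "\<dots> = (transpose Y ** Y) *v \<alpha> + (transpose Y ** transpose N) *v \<beta>"
      by (simp only: matrix_vector_right_distrib matrix_vector_mul_assoc)
    also have "\<dots> = (transpose Y ** Y) *v \<alpha>" by (simp add: YN)
    finally show ?thesis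
      using gram_invertible[of Y, OF Y] matrix_left_invertible_ker[of "transpose Y ** Y"] invertible_left_inverse[of "transpose Y ** Y"]
      by simp
  qed
  have "z = 0" if "hcat Y (transpose N) *v z = 0" for z
  proof -
    have eq: "Y *v (\<chi> a. z $ Inl a) + transpose N *v (\<chi> b. z $ Inr b) = 0"
      using that by (simp only: hcat_mult_vector)
    from split0[OF eq] have z1: "(\<chi> a. z $ Inl a) = 0" .
    with eq have z2: "(\<chi> b. z $ Inr b) = 0" by (intro N) simp
    have "z $ j = 0" for j using z1 z2 by (cases j) (simp_all add: vec_eq_iff)
    then show ?thesis by (simp add: vec_eq_iff)
  qed
  then have "rank (hcat Y (transpose N)) = CARD('m + 'k)" by (subst full_column_rank_iff) blast
  also have "\<dots> = CARD('n)" using card by simp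
  finally have surj: "surj ((*v) (hcat Y (transpose N)))" by (simp add: full_rank_surjective)
  have "A *v x = (A ** transpose N ** matrix_inv (N ** transpose N) ** N) *v x" for x
  proof -
    obtain z where "x = hcat Y (transpose N) *v z" using surj by (metis surjD)
    then obtain \<alpha> \<beta> where x: "x = Y *v \<alpha> + transpose N *v \<beta>" by (simp only: hcat_mult_vector)
    have "A *v x = (A ** Y) *v \<alpha> + (A ** transpose N) *v \<beta>"
      unfolding x by (simp only: matrix_vector_right_distrib matrix_vector_mul_assoc)
    then have 1: "A *v x = (A ** transpose N) *v \<beta>" by (simp add: AY)
    have "N *v x = (N ** Y) *v \<alpha> + (N ** transpose N) *v \<beta>"
      unfolding x by (simp only: matrix_vector_right_distrib matrix_vector_mul_assoc)
    then have 2: "N *v x = (N ** transpose N) *v \<beta>" by (simp add: NY)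
    have "(A ** transpose N ** matrix_inv (N ** transpose N) ** N) *v x
        = (A ** transpose N ** matrix_inv (N ** transpose N)) *v (N *v x)"
      by (simp only: matrix_vector_mul_assoc)
    also have "\<dots> = (A ** transpose N ** (matrix_inv (N ** transpose N) ** (N ** transpose N))) *v \<beta>"
      unfolding 2 by (simp only: matrix_vector_mul_assoc matrix_mul_assoc)
    also have "\<dots> = A *v x" by (simp add: 1 matrix_inv_mult[OF inv])
    finally show ?thesis by simp
  qed
  then show ?thesis by (simp add: matrix_eq)
qed

section \<open>The tracking constraint\<close>

text \<open>\<open>Y'\<close> is a fixed continuous derivative, and the rank conditions appear as
  trivial kernels. Injectivity of \<open>transpose (N t)\<close> is assumed at time 0 only;
  \<open>N_inj\<close> propagates it.\<close>

locale tracking =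
  fixes Y Y' :: "real \<Rightarrow> real^'m^'n" and N :: "real \<Rightarrow> real^'n^'k"
  assumes card: "CARD('k) + CARD('m) = CARD('n)"
    and Y'_cont: "continuous_on {0..1} Y'"
    and Y_der: "\<And>t. t \<in> {0..1} \<Longrightarrow> (Y has_vector_derivative Y' t) (at t within {0..1})"
    and Y_inj: "\<And>t x. t \<in> {0..1} \<Longrightarrow> Y t *v x = 0 \<Longrightarrow> x = 0"
    and N_der: "\<And>t. t \<in> {0..1} \<Longrightarrow> (N has_vector_derivative (- (N t ** Mcurve Y t))) (at t within {0..1})"
    and NY0: "N 0 ** Y 0 = 0"
    and N0_inj: "\<And>x. transpose (N 0) *v x = 0 \<Longrightarrow> x = 0"
begin

lemma Y_cont: "continuous_on {0..1} Y"
  by (rule continuous_on_vector_derivative[OF Y_der])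

lemma N_cont: "continuous_on {0..1} N"
  by (rule continuous_on_vector_derivative[OF N_der])

lemma Mcurve_eq:
  assumes "t \<in> {0..1}"
  shows "Mcurve Y t = Y' t ** matrix_inv (transpose (Y t) ** Y t) ** transpose (Y t)"
  using vector_derivative_within_cbox[of 0 1 t Y "Y' t"] Y_der[OF assms] assms
  by (simp add: Mcurve_def cbox_interval)

lemma gram_Y_invertible: "t \<in> {0..1} \<Longrightarrow> invertible (transpose (Y t) ** Y t)"
  using Y_inj by (intro gram_invertible)

text \<open>\<open>matrix_inv (transpose (Y t) ** Y t) ** transpose (Y t)\<close> is the left
  pseudoinverse of \<open>Y t\<close>, so \<open>Mcurve Y t\<close> is a particular solution
  \<open>K\<close> of the equation \<open>K Y = Y'\<close>.\<close>

lemma Mcurve_mult_Y: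
  assumes "t \<in> {0..1}"
  shows "Mcurve Y t ** Y t = Y' t"
proof -
  have "Mcurve Y t ** Y t = Y' t ** (matrix_inv (transpose (Y t) ** Y t) ** (transpose (Y t) ** Y t))"
    by (simp add: Mcurve_eq[OF assms] matrix_mul_assoc)
  then show ?thesis by (simp add: matrix_inv_mult[OF gram_Y_invertible[OF assms]])
qed

lemma Mcurve_cont: "continuous_on {0..1} (Mcurve Y)"
proof -
  have "continuous_on {0..1} (\<lambda>t. Y' t ** matrix_inv (transpose (Y t) ** Y t) ** transpose (Y t))"
    using gram_Y_invertible
    by (intro continuous_on_matrix_mult continuous_on_matrix_inv Y'_cont Y_cont
        bounded_linear.continuous_on[OF bounded_linear_transpose]) auto
  then show ?thesis by (rule continuous_on_eq) (simp add: Mcurve_eq)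
qed

text \<open>By the product rule the derivative of \<open>N t ** Y t\<close> is
  \<open>N Y' - N M Y\<close>, which vanishes because \<open>M Y = Y'\<close>.\<close>

lemma N_mult_Y:
  assumes "t \<in> {0..1}"
  shows "N t ** Y t = 0"
proof -
  have "((\<lambda>t. N t ** Y t) has_vector_derivative 0) (at x within {0..1})" if x: "x \<in> {0..1}" for x
  proof -
    have "((\<lambda>t. N t ** Y t) has_vector_derivative N x ** Y' x + (- (N x ** Mcurve Y x)) ** Y x) (at x within {0..1})"
      by (rule bounded_bilinear.has_vector_derivative[OF bounded_bilinear_matrix_mult N_der[OF x] Y_der[OF x]])
    moreover have "(- (N x ** Mcurve Y x)) ** Y x = - (N x ** (Mcurve Y x ** Y x))"
      by (simp add: bounded_bilinear.minus_left[OF bounded_bilinear_matrix_mult] matrix_mul_assoc)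
    ultimately show ?thesis by (simp add: Mcurve_mult_Y[OF x])
  qed
  then obtain c where c: "\<And>x. x \<in> {0..1} \<Longrightarrow> N x ** Y x = c"
    using has_vector_derivative_zero_constant[of "{0..1::real}" "\<lambda>t. N t ** Y t"] by auto
  from c[of 0] c[OF assms] NY0 show ?thesis by simp
qed

text \<open>\<open>transpose (N t)\<close> solves the linear equation with coefficient
  \<open>- transpose (Mcurve Y t)\<close>. The growth bound from \<open>t\<close> back to 0 shows
  that a solution vanishing at \<open>t\<close> already vanished at 0.\<close>

lemma N_inj:
  assumes t: "t \<in> {0..1}" and x: "transpose (N t) *v x = 0"
  shows "x = 0"
proof -
  \<comment> \<open>The growth lemma is about matrices, so the vector \<open>x\<close> is copied
    into every column.\<close>
  define X :: "real^'k^'k" where "X = (\<chi> i j. x $ i)"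
  define v where "v r = transpose (N r) ** X" for r
  define K where "K r = - transpose (Mcurve Y r)" for r
  have col: "(transpose (N r) ** X) $ i $ j = (transpose (N r) *v x) $ i" for r i j
    by (simp add: matrix_matrix_mult_def matrix_vector_mult_def X_def del: transpose_matrix_vector)
  have K_cont: "continuous_on {0..1} K"
    unfolding K_def by (intro continuous_intros bounded_linear.continuous_on[OF bounded_linear_transpose] Mcurve_cont)
  have v_der: "(v has_vector_derivative K r ** v r) (at r within {0..1})" if r: "r \<in> {0..1}" for r
  proof -
    have "bounded_linear (\<lambda>A. transpose A ** X)"
      by (rule bounded_linear_compose[OF bounded_bilinear.bounded_linear_left[OF bounded_bilinear_matrix_mult] bounded_linear_transpose])
    from bounded_linear.has_vector_derivative[OF this N_der[OF r]]
    have "(v has_vector_derivative transpose (- (N r ** Mcurve Y r)) ** X) (at r within {0..1})"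
      by (simp add: v_def[abs_def])
    moreover have "transpose (- (N r ** Mcurve Y r)) = - transpose (N r ** Mcurve Y r)"
      by (rule linear_neg[OF bounded_linear.linear[OF bounded_linear_transpose]])
    ultimately show ?thesis
      by (simp add: K_def v_def matrix_transpose_mul matrix_mul_assoc bounded_bilinear.minus_left[OF bounded_bilinear_matrix_mult])
  qed
  have v_cont: "continuous_on {0..1} v"
    by (rule continuous_on_vector_derivative[OF v_der])
  define C where "C = integral {0..1} (\<lambda>t. (norm (K t))\<^sup>2)"
  obtain p0 :: nat where p0: "4 * C \<le> real p0" using real_arch_simple by blast
  have "norm (v 0) \<le> 2 ^ Suc p0 * norm (v t)"
  proof (rule linear_flow_growth[OF v_cont, of K C])
    show "(\<lambda>t. (norm (K t))\<^sup>2) integrable_on {0..1}"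
      using K_cont by (intro integrable_continuous_real continuous_intros)
    show "((\<lambda>r. K r ** v r) has_integral v t - v s) {s..t}" if st: "0 \<le> s" "s \<le> t" "t \<le> 1" for s t
    proof (rule fundamental_theorem_of_calculus[OF st(2)])
      show "(v has_vector_derivative K r ** v r) (at r within {s..t})" if "r \<in> {s..t}" for r
        by (rule has_vector_derivative_within_subset[OF v_der]) (use st that in auto)
    qed
  qed (use p0 t in \<open>auto simp: C_def\<close>)
  moreover have "v t = 0"
    unfolding v_def vec_eq_iff col x by simp
  ultimately have "v 0 = 0" by simp
  then have "transpose (N 0) *v x = 0"
    using col[of 0] unfolding v_def vec_eq_iff by simp
  then show ?thesis by (rule N0_inj)
qed

text \<open>The error \<open>w\<close> satisfies the same linear equation as the flow, since the
  form of \<open>K\<close> gives \<open>K Y = M Y + R N Y = Y'\<close> almost everywhere. It starts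
  at 0, and the growth bound keeps it there.\<close>

lemma admissible_tracks:
  assumes adm: "admissible2 \<Sigma>0 \<Sigma>1 Y N K \<Phi>" and t: "t \<in> {0..1}"
  shows "\<Phi> t ** Y 0 = Y t"
proof -
  note adm' = adm[unfolded admissible2_def]
  from adm' have ac: "abs_continuous_on {0..1} \<Phi>" and \<Phi>0: "\<Phi> 0 = mat 1"
    and der: "\<forall>t\<in>{0..1}. \<forall>D. (\<Phi> has_vector_derivative D) (at t within {0..1}) \<longrightarrow> D = K t ** \<Phi> t"
    and Ksq: "(\<lambda>t. (norm (K t))\<^sup>2) integrable_on {0..1}"
    by (simp_all add: square_integrable_on_def)
  from adm' obtain R Z where Z: "negligible Z" "\<And>t. t \<in> {0..1} - Z \<Longrightarrow> K t = Mcurve Y t + R t ** N t" by blast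
  define w where "w r = \<Phi> r ** Y 0 - Y r" for r
  have w_cont: "continuous_on {0..1} w"
    unfolding w_def using abs_continuous_on_imp_continuous_on[OF ac] Y_cont
    by (intro continuous_on_diff continuous_on_matrix_mult continuous_on_const)
  have flow: "((\<lambda>r. K r ** w r) has_integral w t - w s) {s..t}" if st: "0 \<le> s" "s \<le> t" "t \<le> 1" for s t
  proof -
    have 1: "((\<lambda>r. K r ** \<Phi> r ** Y 0) has_integral (\<Phi> t - \<Phi> s) ** Y 0) {s..t}"
      using has_integral_linear[OF flow_has_integral[OF ac der st]
          bounded_bilinear.bounded_linear_left[OF bounded_bilinear_matrix_mult, of "Y 0"]]
      by (simp add: o_def)
    have "(Y' has_integral Y t - Y s) {s..t}"
    proof (rule fundamental_theorem_of_calculus[OF st(2)])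
      show "(Y has_vector_derivative Y' r) (at r within {s..t})" if "r \<in> {s..t}" for r
        by (rule has_vector_derivative_within_subset[OF Y_der]) (use st that in auto)
    qed
    then have 2: "((\<lambda>r. K r ** Y r) has_integral Y t - Y s) {s..t}"
    proof (rule has_integral_spike[OF Z(1), rotated])
      fix r assume r: "r \<in> {s..t} - Z"
      then have r01: "r \<in> {0..1}" using st by auto
      have "K r ** Y r = Mcurve Y r ** Y r + R r ** (N r ** Y r)"
        using Z(2)[of r] r r01
        by (simp add: bounded_bilinear.add_left[OF bounded_bilinear_matrix_mult] matrix_mul_assoc)
      then show "K r ** Y r = Y' r"
        by (simp add: Mcurve_mult_Y[OF r01] N_mult_Y[OF r01] bounded_bilinear.zero_right[OF bounded_bilinear_matrix_mult])
    qed
    have "w t - w s = (\<Phi> t - \<Phi> s) ** Y 0 - (Y t - Y s)"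
      by (simp add: w_def bounded_bilinear.diff_left[OF bounded_bilinear_matrix_mult])
    moreover have "K r ** w r = K r ** \<Phi> r ** Y 0 - K r ** Y r" for r
      by (simp add: w_def bounded_bilinear.diff_right[OF bounded_bilinear_matrix_mult] matrix_mul_assoc)
    ultimately show ?thesis using has_integral_diff[OF 1 2] by simp
  qed
  define C where "C = integral {0..1} (\<lambda>t. (norm (K t))\<^sup>2)"
  obtain p0 :: nat where p0: "4 * C \<le> real p0" using real_arch_simple by blast
  have "norm (w t) \<le> 2 ^ Suc p0 * norm (w 0)"
    by (rule linear_flow_growth[OF w_cont Ksq, of C]) (use p0 t flow in \<open>auto simp: C_def\<close>)
  moreover have "w 0 = 0" by (simp add: w_def \<Phi>0)
  ultimately show ?thesis by (simp add: w_def)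
qed

text \<open>Converse of \<open>admissible_tracks\<close>: differentiating
  \<open>\<Phi> t ** Y 0 = Y t\<close> gives \<open>(K - M) Y = 0\<close> almost everywhere, so
  \<open>K - M\<close> factors through \<open>N\<close>. The feedback is \<open>(K - M) Q\<close>
  with the right pseudoinverse \<open>Q\<close> of \<open>N\<close>; since \<open>Q\<close> is
  continuous, square integrability is inherited.\<close>

lemma tracking_feedback:
  assumes track: "\<And>t. t \<in> {0..1} \<Longrightarrow> \<Phi> t ** Y 0 = Y t"
    and Z: "negligible Z"
    and der: "\<And>t. t \<in> {0..1} - Z \<Longrightarrow> (\<Phi> has_vector_derivative K t ** \<Phi> t) (at t within {0..1})"
    and K: "square_integrable_on {0..1} K"
  shows "\<exists>R::real \<Rightarrow> real^'k^'n. square_integrable_on {0..1} R \<and>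
        (\<exists>Z. negligible Z \<and> (\<forall>t\<in>{0..1} - Z. K t = Mcurve Y t + R t ** N t))"
proof (intro exI conjI ballI)
  define Q where "Q t = transpose (N t) ** matrix_inv (N t ** transpose (N t))" for t
  have inv: "invertible (N t ** transpose (N t))" if "t \<in> {0..1}" for t
    using gram_invertible[of "transpose (N t)", OF N_inj[OF that]] by (simp only: transpose_transpose)
  have "continuous_on {0..1} Q"
    unfolding Q_def using inv
    by (intro continuous_on_matrix_mult continuous_on_matrix_inv N_cont
        bounded_linear.continuous_on[OF bounded_linear_transpose]) auto
  then show "square_integrable_on {0..1} (\<lambda>t. (K t - Mcurve Y t) ** Q t)"
    by (intro square_integrable_on_mult_continuous square_integrable_on_diff_continuous K Mcurve_cont)
  show "negligible Z" by (rule Z)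
  fix t assume tZ: "t \<in> {0..1} - Z"
  then have t: "t \<in> {0..1}" by blast
  have "((\<lambda>r. \<Phi> r ** Y 0) has_vector_derivative K t ** \<Phi> t ** Y 0) (at t within {0..1})"
    by (rule bounded_linear.has_vector_derivative[OF bounded_bilinear.bounded_linear_left[OF bounded_bilinear_matrix_mult] der[OF tZ]])
  then have "(Y has_vector_derivative K t ** \<Phi> t ** Y 0) (at t within {0..1})"
    by (rule has_vector_derivative_transform[OF t, rotated]) (simp add: track)
  then have "K t ** \<Phi> t ** Y 0 = Y' t"
    using vector_derivative_unique_within[OF _ _ Y_der[OF t]] t by (simp add: trivial_limit_within islimpt_Icc)
  then have KY: "K t ** Y t = Y' t"
    using track[OF t] by (simp add: matrix_mul_assoc[symmetric])
  have AY: "(K t - Mcurve Y t) ** Y t = 0"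
    by (simp add: bounded_bilinear.diff_left[OF bounded_bilinear_matrix_mult] KY Mcurve_mult_Y[OF t])
  have "K t - Mcurve Y t = (K t - Mcurve Y t) ** Q t ** N t"
    using factor_through_annihilator[OF card N_mult_Y[OF t] AY Y_inj[OF t] N_inj[OF t]]
    by (simp add: Q_def matrix_mul_assoc)
  then show "K t = Mcurve Y t + (K t - Mcurve Y t) ** Q t ** N t"
    by (metis add.commute diff_add_cancel)
qed

end

section \<open>Lower semicontinuity\<close>

lemma integrable_on_Icc_lebesgue:
  fixes f :: "real \<Rightarrow> real"
  assumes "f integrable_on {a..b}" and "\<And>x. x \<in> {a..b} \<Longrightarrow> 0 \<le> f x"
  shows "integrable (lebesgue_on {a..b}) f"
  using nonnegative_absolutely_integrable_1[OF assms]
  by (simp add: set_integrable_def integrable_restrict_space)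

text \<open>Nonnegative functions integrable in the gauge sense are Lebesgue integrable, so
  everything can be moved to \<open>nn_integral\<close>, where Fatou's lemma yields finiteness and
  the bound at once.\<close>

lemma Fatou_integrable_on_everywhere:
  fixes S :: "nat \<Rightarrow> real \<Rightarrow> real" and h :: "real \<Rightarrow> real"
  assumes S: "\<And>n. S n integrable_on {a..b}" "\<And>n x. x \<in> {a..b} \<Longrightarrow> 0 \<le> S n x"
    and lim: "\<And>x. x \<in> {a..b} \<Longrightarrow> (\<lambda>n. S n x) \<longlonglongrightarrow> h x"
    and le: "eventually (\<lambda>n. integral {a..b} (S n) \<le> B) sequentially"
  shows "h integrable_on {a..b} \<and> integral {a..b} h \<le> B"
proof -
  let ?M = "lebesgue_on {a..b}"
  have Si: "integrable ?M (S n)" for n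
    by (rule integrable_on_Icc_lebesgue[OF S])
  have Sm: "S n \<in> borel_measurable ?M" for n
    using Si by (rule borel_measurable_integrable)
  have hm: "h \<in> borel_measurable ?M"
    by (rule borel_measurable_LIMSEQ_real[where u = S]) (use lim Sm in auto)
  have h0: "0 \<le> h x" if x: "x \<in> {a..b}" for x
    by (rule LIMSEQ_le_const[OF lim[OF x]]) (use S(2)[OF x] in auto)
  have nnS: "(\<integral>\<^sup>+x. ennreal (S n x) \<partial>?M) = ennreal (integral {a..b} (S n))" for n
  proof -
    have "AE x in ?M. 0 \<le> S n x" by (rule AE_I2) (use S(2) in auto)
    then show ?thesis
      using nn_integral_eq_integral[OF Si[of n]] lebesgue_integral_eq_integral[OF Si[of n]] by simp
  qed
  have "(\<integral>\<^sup>+x. ennreal (h x) \<partial>?M) = (\<integral>\<^sup>+x. liminf (\<lambda>n. ennreal (S n x)) \<partial>?M)"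
  proof (rule nn_integral_cong)
    fix x assume "x \<in> space ?M"
    then have "(\<lambda>n. ennreal (S n x)) \<longlonglongrightarrow> ennreal (h x)" using lim by (intro tendsto_ennrealI) auto
    then show "ennreal (h x) = liminf (\<lambda>n. ennreal (S n x))"
      by (simp add: lim_imp_Liminf)
  qed
  also have "\<dots> \<le> liminf (\<lambda>n. \<integral>\<^sup>+x. ennreal (S n x) \<partial>?M)"
    using Sm by (intro nn_integral_liminf) measurable
  also have "\<dots> = liminf (\<lambda>n. ennreal (integral {a..b} (S n)))" by (simp add: nnS)
  also have "\<dots> \<le> liminf (\<lambda>n::nat. ennreal B)"
    using le by (intro Liminf_mono) (auto elim!: eventually_mono intro: ennreal_leI)
  also have "\<dots> = ennreal B" by (simp add: Liminf_const)
  finally have le': "(\<integral>\<^sup>+x. ennreal (h x) \<partial>?M) \<le> ennreal B" .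
  have h0_AE: "AE x in ?M. 0 \<le> h x" by (rule AE_I2) (use h0 in auto)
  have hi: "integrable ?M h"
  proof (rule integrableI_nonneg[OF hm h0_AE])
    show "(\<integral>\<^sup>+x. ennreal (h x) \<partial>?M) < \<infinity>"
      using le_less_trans[OF le' ennreal_less_top] by simp
  qed
  have "0 \<le> B"
  proof -
    obtain n where "integral {a..b} (S n) \<le> B" using eventually_happens[OF le] by auto
    moreover have "0 \<le> integral {a..b} (S n)" using S by (intro integral_nonneg) auto
    ultimately show ?thesis by linarith
  qed
  moreover have "(\<integral>\<^sup>+x. ennreal (h x) \<partial>?M) = ennreal (integral {a..b} h)"
    using nn_integral_eq_integral[OF hi h0_AE] lebesgue_integral_eq_integral[OF hi] by simp
  ultimately have "integral {a..b} h \<le> B" using le' by simp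
  moreover have "h integrable_on {a..b}" using hi by (intro integrable_on_lebesgue_on) auto
  ultimately show ?thesis by blast
qed

text \<open>The slack \<open>e\<close> matches partition sums that reach \<open>B\<close> only up to
  a vanishing error. Redefining all functions as 0 on \<open>Z\<close> reduces the claim to
  convergence everywhere.\<close>

lemma Fatou_integrable_on:
  fixes S :: "nat \<Rightarrow> real \<Rightarrow> real" and h :: "real \<Rightarrow> real"
  assumes S: "\<And>n. S n integrable_on {a..b}" "\<And>n x. x \<in> {a..b} \<Longrightarrow> 0 \<le> S n x"
    and Z: "negligible Z" and lim: "\<And>x. x \<in> {a..b} - Z \<Longrightarrow> (\<lambda>n. S n x) \<longlonglongrightarrow> h x"
    and le: "\<And>e. e > 0 \<Longrightarrow> eventually (\<lambda>n. integral {a..b} (S n) \<le> B + e) sequentially"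
  shows "h integrable_on {a..b}" "integral {a..b} h \<le> B"
proof -
  define S' where "S' n x = (if x \<in> Z then 0 else S n x)" for n x
  define h' where "h' x = (if x \<in> Z then 0 else h x)" for x
  have S': "S' n integrable_on {a..b}" "integral {a..b} (S' n) = integral {a..b} (S n)" for n
    using integrable_spike[OF S(1)[of n] Z, of "S' n"] integral_spike[OF Z, of "{a..b}" "S' n" "S n"]
    by (auto simp: S'_def)
  have F: "h' integrable_on {a..b} \<and> integral {a..b} h' \<le> B + e" if "e > 0" for e
  proof (rule Fatou_integrable_on_everywhere[of S'])
    show "S' n integrable_on {a..b}" for n by (rule S'(1))
    show "0 \<le> S' n x" if "x \<in> {a..b}" for n x using S(2)[OF that] by (simp add: S'_def)
    show "(\<lambda>n. S' n x) \<longlonglongrightarrow> h' x" if "x \<in> {a..b}" for x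
      using lim[of x] that by (cases "x \<in> Z") (simp_all add: S'_def h'_def)
    show "eventually (\<lambda>n. integral {a..b} (S' n) \<le> B + e) sequentially"
      unfolding S'(2) by (rule le[OF that])
  qed
  show "h integrable_on {a..b}"
  proof (rule integrable_spike[OF _ Z])
    show "h' integrable_on {a..b}" using F[of 1] by simp
  qed (simp add: h'_def)
  have "integral {a..b} h = integral {a..b} h'"
    by (rule integral_spike[OF Z]) (auto simp: h'_def)
  moreover have "integral {a..b} h' \<le> B"
    by (rule field_le_epsilon) (use F in blast)
  ultimately show "integral {a..b} h \<le> B" by simp
qed

lemma has_integral_uniform_partition:
  fixes f :: "real \<Rightarrow> 'a::banach"
  assumes "n > 0" and "\<And>i. i < n \<Longrightarrow> (f has_integral c i) {real i / real n..(real i + 1) / real n}"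
  shows "(f has_integral (\<Sum>i<n. c i)) {0..1}"
proof -
  have "(f has_integral (\<Sum>i<k. c i)) {0..real k / real n}" if "k \<le> n" for k
    using that
  proof (induction k)
    case 0
    then show ?case by (simp add: has_integral_refl)
  next
    case (Suc k)
    have "(f has_integral (\<Sum>i<k. c i) + c k) {0..(real k + 1) / real n}"
      by (rule has_integral_combine[of 0 "real k / real n"])
        (use Suc assms(2)[of k] in \<open>auto simp: divide_right_mono\<close>)
    then show ?case by (simp add: add.commute)
  qed
  from this[of n] show ?thesis using \<open>n > 0\<close> by simp
qed

text \<open>Each instance of absolute continuity involves finitely many values of the curve, so an
  estimate uniform in \<open>j\<close> passes to pointwise limits. It comes from Cauchy-Schwarz on
  each interval, followed by AM-GM with weight \<open>l\<close>: the increments sum to at most half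
  of \<open>l\<close> times the total length plus half of \<open>C / l\<close>.\<close>

lemma abs_continuous_on_pointwise_limit:
  fixes \<Phi> :: "real \<Rightarrow> 'a::euclidean_space"
  assumes lim: "\<And>t. t \<in> {0..1} \<Longrightarrow> (\<lambda>j. \<Phi>s j t) \<longlonglongrightarrow> \<Phi> t"
    and flow: "\<And>j s t. 0 \<le> s \<Longrightarrow> s \<le> t \<Longrightarrow> t \<le> 1 \<Longrightarrow> (G j has_integral \<Phi>s j t - \<Phi>s j s) {s..t}"
    and sq: "\<And>j. (\<lambda>t. (norm (G j t))\<^sup>2) integrable_on {0..1}"
    and le: "\<And>j. integral {0..1} (\<lambda>t. (norm (G j t))\<^sup>2) \<le> C"
  shows "abs_continuous_on {0..1} \<Phi>"
  unfolding abs_continuous_on_def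
proof (intro allI impI)
  fix e :: real assume "e > 0"
  have "0 \<le> integral {0..1} (\<lambda>t. (norm (G 0 t))\<^sup>2)" by (rule integral_nonneg[OF sq]) simp
  then have "C \<ge> 0" using le[of 0] by linarith
  have amgm: "x * y \<le> ((x + y) / 2)\<^sup>2" for x y :: real
    using zero_le_power2[of "x - y"] by (simp add: power2_eq_square field_simps)
  \<comment> \<open>This weight makes \<open>C / l\<close> at most \<open>e\<close>, and a total
    length below \<open>e / (2 * l)\<close> makes the other term at most \<open>e / 2\<close>. The
    bound \<open>3 * e / 4\<close> leaves room for a strict inequality after the limit in
    \<open>j\<close>.\<close>
  define l where "l = (C + 1) / e"
  have "l > 0" using \<open>C \<ge> 0\<close> \<open>e > 0\<close> by (simp add: l_def)
  show "\<exists>d>0. \<forall>(n::nat) (a::nat\<Rightarrow>real) b.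
        (\<forall>i<n. a i \<le> b i \<and> {a i..b i} \<subseteq> {0..1}) \<and>
        (\<forall>i<n. \<forall>j<n. i \<noteq> j \<longrightarrow> b i \<le> a j \<or> b j \<le> a i) \<and>
        (\<Sum>i<n. b i - a i) < d \<longrightarrow> (\<Sum>i<n. norm (\<Phi> (b i) - \<Phi> (a i))) < e"
  proof (intro exI[of _ "e / (2 * l)"] conjI allI impI)
    show "e / (2 * l) > 0" using \<open>e > 0\<close> \<open>l > 0\<close> by simp
    fix n and a b :: "nat \<Rightarrow> real"
    assume H: "(\<forall>i<n. a i \<le> b i \<and> {a i..b i} \<subseteq> {0..1}) \<and>
        (\<forall>i<n. \<forall>j<n. i \<noteq> j \<longrightarrow> b i \<le> a j \<or> b j \<le> a i) \<and> (\<Sum>i<n. b i - a i) < e / (2 * l)"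
    have ab: "0 \<le> a i" "a i \<le> b i" "b i \<le> 1" if "i < n" for i
      using H that by (auto simp: atLeastatMost_subset_iff)
    have "(\<Sum>i<n. norm (\<Phi>s j (b i) - \<Phi>s j (a i))) \<le> 3 * e / 4" for j
    proof -
      let ?g = "\<lambda>t. (norm (G j t))\<^sup>2"
      have gi: "?g integrable_on {a i..b i}" if "i < n" for i
        using integrable_subinterval_real[OF sq[of j]] ab[OF that] by auto
      have "((?g) has_integral (\<Sum>i<n. integral {a i..b i} ?g)) (\<Union>i<n. {a i..b i})"
      proof (rule has_integral_UN)
        show "pairwise (\<lambda>i i'. negligible ({a i..b i} \<inter> {a i'..b i'})) {..<n}"
        proof (rule pairwiseI)
          fix i i' assume i: "i \<in> {..<n}" "i' \<in> {..<n}" "i \<noteq> i'"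
          then have "b i \<le> a i' \<or> b i' \<le> a i" using H by auto
          then have "{a i..b i} \<inter> {a i'..b i'} \<subseteq> {a i, a i'}" by auto
          then show "negligible ({a i..b i} \<inter> {a i'..b i'})"
            by (rule negligible_subset[rotated]) (simp add: negligible_finite)
        qed
      qed (use gi in auto)
      moreover have "integral (\<Union>i<n. {a i..b i}) ?g \<le> integral {0..1} ?g"
        using calculation H sq[of j] by (intro integral_subset_le) (auto simp: integrable_on_def)
      ultimately have sumg: "(\<Sum>i<n. integral {a i..b i} ?g) \<le> C"
        using le[of j] by (simp add: integral_unique)
      have "(\<Sum>i<n. norm (\<Phi>s j (b i) - \<Phi>s j (a i))) \<le> (\<Sum>i<n. (l * (b i - a i) + integral {a i..b i} ?g / l) / 2)"
      proof (rule sum_mono)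
        fix i assume "i \<in> {..<n}"
        then have i: "i < n" by simp
        let ?A = "l * (b i - a i)" and ?B = "integral {a i..b i} ?g / l"
        have pos: "?A \<ge> 0" "?B \<ge> 0"
          using ab[OF i] \<open>l > 0\<close> integral_nonneg[OF gi[OF i]] by auto
        have "(norm (\<Phi>s j (b i) - \<Phi>s j (a i)))\<^sup>2 \<le> (b i - a i) * integral {a i..b i} ?g"
          unfolding power2_norm_eq_inner
          using Cauchy_Schwarz_has_integral[OF bounded_bilinear_inner inner_commute inner_ge_zero flow[OF ab[OF i]] gi[OF i] ab(2)[OF i]]
          by (simp add: power2_norm_eq_inner)
        also have "\<dots> = ?A * ?B" using \<open>l > 0\<close> by simp
        also have "\<dots> \<le> ((?A + ?B) / 2)\<^sup>2"
          by (rule amgm)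
        finally show "norm (\<Phi>s j (b i) - \<Phi>s j (a i)) \<le> (?A + ?B) / 2"
          by (rule power2_le_imp_le) (use pos in simp)
      qed
      also have "\<dots> = (l * (\<Sum>i<n. b i - a i) + (\<Sum>i<n. integral {a i..b i} ?g) / l) / 2"
        by (simp add: sum_divide_distrib[symmetric] sum.distrib sum_distrib_left[symmetric])
      also have "\<dots> \<le> (l * (e / (2 * l)) + C / l) / 2"
        using H sumg \<open>l > 0\<close> by (intro divide_right_mono add_mono mult_left_mono) auto
      also have "\<dots> \<le> (e / 2 + e) / 2"
      proof -
        have "C / l \<le> e" using \<open>C \<ge> 0\<close> \<open>e > 0\<close> by (simp add: l_def field_simps)
        moreover have eq: "l * (e / (2 * l)) = e / 2" using \<open>l > 0\<close> by simp
        ultimately show ?thesis unfolding eq by (intro divide_right_mono add_left_mono) auto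
      qed
      finally show ?thesis by simp
    qed
    moreover have "(\<lambda>j. \<Sum>i<n. norm (\<Phi>s j (b i) - \<Phi>s j (a i))) \<longlonglongrightarrow> (\<Sum>i<n. norm (\<Phi> (b i) - \<Phi> (a i)))"
      using ab by (intro tendsto_sum tendsto_norm tendsto_diff lim) fastforce+
    ultimately have "(\<Sum>i<n. norm (\<Phi> (b i) - \<Phi> (a i))) \<le> 3 * e / 4"
      by (intro LIMSEQ_le_const2) auto
    then show "(\<Sum>i<n. norm (\<Phi> (b i) - \<Phi> (a i))) < e" using \<open>e > 0\<close> by linarith
  qed
qed

section \<open>Quadratic costs along uniform partitions\<close>

lemma trace_form_commute:
  fixes A B :: "real^'n^'m" and P :: "real^'n^'n"
  assumes "transpose P = P"
  shows "trace (A ** P ** transpose B) = trace (B ** P ** transpose A)"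
  unfolding trace_quadratic_form
proof (rule sum.cong[OF refl])
  fix i
  have "A $ i \<bullet> (P *v (B $ i)) = (transpose P *v (A $ i)) \<bullet> (B $ i)"
    using dot_lmul_matrix[of "A $ i" P "B $ i"] by simp
  then show "A $ i \<bullet> (P *v (B $ i)) = B $ i \<bullet> (P *v (A $ i))"
    unfolding assms by (simp add: inner_commute)
qed

lemma tendsto_trace_form:
  fixes A :: "'a \<Rightarrow> real^'n^'m"
  assumes "(A \<longlongrightarrow> A0) F" "(P \<longlongrightarrow> P0) F"
  shows "((\<lambda>x. trace (A x ** P x ** transpose (A x))) \<longlongrightarrow> trace (A0 ** P0 ** transpose A0)) F"
  unfolding trace_def
  by (intro tendsto_sum tendsto_vec_nth tendsto_matrix_mult assms bounded_linear.tendsto[OF bounded_linear_transpose])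

lemma trace_form_diff_le:
  fixes A :: "real^'n^'m" and P Q :: "real^'n^'n"
  shows "trace (A ** P ** transpose A) \<le> trace (A ** Q ** transpose A) + norm (P - Q) * (norm A)\<^sup>2"
proof -
  have "A ** (P - Q) ** transpose A = A ** P ** transpose A - A ** Q ** transpose A"
    by (simp add: bounded_bilinear.diff_left[OF bounded_bilinear_matrix_mult] bounded_bilinear.diff_right[OF bounded_bilinear_matrix_mult])
  then have "trace (A ** P ** transpose A) - trace (A ** Q ** transpose A) = trace (A ** (P - Q) ** transpose A)"
    by (simp add: trace_sub)
  then show ?thesis using trace_form_le[of A "P - Q"] by linarith
qed

lemma difference_sums_le:
  fixes \<phi> G :: "real \<Rightarrow> real^'n^'n" and P Q :: "real \<Rightarrow> real^'n^'n" and n :: nat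
  assumes flow: "\<And>s t. 0 \<le> s \<Longrightarrow> s \<le> t \<Longrightarrow> t \<le> 1 \<Longrightarrow> (G has_integral \<phi> t - \<phi> s) {s..t}"
    and sq: "(\<lambda>t. (norm (G t))\<^sup>2) integrable_on {0..1}"
    and le: "integral {0..1} (\<lambda>t. (norm (G t))\<^sup>2) \<le> C"
    and q: "(\<lambda>t. trace (G t ** Q t ** transpose (G t))) integrable_on {0..1}"
    and sym: "\<And>t. t \<in> {0..1} \<Longrightarrow> transpose (P t) = P t"
    and psd: "\<And>t (A::real^'n^'n). t \<in> {0..1} \<Longrightarrow> 0 \<le> trace (A ** P t ** transpose A)"
    and "n > 0" "\<eta> \<ge> 0"
    and close: "\<And>s t. s \<in> {0..1} \<Longrightarrow> t \<in> {0..1} \<Longrightarrow> \<bar>s - t\<bar> \<le> 1 / real n \<Longrightarrow> norm (P s - Q t) \<le> \<eta>"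
  shows "(\<Sum>i<n. real n * trace ((\<phi> ((real i + 1) / real n) - \<phi> (real i / real n)) ** P (real i / real n) **
            transpose (\<phi> ((real i + 1) / real n) - \<phi> (real i / real n))))
         \<le> integral {0..1} (\<lambda>t. trace (G t ** Q t ** transpose (G t))) + \<eta> * C"
proof -
  define \<psi> where "\<psi> t = trace (G t ** Q t ** transpose (G t)) + \<eta> * (norm (G t))\<^sup>2" for t
  have \<psi>: "\<psi> integrable_on {0..1}"
    unfolding \<psi>_def by (intro integrable_add q integrable_on_mult_right sq)
  have piece: "0 \<le> real i / real n" "real i / real n \<le> (real i + 1) / real n" "(real i + 1) / real n \<le> 1" if "i < n" for i
    using that by (auto simp: divide_right_mono)
  have \<psi>i: "\<psi> integrable_on {real i / real n..(real i + 1) / real n}" if "i < n" for i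
    by (rule integrable_subinterval_real[OF \<psi>]) (use piece[OF that] in auto)
  have "(\<Sum>i<n. real n * trace ((\<phi> ((real i + 1) / real n) - \<phi> (real i / real n)) ** P (real i / real n) **
            transpose (\<phi> ((real i + 1) / real n) - \<phi> (real i / real n))))
      \<le> (\<Sum>i<n. integral {real i / real n..(real i + 1) / real n} \<psi>)"
  proof (rule sum_mono)
    fix i assume "i \<in> {..<n}"
    then have i: "i < n" by simp
    let ?s = "real i / real n" and ?t = "(real i + 1) / real n"
    have s01: "?s \<in> {0..1}" using piece[OF i] by auto
    have "trace ((\<phi> ?t - \<phi> ?s) ** P ?s ** transpose (\<phi> ?t - \<phi> ?s)) \<le> (?t - ?s) * integral {?s..?t} \<psi>"
    proof (rule Cauchy_Schwarz_has_integral[OF bounded_bilinear_trace_form _ _ flow[OF piece[OF i]] \<psi>i[OF i] piece(2)[OF i]])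
      show "trace (x ** P ?s ** transpose y) = trace (y ** P ?s ** transpose x)" for x y :: "real^'n^'n"
        by (rule trace_form_commute[OF sym[OF s01]])
      show "0 \<le> trace (x ** P ?s ** transpose x)" for x :: "real^'n^'n" by (rule psd[OF s01])
      fix x assume x: "x \<in> {?s..?t}"
      have "?t - ?s = 1 / real n" by (simp add: diff_divide_distrib[symmetric])
      moreover have "x \<in> {0..1}" using x piece[OF i] by (meson atLeastAtMost_iff order_trans)
      ultimately have "norm (P ?s - Q x) \<le> \<eta>" using x by (intro close s01) auto
      then have "norm (P ?s - Q x) * (norm (G x))\<^sup>2 \<le> \<eta> * (norm (G x))\<^sup>2" by (intro mult_right_mono) auto
      then show "trace (G x ** P ?s ** transpose (G x)) \<le> \<psi> x"
        unfolding \<psi>_def using trace_form_diff_le[of "G x" "P ?s" "Q x"] by linarith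
    qed
    moreover have "?t - ?s = 1 / real n" by (simp add: diff_divide_distrib[symmetric])
    ultimately have "trace ((\<phi> ?t - \<phi> ?s) ** P ?s ** transpose (\<phi> ?t - \<phi> ?s)) \<le> integral {?s..?t} \<psi> / real n" by simp
    then show "real n * trace ((\<phi> ?t - \<phi> ?s) ** P ?s ** transpose (\<phi> ?t - \<phi> ?s)) \<le> integral {?s..?t} \<psi>"
      using \<open>n > 0\<close> by (simp add: pos_le_divide_eq mult.commute)
  qed
  also have "\<dots> = integral {0..1} \<psi>"
    by (rule integral_unique[symmetric], rule has_integral_uniform_partition[OF \<open>n > 0\<close>])
       (rule integrable_integral[OF \<psi>i])
  also have "\<dots> = integral {0..1} (\<lambda>t. trace (G t ** Q t ** transpose (G t))) + \<eta> * integral {0..1} (\<lambda>t. (norm (G t))\<^sup>2)"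
    unfolding \<psi>_def using q sq by (subst integral_add) (auto intro!: integrable_on_mult_right)
  also have "\<dots> \<le> integral {0..1} (\<lambda>t. trace (G t ** Q t ** transpose (G t))) + \<eta> * C"
    using le \<open>\<eta> \<ge> 0\<close> by (intro add_left_mono mult_left_mono)
  finally show ?thesis .
qed

text \<open>The difference quotient over the cell of the partition into \<open>n\<close> equal parts that contains \<open>t\<close>.\<close>

definition diffquot :: "(real \<Rightarrow> 'a::real_normed_vector) \<Rightarrow> nat \<Rightarrow> real \<Rightarrow> 'a" where
  "diffquot f n t = real n *\<^sub>R (f ((of_int \<lfloor>real n * t\<rfloor> + 1) / real n) - f (of_int \<lfloor>real n * t\<rfloor> / real n))"

text \<open>For \<open>t < 1\<close> the cell stays inside the unit interval; at
  \<open>t = 1\<close> the floor would select the cell that begins at 1.\<close>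

lemma floor_grid:
  assumes "n > 0" and t: "0 \<le> t" "t < 1"
  defines "u \<equiv> of_int \<lfloor>real n * t\<rfloor> / real n" and "v \<equiv> (of_int \<lfloor>real n * t\<rfloor> + 1) / real n"
  shows "0 \<le> u" "u \<le> t" "t \<le> v" "v \<le> 1" "v - u = 1 / real n"
proof -
  have n: "real n > 0" using \<open>n > 0\<close> by simp
  show "0 \<le> u" using n t by (simp add: u_def)
  show "u \<le> t" using n of_int_floor_le[of "real n * t"] by (simp add: u_def pos_divide_le_eq mult.commute)
  show "t \<le> v" using n floor_correct[of "real n * t"] by (simp add: v_def pos_le_divide_eq mult.commute)
  have "real n * t < of_nat n" using n t by simp
  then have "\<lfloor>real n * t\<rfloor> < int n" by (simp add: floor_less_iff)
  then have "\<lfloor>real n * t\<rfloor> + 1 \<le> int n" by simp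
  then have "of_int (\<lfloor>real n * t\<rfloor> + 1) \<le> real n" by linarith
  then show "v \<le> 1" using n by (simp add: v_def)
  show "v - u = 1 / real n" by (simp add: u_def v_def diff_divide_distrib[symmetric])
qed

text \<open>The point \<open>t\<close> may lie anywhere in its cell, so the straddle estimate is
  what applies; it is multiplied by the reciprocal of the cell length.\<close>

lemma diffquot_tendsto:
  fixes f :: "real \<Rightarrow> 'a::real_normed_vector"
  assumes der: "(f has_vector_derivative D) (at t within {0..1})" and t: "0 \<le> t" "t < 1"
  shows "(\<lambda>n. diffquot f (Suc n) t) \<longlonglongrightarrow> D"
proof (rule LIMSEQ_I)
  fix e :: real assume "e > 0"
  then have "e/2 > 0" by simp
  obtain d where "d > 0" and d: "\<And>u v. u \<in> {0..1} \<Longrightarrow> v \<in> {0..1} \<Longrightarrow> u \<le> t \<Longrightarrow> t \<le> v \<Longrightarrow> v - u < d \<Longrightarrow>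
    norm (f v - f u - (v - u) *\<^sub>R D) \<le> e/2 * (v - u)"
  proof (rule has_vector_derivative_straddle[OF der _ \<open>e/2 > 0\<close>])
    show "t \<in> {0..1}" using t by simp
  qed (rule that)
  obtain n0 where n0: "1 / real (Suc n0) < d" using nat_approx_posE[OF \<open>d > 0\<close>] by auto
  show "\<exists>no. \<forall>n\<ge>no. norm (diffquot f (Suc n) t - D) < e"
  proof (intro exI[of _ n0] allI impI)
    fix n assume "n \<ge> n0"
    define m where "m = real (Suc n)"
    have "m > 0" by (simp add: m_def)
    define u v where "u = of_int \<lfloor>m * t\<rfloor> / m" and "v = (of_int \<lfloor>m * t\<rfloor> + 1) / m"
    have uv: "0 \<le> u" "u \<le> t" "t \<le> v" "v \<le> 1" "v - u = 1 / m"
      using floor_grid[of "Suc n" t] t unfolding u_def v_def m_def by auto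
    have "1 / m \<le> 1 / real (Suc n0)" using \<open>n \<ge> n0\<close> unfolding m_def by (intro divide_left_mono) auto
    then have "v - u < d" using uv n0 by linarith
    then have "norm (f v - f u - (v - u) *\<^sub>R D) \<le> e/2 * (v - u)"
      using uv by (intro d) auto
    then have le: "m * norm (f v - f u - (1 / m) *\<^sub>R D) \<le> e/2"
      using \<open>m > 0\<close> unfolding uv(5) by (simp add: field_simps)
    have "diffquot f (Suc n) t - D = m *\<^sub>R (f v - f u - (1 / m) *\<^sub>R D)"
      using \<open>m > 0\<close> by (simp add: diffquot_def u_def v_def m_def scaleR_diff_right)
    then have "norm (diffquot f (Suc n) t - D) = m * norm (f v - f u - (1 / m) *\<^sub>R D)"
      using \<open>m > 0\<close> by simp
    then show "norm (diffquot f (Suc n) t - D) < e" using le \<open>e > 0\<close> by linarith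
  qed
qed

text \<open>Any function of an integer is measurable, so step functions built from arbitrary values
  of a curve are measurable.\<close>

lemma borel_measurable_floor_comp:
  fixes H :: "int \<Rightarrow> 'a::euclidean_space" and c :: real
  shows "(\<lambda>t. H \<lfloor>c * t\<rfloor>) \<in> borel_measurable (lebesgue_on S)"
proof -
  have "(\<lambda>t::real. \<lfloor>c * t\<rfloor>) \<in> measurable borel (count_space UNIV)" by measurable
  then have "(\<lambda>t::real. H \<lfloor>c * t\<rfloor>) \<in> borel_measurable borel"
    by (rule measurable_compose) simp
  then have "(\<lambda>t::real. H \<lfloor>c * t\<rfloor>) \<in> borel_measurable lebesgue"
    by (intro measurable_completion) simp
  then show ?thesis by (rule measurable_restrict_space1)
qed

lemma derivative_borel_measurable:
  fixes \<Phi> D :: "real \<Rightarrow> 'a::euclidean_space"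
  assumes "negligible Z" and "\<And>t. t \<in> {0..1} - Z \<Longrightarrow> (\<Phi> has_vector_derivative D t) (at t within {0..1})"
  shows "D \<in> borel_measurable (lebesgue_on {0..1})"
proof -
  have "D measurable_on {0..1}"
  proof (rule measurable_on_limit[of "\<lambda>n. diffquot \<Phi> (Suc n)"])
    show "diffquot \<Phi> (Suc n) measurable_on {0..1}" for n
      using borel_measurable_floor_comp[of "\<lambda>k. real (Suc n) *\<^sub>R (\<Phi> ((of_int k + 1) / real (Suc n)) - \<Phi> (of_int k / real (Suc n)))"]
      by (simp add: measurable_on_iff_borel_measurable diffquot_def[abs_def])
    show "negligible (insert 1 Z)" using assms(1) by simp
    show "(\<lambda>n. diffquot \<Phi> (Suc n) x) \<longlonglongrightarrow> D x" if "x \<in> {0..1} - insert 1 Z" for x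
      by (rule diffquot_tendsto[OF assms(2)]) (use that in auto)
  qed
  then show ?thesis by (simp add: measurable_on_iff_borel_measurable)
qed

text \<open>The order of the two limits matters. For a fixed partition only finitely many values of
  the curves enter, so \<open>j\<close> can tend to infinity in \<open>difference_sums_le\<close> by
  pointwise convergence; this bounds the integral of the step function \<open>S n\<close> by
  \<open>I\<close> plus an error from the oscillation of \<open>P\<close>. Only then does
  \<open>n\<close> tend to infinity, with \<open>S n\<close> converging almost everywhere to the
  form in \<open>D t\<close>.\<close>

lemma quadratic_cost_lsc:
  fixes \<Phi> D :: "real \<Rightarrow> real^'n^'n" and \<Phi>s G Ps :: "nat \<Rightarrow> real \<Rightarrow> real^'n^'n" and P :: "real \<Rightarrow> real^'n^'n"
  assumes lim: "\<And>t. t \<in> {0..1} \<Longrightarrow> (\<lambda>j. \<Phi>s j t) \<longlonglongrightarrow> \<Phi> t"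
    and flow: "\<And>j s t. 0 \<le> s \<Longrightarrow> s \<le> t \<Longrightarrow> t \<le> 1 \<Longrightarrow> (G j has_integral \<Phi>s j t - \<Phi>s j s) {s..t}"
    and sq: "\<And>j. (\<lambda>t. (norm (G j t))\<^sup>2) integrable_on {0..1}"
    and le: "\<And>j. integral {0..1} (\<lambda>t. (norm (G j t))\<^sup>2) \<le> C"
    and P_cont: "continuous_on {0..1} P"
    and sym: "\<And>t. t \<in> {0..1} \<Longrightarrow> transpose (P t) = P t"
    and psd: "\<And>t (A::real^'n^'n). t \<in> {0..1} \<Longrightarrow> 0 \<le> trace (A ** P t ** transpose A)"
    and Plim: "\<And>e. e > 0 \<Longrightarrow> eventually (\<lambda>j. \<forall>t\<in>{0..1}. norm (Ps j t - P t) \<le> e) sequentially"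
    and q: "\<And>j. (\<lambda>t. trace (G j t ** Ps j t ** transpose (G j t))) integrable_on {0..1}"
    and I: "(\<lambda>j. integral {0..1} (\<lambda>t. trace (G j t ** Ps j t ** transpose (G j t)))) \<longlonglongrightarrow> I"
    and Z: "negligible Z" and der: "\<And>t. t \<in> {0..1} - Z \<Longrightarrow> (\<Phi> has_vector_derivative D t) (at t within {0..1})"
  shows "(\<lambda>t. trace (D t ** P t ** transpose (D t))) integrable_on {0..1}"
    and "integral {0..1} (\<lambda>t. trace (D t ** P t ** transpose (D t))) \<le> I"
proof -
  have "0 \<le> integral {0..1} (\<lambda>t. (norm (G 0 t))\<^sup>2)" by (rule integral_nonneg[OF sq]) simp
  then have "C \<ge> 0" using le[of 0] by linarith
  define g where "g n t = of_int \<lfloor>real n * t\<rfloor> / real n" for n :: nat and t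
  define S where "S n t = trace (diffquot \<Phi> n t ** P (g n t) ** transpose (diffquot \<Phi> n t))" for n t
  define \<Delta> where "\<Delta> f n i = f ((real i + 1) / real n) - f (real i / real n)" for f :: "real \<Rightarrow> real^'n^'n" and n i :: nat
  have S_int: "(S n has_integral (\<Sum>i<n. real n * trace (\<Delta> \<Phi> n i ** P (real i / real n) ** transpose (\<Delta> \<Phi> n i)))) {0..1}"
    if "n > 0" for n
  proof (rule has_integral_uniform_partition[OF that])
    fix i assume "i < n"
    let ?s = "real i / real n" and ?t = "(real i + 1) / real n"
    let ?c = "trace (\<Delta> \<Phi> n i ** P ?s ** transpose (\<Delta> \<Phi> n i))"
    have n: "real n > 0" using that by simp
    \<comment> \<open>On the cell \<open>S n\<close> is constant: the difference quotient
      contributes the factor \<open>real n\<close> twice, and the cell length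
      \<open>1 / real n\<close> cancels one of them.\<close>
    have "((\<lambda>t. real n * (real n * ?c)) has_integral (?t - ?s) *\<^sub>R (real n * (real n * ?c))) {?s..?t}"
      using has_integral_const_real[of "real n * (real n * ?c)" ?s ?t] by (simp add: divide_right_mono)
    moreover have "(?t - ?s) *\<^sub>R (real n * (real n * ?c)) = real n * ?c"
      using n by (simp add: diff_divide_distrib[symmetric])
    ultimately have "((\<lambda>t. real n * (real n * ?c)) has_integral real n * ?c) {?s..?t}" by (simp only:)
    then show "(S n has_integral real n * ?c) {?s..?t}"
    \<comment> \<open>The floor at the right endpoint belongs to the next cell; dropping this point
      leaves the half-open cell on which the floor is \<open>int i\<close>.\<close>
    proof (rule has_integral_spike_finite[of "{?t}", rotated 2])
      fix x assume x: "x \<in> {?s..?t} - {?t}"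
      then have "?s \<le> x" "x < ?t" by auto
      then have "real i \<le> real n * x" "real n * x < real i + 1"
        using n by (auto simp: pos_divide_le_eq pos_less_divide_eq mult.commute)
      then have fl: "\<lfloor>real n * x\<rfloor> = int i" by (simp add: floor_eq_iff)
      show "S n x = real n * (real n * ?c)"
        unfolding S_def g_def diffquot_def fl of_int_of_nat_eq \<Delta>_def[symmetric]
          bounded_bilinear.scaleR_left[OF bounded_bilinear_trace_form] bounded_bilinear.scaleR_right[OF bounded_bilinear_trace_form]
        by simp
    qed simp
  qed
  have S_le: "integral {0..1} (S n) \<le> I + 2 * \<eta> * C"
    if "n > 0" "\<eta> > 0" and cl: "\<And>s t. s \<in> {0..1} \<Longrightarrow> t \<in> {0..1} \<Longrightarrow> \<bar>s - t\<bar> \<le> 1 / real n \<Longrightarrow> norm (P s - P t) \<le> \<eta>" for n \<eta>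
  proof -
    have "(\<Sum>i<n. real n * trace (\<Delta> \<Phi> n i ** P (real i / real n) ** transpose (\<Delta> \<Phi> n i))) \<le> I + 2 * \<eta> * C"
    proof (rule tendsto_le[OF sequentially_bot])
      show "(\<lambda>j. integral {0..1} (\<lambda>t. trace (G j t ** Ps j t ** transpose (G j t))) + 2 * \<eta> * C) \<longlonglongrightarrow> I + 2 * \<eta> * C"
        by (intro tendsto_intros I)
      show "(\<lambda>j. \<Sum>i<n. real n * trace (\<Delta> (\<Phi>s j) n i ** P (real i / real n) ** transpose (\<Delta> (\<Phi>s j) n i)))
          \<longlonglongrightarrow> (\<Sum>i<n. real n * trace (\<Delta> \<Phi> n i ** P (real i / real n) ** transpose (\<Delta> \<Phi> n i)))"
        unfolding \<Delta>_def
      proof (intro tendsto_sum tendsto_mult tendsto_const tendsto_trace_form tendsto_diff lim)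
        fix i assume "i \<in> {..<n}"
        then show "(real i + 1) / real n \<in> {0..1}" "real i / real n \<in> {0..1}" by auto
      qed
      show "eventually (\<lambda>j. (\<Sum>i<n. real n * trace (\<Delta> (\<Phi>s j) n i ** P (real i / real n) ** transpose (\<Delta> (\<Phi>s j) n i)))
          \<le> integral {0..1} (\<lambda>t. trace (G j t ** Ps j t ** transpose (G j t))) + 2 * \<eta> * C) sequentially"
        using Plim[OF \<open>\<eta> > 0\<close>]
      proof eventually_elim
        case (elim j)
        show ?case
          unfolding \<Delta>_def
        proof (rule difference_sums_le[OF flow[of _ _ j] sq[of j] le[of j] q[of j] sym psd \<open>n > 0\<close>])
          fix s t :: real assume st: "s \<in> {0..1}" "t \<in> {0..1}" "\<bar>s - t\<bar> \<le> 1 / real n"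
          \<comment> \<open>One \<open>\<eta>\<close> pays for moving from \<open>s\<close> to
            \<open>t\<close> within a cell, the other for replacing \<open>P\<close> by
            \<open>Ps j\<close>.\<close>
          have "norm (P s - Ps j t) \<le> norm (P s - P t) + norm (Ps j t - P t)"
            using norm_triangle_ineq4[of "P s - P t" "Ps j t - P t"] by simp
          then show "norm (P s - Ps j t) \<le> 2 * \<eta>" using cl[OF st] elim st(2) by fastforce
        qed (use \<open>\<eta> > 0\<close> in auto)
      qed
    qed
    then show ?thesis using integral_unique[OF S_int[OF \<open>n > 0\<close>]] by simp
  qed
  have S_ev: "eventually (\<lambda>n. integral {0..1} (S (Suc n)) \<le> I + e) sequentially" if "e > 0" for e
  proof -
    define \<eta> where "\<eta> = e / (2 * (C + 1))"
    have "\<eta> > 0" using \<open>e > 0\<close> \<open>C \<ge> 0\<close> by (simp add: \<eta>_def)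
    have \<eta>C: "2 * \<eta> * C \<le> e" using \<open>e > 0\<close> \<open>C \<ge> 0\<close> by (simp add: \<eta>_def field_simps)
    have "uniformly_continuous_on {0..1} P"
      by (rule compact_uniformly_continuous[OF P_cont]) simp
    then obtain d where "d > 0" and d: "\<And>s t. s \<in> {0..1} \<Longrightarrow> t \<in> {0..1} \<Longrightarrow> dist s t < d \<Longrightarrow> dist (P s) (P t) < \<eta>"
      unfolding uniformly_continuous_on_def using \<open>\<eta> > 0\<close> by metis
    obtain n0 where n0: "1 / real (Suc n0) < d" using nat_approx_posE[OF \<open>d > 0\<close>] by auto
    have "integral {0..1} (S (Suc n)) \<le> I + e" if "n \<ge> n0" for n
    proof -
      have "1 / real (Suc n) \<le> 1 / real (Suc n0)" using that by (intro divide_left_mono) auto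
      then have "norm (P s - P t) \<le> \<eta>" if "s \<in> {0..1}" "t \<in> {0..1}" "\<bar>s - t\<bar> \<le> 1 / real (Suc n)" for s t
        using d[of s t] that n0 by (simp add: dist_norm)
      from S_le[OF _ \<open>\<eta> > 0\<close> this] \<eta>C show ?thesis by fastforce
    qed
    then show ?thesis unfolding eventually_sequentially by blast
  qed
  have S_lim: "(\<lambda>n. S (Suc n) t) \<longlonglongrightarrow> trace (D t ** P t ** transpose (D t))" if t: "t \<in> {0..1} - insert 1 Z" for t
  proof -
    have t': "t \<in> {0..1} - Z" "0 \<le> t" "t < 1" using t by auto
    have glim: "(\<lambda>n. g (Suc n) t) \<longlonglongrightarrow> t"
    proof (rule tendsto_sandwich)
      show "eventually (\<lambda>n. t - 1 / real (Suc n) \<le> g (Suc n) t) sequentially"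
        "eventually (\<lambda>n. g (Suc n) t \<le> t) sequentially"
      proof -
        have "t - 1 / real (Suc n) \<le> g (Suc n) t" "g (Suc n) t \<le> t" for n
          using floor_grid[of "Suc n" t] t' unfolding g_def by auto
        then show "eventually (\<lambda>n. t - 1 / real (Suc n) \<le> g (Suc n) t) sequentially"
          "eventually (\<lambda>n. g (Suc n) t \<le> t) sequentially" by auto
      qed
      show "(\<lambda>n. t - 1 / real (Suc n)) \<longlonglongrightarrow> t"
        using tendsto_diff[OF tendsto_const LIMSEQ_inverse_real_of_nat, of t] by (simp add: inverse_eq_divide)
    qed simp
    have "(\<lambda>n. P (g (Suc n) t)) \<longlonglongrightarrow> P t"
    proof (rule continuous_on_tendsto_compose[OF P_cont glim])
      show "t \<in> {0..1}" using t by blast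
      have "g (Suc n) t \<in> {0..1}" for n
        using floor_grid[of "Suc n" t] t' unfolding g_def by auto
      then show "eventually (\<lambda>n. g (Suc n) t \<in> {0..1}) sequentially" by simp
    qed
    then show ?thesis
      unfolding S_def by (intro tendsto_trace_form diffquot_tendsto[OF der[OF t'(1)] t'(2,3)])
  qed
  have S_nonneg: "0 \<le> S (Suc n) t" if "t \<in> {0..1}" for n t
  proof -
    \<comment> \<open>At \<open>t = 1\<close> the grid point is 1 itself. The difference quotient
      then uses a value of \<Phi> beyond 1, which is harmless: nonnegativity only concerns the
      weight at the grid point.\<close>
    have "g (Suc n) t \<in> {0..1}"
    proof (cases "t = 1")
      case True
      then have "\<lfloor>real (Suc n) * t\<rfloor> = int (Suc n)" by (simp del: of_nat_Suc)
      then show ?thesis by (simp add: g_def del: of_nat_Suc)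
    next
      case False
      then show ?thesis using floor_grid[of "Suc n" t] that unfolding g_def by auto
    qed
    then show ?thesis unfolding S_def by (rule psd)
  qed
  have S_i: "S (Suc n) integrable_on {0..1}" for n
    using S_int[of "Suc n"] by blast
  have Z1: "negligible (insert 1 Z)" using Z by simp
  show "(\<lambda>t. trace (D t ** P t ** transpose (D t))) integrable_on {0..1}"
    by (rule Fatou_integrable_on(1)[of "\<lambda>n. S (Suc n)", OF S_i S_nonneg Z1 S_lim S_ev])
  show "integral {0..1} (\<lambda>t. trace (D t ** P t ** transpose (D t))) \<le> I"
    by (rule Fatou_integrable_on(2)[of "\<lambda>n. S (Suc n)", OF S_i S_nonneg Z1 S_lim S_ev])
qed

section \<open>Existence of a minimizer\<close>

definition cost_weight :: "real^'n^'n \<Rightarrow> real \<Rightarrow> real^'n^'n \<Rightarrow> real^'n^'n" where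
  "cost_weight \<Sigma> \<epsilon> \<Phi> = \<Sigma> + \<epsilon> *\<^sub>R (matrix_inv \<Phi> ** transpose (matrix_inv \<Phi>))"

lemma trace_cost_weight:
  fixes A :: "real^'n^'m"
  shows "trace (A ** cost_weight \<Sigma> \<epsilon> \<Phi> ** transpose A)
    = trace (A ** \<Sigma> ** transpose A) + \<epsilon> * (norm (A ** matrix_inv \<Phi>))\<^sup>2"
proof -
  let ?Q = "matrix_inv \<Phi>"
  have "A ** cost_weight \<Sigma> \<epsilon> \<Phi> ** transpose A = A ** \<Sigma> ** transpose A + \<epsilon> *\<^sub>R ((A ** ?Q) ** transpose (A ** ?Q))"
    unfolding cost_weight_def
    by (simp add: bounded_bilinear.add_left[OF bounded_bilinear_matrix_mult] bounded_bilinear.add_right[OF bounded_bilinear_matrix_mult]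
      bounded_bilinear.scaleR_left[OF bounded_bilinear_matrix_mult] bounded_bilinear.scaleR_right[OF bounded_bilinear_matrix_mult]
      matrix_transpose_mul matrix_mul_assoc)
  moreover have "trace (\<epsilon> *\<^sub>R B) = \<epsilon> * trace B" for B :: "real^'m^'m"
    by (simp add: trace_def sum_distrib_left)
  ultimately show ?thesis
    by (simp add: trace_add trace_mult_transpose)
qed

lemma trace_sym_pos_def_nonneg:
  assumes "sym_pos_def \<Sigma>"
  shows "0 \<le> trace (A ** \<Sigma> ** transpose A)"
  unfolding trace_quadratic_form
proof (rule sum_nonneg)
  show "0 \<le> A $ i \<bullet> (\<Sigma> *v (A $ i))" for i
    using assms unfolding sym_pos_def_def by (cases "A $ i = 0") (auto simp: less_imp_le)
qed

lemma trace_cost_weight_flow: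
  fixes K :: "real^'n^'m"
  assumes "invertible \<Phi>"
  shows "trace ((K ** \<Phi>) ** cost_weight \<Sigma> \<epsilon> \<Phi> ** transpose (K ** \<Phi>))
    = trace (K ** \<Phi> ** \<Sigma> ** transpose \<Phi> ** transpose K) + \<epsilon> * trace (K ** transpose K)"
proof -
  have "K ** \<Phi> ** matrix_inv \<Phi> = K"
    by (simp add: matrix_mul_assoc[symmetric] matrix_inv_mult[OF assms])
  then show ?thesis
    unfolding trace_cost_weight by (simp add: trace_mult_transpose matrix_transpose_mul matrix_mul_assoc)
qed

text \<open>For the two inverses \<open>A\<close> and \<open>B\<close>, the identity
  \<open>A - B = A (\<Psi> - \<Phi>) B\<close> makes inversion Lipschitz on bounded sets of
  inverses. The difference of the two Gram products splits into two terms, each at most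
  \<open>b ^ 3\<close> times the distance, whence \<open>2 * b ^ 3\<close>. Uniform convergence of
  the flows thus becomes uniform convergence of the weights.\<close>

lemma norm_cost_weight_diff:
  assumes inv: "invertible \<Phi>" "invertible \<Psi>" and "\<epsilon> \<ge> 0"
    and b: "norm (matrix_inv \<Phi>) \<le> b" "norm (matrix_inv \<Psi>) \<le> b"
  shows "norm (cost_weight \<Sigma> \<epsilon> \<Phi> - cost_weight \<Sigma> \<epsilon> \<Psi>) \<le> \<epsilon> * (2 * b ^ 3) * norm (\<Phi> - \<Psi>)"
proof -
  let ?A = "matrix_inv \<Phi>" and ?B = "matrix_inv \<Psi>"
  have "b \<ge> 0" using b(1) norm_ge_zero order_trans by blast
  have "?A ** (\<Psi> - \<Phi>) ** ?B = ?A ** (\<Psi> ** ?B) - (?A ** \<Phi>) ** ?B"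
    by (simp add: bounded_bilinear.diff_left[OF bounded_bilinear_matrix_mult] bounded_bilinear.diff_right[OF bounded_bilinear_matrix_mult]
      matrix_mul_assoc)
  then have AB: "?A - ?B = ?A ** (\<Psi> - \<Phi>) ** ?B"
    by (simp add: matrix_inv_mult[OF inv(1)] matrix_inv_mult[OF inv(2)])
  have "norm (?A - ?B) \<le> norm (?A ** (\<Psi> - \<Phi>)) * norm ?B"
    unfolding AB by (rule norm_matrix_mult_le)
  also have "\<dots> \<le> (norm ?A * norm (\<Psi> - \<Phi>)) * norm ?B"
    by (intro mult_right_mono norm_matrix_mult_le) simp
  also have "\<dots> \<le> (b * norm (\<Psi> - \<Phi>)) * b"
    using b \<open>b \<ge> 0\<close> by (intro mult_mono) auto
  finally have d: "norm (?A - ?B) \<le> b\<^sup>2 * norm (\<Phi> - \<Psi>)"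
    by (simp add: norm_minus_commute power2_eq_square mult_ac)
  have "transpose (?A - ?B) = transpose ?A - transpose ?B"
    by (rule linear_diff[OF bounded_linear.linear[OF bounded_linear_transpose]])
  then have "?A ** transpose ?A - ?B ** transpose ?B = ?A ** transpose (?A - ?B) + (?A - ?B) ** transpose ?B"
    by (simp add: bounded_bilinear.diff_left[OF bounded_bilinear_matrix_mult] bounded_bilinear.diff_right[OF bounded_bilinear_matrix_mult])
  then have "norm (?A ** transpose ?A - ?B ** transpose ?B) \<le> norm (?A ** transpose (?A - ?B)) + norm ((?A - ?B) ** transpose ?B)"
    by (simp add: norm_triangle_ineq)
  also have "\<dots> \<le> norm ?A * norm (?A - ?B) + norm (?A - ?B) * norm ?B"
    using norm_matrix_mult_le[of ?A "transpose (?A - ?B)"] norm_matrix_mult_le[of "?A - ?B" "transpose ?B"]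
    unfolding norm_transpose by linarith
  also have "\<dots> \<le> b * (b\<^sup>2 * norm (\<Phi> - \<Psi>)) + (b\<^sup>2 * norm (\<Phi> - \<Psi>)) * b"
    using b d \<open>b \<ge> 0\<close> by (intro add_mono mult_mono) auto
  finally have "norm (?A ** transpose ?A - ?B ** transpose ?B) \<le> 2 * b ^ 3 * norm (\<Phi> - \<Psi>)"
    by (simp add: power2_eq_square power3_eq_cube mult_ac)
  then have "\<epsilon> * norm (?A ** transpose ?A - ?B ** transpose ?B) \<le> \<epsilon> * (2 * b ^ 3 * norm (\<Phi> - \<Psi>))"
    using \<open>\<epsilon> \<ge> 0\<close> by (rule mult_left_mono)
  moreover have "cost_weight \<Sigma> \<epsilon> \<Phi> - cost_weight \<Sigma> \<epsilon> \<Psi> = \<epsilon> *\<^sub>R (?A ** transpose ?A - ?B ** transpose ?B)"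
    by (simp add: cost_weight_def scaleR_diff_right)
  ultimately show ?thesis using \<open>\<epsilon> \<ge> 0\<close> by simp
qed

text \<open>All constants depend on the control only through \<open>C\<close>, so they are common to
  a whole minimizing sequence. The third estimate is growth from \<open>t\<close> back to 0. In this
  form, for arbitrary \<open>X\<close>, it passes to limits of flows and yields their invertibility;
  with \<open>X\<close> the inverse of \<open>\<Phi> t\<close> it bounds that inverse by
  \<open>b\<close>.\<close>

lemma admissible_estimates:
  fixes K \<Phi> :: "real \<Rightarrow> real^'n^'n" and p :: nat
  assumes adm: "admissible2 \<Sigma>0 \<Sigma>1 Y N K \<Phi>"
    and C: "integral {0..1} (\<lambda>t. (norm (K t))\<^sup>2) \<le> C" and p: "p > 0" "4 * C \<le> real p"
  defines "b \<equiv> 2 ^ p * norm (mat 1 :: real^'n^'n)"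
  shows "\<And>s t. 0 \<le> s \<Longrightarrow> s \<le> t \<Longrightarrow> t \<le> 1 \<Longrightarrow> ((\<lambda>r. K r ** \<Phi> r) has_integral \<Phi> t - \<Phi> s) {s..t}"
    and "\<And>t. t \<in> {0..1} \<Longrightarrow> norm (\<Phi> t) \<le> b"
    and "\<And>t X. t \<in> {0..1} \<Longrightarrow> norm (X::real^'n^'n) \<le> 2 ^ p * norm (\<Phi> t ** X)"
    and "(\<lambda>t. (norm (K t ** \<Phi> t))\<^sup>2) integrable_on {0..1}"
    and "integral {0..1} (\<lambda>t. (norm (K t ** \<Phi> t))\<^sup>2) \<le> b\<^sup>2 * C"
proof -
  from adm have ac: "abs_continuous_on {0..1} \<Phi>" and \<Phi>0: "\<Phi> 0 = mat 1"
    and der: "\<forall>t\<in>{0..1}. \<forall>D. (\<Phi> has_vector_derivative D) (at t within {0..1}) \<longrightarrow> D = K t ** \<Phi> t"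
    and Ksq: "square_integrable_on {0..1} K"
    by (simp_all add: admissible2_def)
  have Ki: "(\<lambda>t. (norm (K t))\<^sup>2) integrable_on {0..1}" using Ksq by (simp add: square_integrable_on_iff)
  have cont: "continuous_on {0..1} \<Phi>" by (rule abs_continuous_on_imp_continuous_on[OF ac])
  show flow: "((\<lambda>r. K r ** \<Phi> r) has_integral \<Phi> t - \<Phi> s) {s..t}" if "0 \<le> s" "s \<le> t" "t \<le> 1" for s t
    by (rule flow_has_integral[OF ac der that])
  have grow: "norm (\<Phi> t ** X) \<le> 2 ^ p * norm (\<Phi> s ** X)" if st: "s \<in> {0..1}" "t \<in> {0..1}" for s t and X :: "real^'n^'n"
  proof (rule linear_flow_growth[OF _ Ki C p _ st, of "\<lambda>t. \<Phi> t ** X"])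
    show "continuous_on {0..1} (\<lambda>t. \<Phi> t ** X)" by (intro continuous_on_matrix_mult cont continuous_on_const)
    show "((\<lambda>r. K r ** (\<Phi> r ** X)) has_integral \<Phi> t ** X - \<Phi> s ** X) {s..t}" if "0 \<le> s" "s \<le> t" "t \<le> 1" for s t
      using has_integral_linear[OF flow[OF that] bounded_bilinear.bounded_linear_left[OF bounded_bilinear_matrix_mult, of X]]
      by (simp add: o_def matrix_mul_assoc bounded_bilinear.diff_left[OF bounded_bilinear_matrix_mult])
  qed
  show b: "norm (\<Phi> t) \<le> b" if "t \<in> {0..1}" for t
    using grow[of 0 t "mat 1"] that by (simp add: \<Phi>0 b_def)
  show "norm X \<le> 2 ^ p * norm (\<Phi> t ** X)" if "t \<in> {0..1}" for t and X :: "real^'n^'n"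
    using grow[of t 0 X] that by (simp add: \<Phi>0)
  show Gi: "(\<lambda>t. (norm (K t ** \<Phi> t))\<^sup>2) integrable_on {0..1}"
    using square_integrable_on_mult_continuous[OF Ksq cont] by (simp add: square_integrable_on_iff)
  have "integral {0..1} (\<lambda>t. (norm (K t ** \<Phi> t))\<^sup>2) \<le> integral {0..1} (\<lambda>t. b\<^sup>2 * (norm (K t))\<^sup>2)"
  proof (rule integral_le[OF Gi integrable_on_mult_right[OF Ki]])
    fix t :: real assume t: "t \<in> {0..1}"
    have "norm (K t ** \<Phi> t) \<le> norm (K t) * b"
      using norm_matrix_mult_le[of "K t" "\<Phi> t"] mult_left_mono[OF b[OF t], of "norm (K t)"] by simp
    then have "(norm (K t ** \<Phi> t))\<^sup>2 \<le> (norm (K t) * b)\<^sup>2" by (intro power_mono) auto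
    then show "(norm (K t ** \<Phi> t))\<^sup>2 \<le> b\<^sup>2 * (norm (K t))\<^sup>2" by (simp add: power_mult_distrib mult.commute)
  qed
  also have "\<dots> \<le> b\<^sup>2 * C" using C by (simp add: mult_left_mono)
  finally show "integral {0..1} (\<lambda>t. (norm (K t ** \<Phi> t))\<^sup>2) \<le> b\<^sup>2 * C" .
qed

lemma cost2_eq:
  fixes \<epsilon> :: real
  assumes "\<And>t. t \<in> {0..1} \<Longrightarrow> invertible (\<Phi> t)"
    and i1: "(\<lambda>t. trace (K t ** \<Phi> t ** \<Sigma>0 ** transpose (\<Phi> t) ** transpose (K t))) integrable_on {0..1}"
    and i2: "(\<lambda>t. trace (K t ** transpose (K t))) integrable_on {0..1}"
  defines "q \<equiv> \<lambda>t. trace ((K t ** \<Phi> t) ** cost_weight \<Sigma>0 \<epsilon> (\<Phi> t) ** transpose (K t ** \<Phi> t))"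
  shows "q integrable_on {0..1}" "cost2 \<Sigma>0 \<epsilon> K \<Phi> = 1/2 * integral {0..1} q"
proof -
  let ?q = "\<lambda>t. trace (K t ** \<Phi> t ** \<Sigma>0 ** transpose (\<Phi> t) ** transpose (K t)) + \<epsilon> * trace (K t ** transpose (K t))"
  have eq: "?q t = q t" if "t \<in> {0..1}" for t
    using trace_cost_weight_flow[OF assms(1)[OF that], of "K t" \<Sigma>0 \<epsilon>] by (simp add: q_def)
  have qi: "?q integrable_on {0..1}" by (intro integrable_add i1 integrable_on_mult_right i2)
  then show "q integrable_on {0..1}" by (rule integrable_eq) (rule eq)
  have "integral {0..1} q = integral {0..1} ?q" by (rule integral_cong) (simp add: eq)
  also have "\<dots> = integral {0..1} (\<lambda>t. trace (K t ** \<Phi> t ** \<Sigma>0 ** transpose (\<Phi> t) ** transpose (K t))) + \<epsilon> * integral {0..1} (\<lambda>t. trace (K t ** transpose (K t)))"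
    using i1 i2 by (subst integral_add) (auto intro!: integrable_on_mult_right)
  finally show "cost2 \<Sigma>0 \<epsilon> K \<Phi> = 1/2 * integral {0..1} q"
    by (simp add: cost2_def J_KE_def J_A_def algebra_simps)
qed

text \<open>Coercivity: the kinetic term is nonnegative, so for positive \<epsilon> a bound on the
  cost bounds the control in mean square.\<close>

lemma admissible_cost_bound:
  assumes adm: "admissible2 \<Sigma>0 \<Sigma>1 Y N K \<Phi>" and S0: "sym_pos_def \<Sigma>0"
  shows "\<epsilon> / 2 * integral {0..1} (\<lambda>t. (norm (K t))\<^sup>2) \<le> cost2 \<Sigma>0 \<epsilon> K \<Phi>"
proof -
  have "0 \<le> trace (K t ** \<Phi> t ** \<Sigma>0 ** transpose (\<Phi> t) ** transpose (K t))" for t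
    using trace_sym_pos_def_nonneg[OF S0, of "K t ** \<Phi> t"] by (simp add: matrix_transpose_mul matrix_mul_assoc)
  then have "0 \<le> J_KE \<Sigma>0 K \<Phi>"
    using adm by (simp add: J_KE_def admissible2_def integral_nonneg)
  then show ?thesis by (simp add: cost2_def J_A_def trace_mult_transpose)
qed

theorem theorem2:
  fixes \<Sigma>0 \<Sigma>1 :: "real^'n^'n"
    and \<epsilon> :: real
    and Y :: "real \<Rightarrow> real^'m^'n"
    and N0 :: "real^'n^'k"
    and N :: "real \<Rightarrow> real^'n^'k"
  assumes n2: "CARD('n) \<ge> 2"
    and m_lt: "1 \<le> CARD('m)" "CARD('m) < CARD('n)"
    and k_def: "CARD('k) = CARD('n) - CARD('m)"
    and S0: "sym_pos_def \<Sigma>0" and S1: "sym_pos_def \<Sigma>1"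
    and eps: "\<epsilon> > 0"
    and Y_C1: "\<exists>Y'. continuous_on {0..1} Y' \<and>
                 (\<forall>t\<in>{0..1}. (Y has_vector_derivative Y' t) (at t within {0..1}))"
    and Y_rank: "\<forall>t\<in>{0..1}. rank (Y t) = CARD('m)"
    and N0Y0: "N0 ** Y 0 = 0"
    and N0_rank: "rank (hcat (Y 0) (transpose N0)) = CARD('n)"
    and N_init: "N 0 = N0"
    and N_ode: "\<forall>t\<in>{0..1}. (N has_vector_derivative (- (N t ** Mcurve Y t))) (at t within {0..1})"
    and ex_adm: "\<exists>K \<Phi>. admissible2 \<Sigma>0 \<Sigma>1 Y N K \<Phi>"
  shows "\<exists>Ks \<Phi>s. admissible2 \<Sigma>0 \<Sigma>1 Y N Ks \<Phi>s \<and>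
           (\<forall>K \<Phi>. admissible2 \<Sigma>0 \<Sigma>1 Y N K \<Phi> \<longrightarrow> cost2 \<Sigma>0 \<epsilon> Ks \<Phi>s \<le> cost2 \<Sigma>0 \<epsilon> K \<Phi>)"
proof -
  obtain Y' where Y': "continuous_on {0..1} Y'"
    "\<And>t. t \<in> {0..1} \<Longrightarrow> (Y has_vector_derivative Y' t) (at t within {0..1})"
    using Y_C1 by blast
  interpret tracking Y Y' N
  proof
    show card': "CARD('k) + CARD('m) = CARD('n)" using k_def m_lt by simp
    show "x = 0" if "t \<in> {0..1}" "Y t *v x = 0" for t x
      using Y_rank that full_column_rank_iff by blast
    show "x = 0" if x: "transpose (N 0) *v x = 0" for x
    proof -
      have "rank (hcat (Y 0) (transpose N0)) = CARD('m + 'k)" using N0_rank card' by simp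
      then have inj: "hcat (Y 0) (transpose N0) *v z = 0 \<Longrightarrow> z = 0" for z
        using full_column_rank_iff by blast
      \<comment> \<open>\<open>x\<close> padded with zeros: a kernel vector of
        \<open>transpose N0\<close> becomes one of \<open>hcat (Y 0) (transpose N0)\<close>.\<close>
      define z :: "real^('m + 'k)" where "z = (\<chi> j. case j of Inl a \<Rightarrow> 0 | Inr c \<Rightarrow> x $ c)"
      have "(\<chi> a. z $ Inl a) = 0" "(\<chi> c. z $ Inr c) = x" by (simp_all add: z_def vec_eq_iff)
      then have "hcat (Y 0) (transpose N0) *v z = 0"
        using x by (simp add: hcat_mult_vector N_init)
      then have "z = 0" by (rule inj)
      then have "z $ Inr c = 0" for c by simp
      then show ?thesis by (simp add: z_def vec_eq_iff)
    qed
    show "N 0 ** Y 0 = 0" using N0Y0 N_init by simp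
  qed (use Y' N_ode in auto)
  define A where "A = {(K, \<Phi>). admissible2 \<Sigma>0 \<Sigma>1 Y N K \<Phi>}"
  define cost where "cost = (\<lambda>(K, \<Phi>). cost2 \<Sigma>0 \<epsilon> K \<Phi>)"
  define c where "c = Inf (cost ` A)"
  have cost0: "0 \<le> cost x" if xA: "x \<in> A" for x
  proof -
    obtain K \<Phi> where x: "x = (K, \<Phi>)" by fastforce
    with xA have adm: "admissible2 \<Sigma>0 \<Sigma>1 Y N K \<Phi>" by (simp add: A_def)
    then have "0 \<le> integral {0..1} (\<lambda>t. (norm (K t))\<^sup>2)"
      by (intro integral_nonneg) (auto simp: admissible2_def square_integrable_on_def)
    then have "0 \<le> \<epsilon> / 2 * integral {0..1} (\<lambda>t. (norm (K t))\<^sup>2)" using eps by simp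
    also note admissible_cost_bound[OF adm S0]
    finally show ?thesis by (simp add: cost_def x)
  qed
  have A_ne: "cost ` A \<noteq> {}" using ex_adm by (auto simp: A_def)
  have bdd: "bdd_below (cost ` A)" using cost0 by (intro bdd_belowI[of _ 0]) auto
  have c_le: "c \<le> cost x" if "x \<in> A" for x
    unfolding c_def by (rule cInf_lower[OF imageI[OF that] bdd])
  have "\<exists>x\<in>A. cost x < c + 1 / real (Suc j)" for j
  proof -
    have "Inf (cost ` A) < c + 1 / real (Suc j)" by (simp add: c_def)
    from cInf_lessD[OF A_ne this] show ?thesis by auto
  qed
  then obtain x where x: "\<And>j. x j \<in> A" "\<And>j. cost (x j) < c + 1 / real (Suc j)" by metis
  define Ks where "Ks j = fst (x j)" for j
  define \<Phi>s where "\<Phi>s j = snd (x j)" for j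
  have adm: "admissible2 \<Sigma>0 \<Sigma>1 Y N (Ks j) (\<Phi>s j)" for j
    using x(1)[of j] by (auto simp: A_def Ks_def \<Phi>s_def)
  have cost_eq: "cost2 \<Sigma>0 \<epsilon> (Ks j) (\<Phi>s j) = cost (x j)" for j
    by (simp add: cost_def Ks_def \<Phi>s_def case_prod_unfold)
  have cost_lim: "(\<lambda>j. cost (x j)) \<longlonglongrightarrow> c"
  proof (rule tendsto_sandwich[of "\<lambda>_. c" _ _ "\<lambda>j. c + 1 / real (Suc j)"])
    show "eventually (\<lambda>j. c \<le> cost (x j)) sequentially" using c_le x(1) by simp
    show "eventually (\<lambda>j. cost (x j) \<le> c + 1 / real (Suc j)) sequentially" using x(2) less_imp_le by (intro always_eventually allI) blast
    show "(\<lambda>j. c + 1 / real (Suc j)) \<longlonglongrightarrow> c"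
      using tendsto_add[OF tendsto_const LIMSEQ_inverse_real_of_nat, of c] by (simp add: inverse_eq_divide)
  qed simp
  \<comment> \<open>All costs of the sequence are below \<open>c + 1\<close>, and coercivity divides
    by \<open>\<epsilon> / 2\<close>.\<close>
  define C where "C = 2 * (c + 1) / \<epsilon>"
  have KC: "integral {0..1} (\<lambda>t. (norm (Ks j t))\<^sup>2) \<le> C" for j
  proof -
    have "1 / real (Suc j) \<le> 1" by simp
    then have "\<epsilon> / 2 * integral {0..1} (\<lambda>t. (norm (Ks j t))\<^sup>2) \<le> c + 1"
      using admissible_cost_bound[OF adm[of j] S0, of \<epsilon>] x(2)[of j] unfolding cost_eq by linarith
    then show ?thesis using eps by (simp add: C_def field_simps)
  qed
  obtain p0 :: nat where p0: "4 * C \<le> real p0" using real_arch_simple by blast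
  define p where "p = Suc p0"
  have p: "p > 0" "4 * C \<le> real p" using p0 by (auto simp: p_def)
  define b where "b = 2 ^ p * norm (mat 1 :: real^'n^'n)"
  note est = admissible_estimates[OF adm KC p, folded b_def]
  have "b \<ge> 0" by (simp add: b_def)
  have "C \<ge> 0"
  proof -
    have "0 \<le> integral {0..1} (\<lambda>t. (norm (Ks 0 t))\<^sup>2)"
      using adm[of 0] by (intro integral_nonneg) (auto simp: admissible2_def square_integrable_on_def)
    then show ?thesis using KC[of 0] by linarith
  qed
  \<comment> \<open>Hoelder exponent 1/2, written with squares. The constant is the same for all
    \<open>j\<close>, which gives the equicontinuity for Arzela-Ascoli.\<close>
  have holder: "(norm (\<Phi>s j t - \<Phi>s j s))\<^sup>2 \<le> (b\<^sup>2 * C) * (t - s)" if st: "0 \<le> s" "s \<le> t" "t \<le> 1" for j s t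
  proof -
    let ?g = "\<lambda>t. (norm (Ks j t ** \<Phi>s j t))\<^sup>2"
    have gi: "?g integrable_on {s..t}"
      using integrable_subinterval_real[OF est(4)] st by auto
    have "(norm (\<Phi>s j t - \<Phi>s j s))\<^sup>2 \<le> (t - s) * integral {s..t} ?g"
      using Cauchy_Schwarz_has_integral[OF bounded_bilinear_inner inner_commute inner_ge_zero est(1)[OF st] gi st(2)]
      by (simp add: power2_norm_eq_inner)
    also have "\<dots> \<le> (t - s) * (b\<^sup>2 * C)"
    proof (rule mult_left_mono)
      have "integral {s..t} ?g \<le> integral {0..1} ?g"
        using st by (intro integral_subset_le gi est(4)) auto
      then show "integral {s..t} ?g \<le> b\<^sup>2 * C" using est(5)[of j] by linarith
    qed (use st in simp)
    finally show ?thesis by (simp add: mult.commute)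
  qed
  have equi: "\<exists>d>0. \<forall>j y. y \<in> {0..1} \<and> norm (x - y) < d \<longrightarrow> norm (\<Phi>s j x - \<Phi>s j y) < e"
    if x: "x \<in> {0..1}" and "e > 0" for x e :: real
  proof (intro exI[of _ "e\<^sup>2 / (b\<^sup>2 * C + 1)"] conjI allI impI)
    have D: "b\<^sup>2 * C + 1 > 0" using \<open>C \<ge> 0\<close> by (simp add: add_nonneg_pos)
    show "e\<^sup>2 / (b\<^sup>2 * C + 1) > 0" using D \<open>e > 0\<close> by simp
    fix j y assume y: "y \<in> {0..1} \<and> norm (x - y) < e\<^sup>2 / (b\<^sup>2 * C + 1)"
    have "(norm (\<Phi>s j x - \<Phi>s j y))\<^sup>2 \<le> (b\<^sup>2 * C) * \<bar>x - y\<bar>"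
      using holder[of x y j] holder[of y x j] x y by (cases "x \<le> y") (auto simp: norm_minus_commute)
    also have "\<dots> \<le> (b\<^sup>2 * C + 1) * \<bar>x - y\<bar>" by (simp add: mult_right_mono)
    also have "\<dots> < e\<^sup>2" using y D by (simp add: pos_less_divide_eq mult.commute)
    finally show "norm (\<Phi>s j x - \<Phi>s j y) < e"
      by (rule power2_less_imp_less) (use \<open>e > 0\<close> in simp)
  qed
  obtain \<Phi> r where \<Phi>_cont: "continuous_on {0..1} \<Phi>" and r: "strict_mono (r :: nat \<Rightarrow> nat)"
    and unif: "\<And>e. 0 < e \<Longrightarrow> \<exists>n. \<forall>j t. j \<ge> n \<and> t \<in> {0..1} \<longrightarrow> norm (\<Phi>s (r j) t - \<Phi> t) < e"
    using Arzela_Ascoli[of "{0..1::real}" \<Phi>s b, OF compact_Icc est(2) equi] by blast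
  have lim: "(\<lambda>j. \<Phi>s (r j) t) \<longlonglongrightarrow> \<Phi> t" if "t \<in> {0..1}" for t
    by (rule LIMSEQ_I) (use unif that in blast)
  \<comment> \<open>Nonvanishing of the determinant is an open condition and could be lost in the
    limit. This lower bound is closed, with a constant independent of \<open>j\<close>.\<close>
  have lower: "norm X \<le> 2 ^ p * norm (\<Phi> t ** X)" if t: "t \<in> {0..1}" for t and X :: "real^'n^'n"
  proof (rule LIMSEQ_le_const)
    show "(\<lambda>j. 2 ^ p * norm (\<Phi>s (r j) t ** X)) \<longlonglongrightarrow> 2 ^ p * norm (\<Phi> t ** X)"
      by (intro tendsto_intros tendsto_matrix_mult lim t)
  qed (use est(3)[OF t] in blast)
  have inv: "invertible (\<Phi> t)" if t: "t \<in> {0..1}" for t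
  proof -
    have "x = 0" if "\<Phi> t *v x = 0" for x
    proof -
      define X :: "real^'n^'n" where "X = (\<chi> i j. x $ i)"
      have "(\<Phi> t ** X) $ i $ j = (\<Phi> t *v x) $ i" for i j
        by (simp add: matrix_matrix_mult_def matrix_vector_mult_def X_def)
      then have "\<Phi> t ** X = 0" using that by (simp add: vec_eq_iff)
      then have "X = 0" using lower[OF t, of X] by simp
      then show ?thesis by (simp add: X_def vec_eq_iff)
    qed
    then show ?thesis by (simp add: invertible_left_inverse matrix_left_invertible_ker)
  qed
  have invb: "norm (matrix_inv (\<Phi> t)) \<le> b" if t: "t \<in> {0..1}" for t
    using lower[OF t, of "matrix_inv (\<Phi> t)"] by (simp add: matrix_inv_mult[OF inv[OF t]] b_def)
  have invs: "invertible (\<Phi>s j t)" if t: "t \<in> {0..1}" for j t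
    using adm[of j] t by (simp add: admissible2_def)
  have invbs: "norm (matrix_inv (\<Phi>s j t)) \<le> b" if t: "t \<in> {0..1}" for j t
    using est(3)[OF t, of "matrix_inv (\<Phi>s j t)" j] by (simp add: matrix_inv_mult[OF invs[OF t]] b_def)
  define P where "P t = cost_weight \<Sigma>0 \<epsilon> (\<Phi> t)" for t
  define Ps where "Ps j t = cost_weight \<Sigma>0 \<epsilon> (\<Phi>s (r j) t)" for j t
  define G where "G j t = Ks (r j) t ** \<Phi>s (r j) t" for j t
  have G_flow: "(G j has_integral \<Phi>s (r j) t - \<Phi>s (r j) s) {s..t}" if "0 \<le> s" "s \<le> t" "t \<le> 1" for j s t
    unfolding G_def by (rule est(1)[OF that])
  have G_sq: "(\<lambda>t. (norm (G j t))\<^sup>2) integrable_on {0..1}" for j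
    unfolding G_def by (rule est(4))
  have G_le: "integral {0..1} (\<lambda>t. (norm (G j t))\<^sup>2) \<le> b\<^sup>2 * C" for j
    unfolding G_def by (rule est(5))
  have ac: "abs_continuous_on {0..1} \<Phi>"
    by (rule abs_continuous_on_pointwise_limit[OF lim G_flow G_sq G_le])
  define Z where "Z = {t\<in>{0..1}. \<not> \<Phi> differentiable (at t within {0..1})}"
  have Z: "negligible Z" unfolding Z_def by (rule abs_continuous_differentiable_ae[OF ac])
  \<comment> \<open>On \<open>Z\<close> the value of \<open>vector_derivative\<close> is arbitrary.
    The differential equation is tested only where a derivative exists, and the cost ignores null
    sets.\<close>
  define D where "D t = vector_derivative \<Phi> (at t within {0..1})" for t
  have der: "(\<Phi> has_vector_derivative D t) (at t within {0..1})" if "t \<in> {0..1} - Z" for t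
    using that by (simp add: Z_def D_def vector_derivative_works)
  define K where "K t = D t ** matrix_inv (\<Phi> t)" for t
  have K\<Phi>: "K t ** \<Phi> t = D t" if t: "t \<in> {0..1}" for t
    by (simp add: K_def matrix_mul_assoc[symmetric] matrix_inv_mult[OF inv[OF t]])
  have inv_cont: "continuous_on {0..1} (\<lambda>t. matrix_inv (\<Phi> t))"
    by (rule continuous_on_matrix_inv[OF \<Phi>_cont inv])
  have P_cont: "continuous_on {0..1} P"
    unfolding P_def cost_weight_def
    by (intro continuous_on_add continuous_on_scaleR continuous_on_const continuous_on_matrix_mult inv_cont
      bounded_linear.continuous_on[OF bounded_linear_transpose])
  have P_sym: "transpose (P t) = P t" for t
  proof -
    have "transpose (P t) = transpose \<Sigma>0 + \<epsilon> *\<^sub>R transpose (matrix_inv (\<Phi> t) ** transpose (matrix_inv (\<Phi> t)))"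
      unfolding P_def cost_weight_def
      by (simp add: linear_add[OF bounded_linear.linear[OF bounded_linear_transpose]] transpose_scalar)
    also have "\<dots> = P t"
      using S0 by (simp add: P_def cost_weight_def sym_pos_def_def matrix_transpose_mul)
    finally show ?thesis .
  qed
  have P_psd: "0 \<le> trace (B ** P t ** transpose B)" for t and B :: "real^'n^'n"
    unfolding P_def trace_cost_weight using trace_sym_pos_def_nonneg[OF S0, of B] eps by simp
  have P_lim: "eventually (\<lambda>j. \<forall>t\<in>{0..1}. norm (Ps j t - P t) \<le> e) sequentially" if "e > 0" for e
  proof -
    define L where "L = \<epsilon> * (2 * b ^ 3)"
    have "L \<ge> 0" using eps \<open>b \<ge> 0\<close> by (simp add: L_def)
    then have "e / (L + 1) > 0" using \<open>e > 0\<close> by simp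
    then obtain n where n: "\<And>j t. j \<ge> n \<Longrightarrow> t \<in> {0..1} \<Longrightarrow> norm (\<Phi>s (r j) t - \<Phi> t) < e / (L + 1)"
      using unif by blast
    have "norm (Ps j t - P t) \<le> e" if "j \<ge> n" "t \<in> {0..1}" for j t
    proof -
      have "norm (Ps j t - P t) \<le> L * norm (\<Phi>s (r j) t - \<Phi> t)"
        unfolding Ps_def P_def L_def using eps that(2)
        by (intro norm_cost_weight_diff invs inv invbs invb) auto
      also have "\<dots> \<le> L * (e / (L + 1))"
        using n[OF that] \<open>L \<ge> 0\<close> by (intro mult_left_mono) auto
      also have "\<dots> \<le> e" using \<open>L \<ge> 0\<close> \<open>e > 0\<close> by (simp add: field_simps)
      finally show ?thesis .
    qed
    then show ?thesis unfolding eventually_sequentially by blast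
  qed
  have adm_int: "(\<lambda>t. trace (Ks j t ** \<Phi>s j t ** \<Sigma>0 ** transpose (\<Phi>s j t) ** transpose (Ks j t))) integrable_on {0..1}"
    "(\<lambda>t. trace (Ks j t ** transpose (Ks j t))) integrable_on {0..1}" for j
    using adm[of j] by (simp_all add: admissible2_def)
  have q: "(\<lambda>t. trace (G j t ** Ps j t ** transpose (G j t))) integrable_on {0..1}" for j
    unfolding G_def Ps_def by (rule cost2_eq(1)[OF invs adm_int])
  have qI: "integral {0..1} (\<lambda>t. trace (G j t ** Ps j t ** transpose (G j t))) = 2 * cost (x (r j))" for j
    unfolding G_def Ps_def cost_eq[symmetric] by (subst cost2_eq(2)[OF invs adm_int]) simp_all
  have I: "(\<lambda>j. integral {0..1} (\<lambda>t. trace (G j t ** Ps j t ** transpose (G j t)))) \<longlonglongrightarrow> 2 * c"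
    unfolding qI using LIMSEQ_subseq_LIMSEQ[OF cost_lim r] by (intro tendsto_mult tendsto_const) (simp add: o_def)
  note lsc = quadratic_cost_lsc[OF lim G_flow G_sq G_le P_cont P_sym P_psd P_lim q I Z der]
  define h where "h t = trace (D t ** P t ** transpose (D t))" for t
  have h_int: "h integrable_on {0..1}" and h_le: "integral {0..1} h \<le> 2 * c"
    using lsc by (simp_all add: h_def[abs_def])
  have h_eq: "h t = trace (K t ** \<Phi> t ** \<Sigma>0 ** transpose (\<Phi> t) ** transpose (K t)) + \<epsilon> * (norm (K t))\<^sup>2"
    if "t \<in> {0..1}" for t
    using trace_cost_weight_flow[OF inv[OF that], of "K t" \<Sigma>0 \<epsilon>]
    by (simp add: h_def P_def K\<Phi>[OF that] trace_mult_transpose)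
  have KE0: "0 \<le> trace (K t ** \<Phi> t ** \<Sigma>0 ** transpose (\<Phi> t) ** transpose (K t))" for t
    using trace_sym_pos_def_nonneg[OF S0, of "K t ** \<Phi> t"] by (simp add: matrix_transpose_mul matrix_mul_assoc)
  have D_meas: "D \<in> borel_measurable (lebesgue_on {0..1})"
    by (rule derivative_borel_measurable[OF Z der])
  have \<Phi>_meas: "\<Phi> \<in> borel_measurable (lebesgue_on {0..1})" "(\<lambda>t. matrix_inv (\<Phi> t)) \<in> borel_measurable (lebesgue_on {0..1})"
    using \<Phi>_cont inv_cont by (intro continuous_imp_measurable_on_sets_lebesgue; simp)+
  have K_meas: "K \<in> borel_measurable (lebesgue_on {0..1})"
    unfolding K_def by (rule borel_measurable_matrix_mult[OF D_meas \<Phi>_meas(2)])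
  \<comment> \<open>Lower semicontinuity controls only the sum of the two parts of the cost. Both
    are nonnegative, so each is dominated by a multiple of \<open>h\<close> and is integrable
    because it is measurable.\<close>
  have K_sq: "(\<lambda>t. (norm (K t))\<^sup>2) integrable_on {0..1}"
  proof (rule integrable_on_dominated[OF borel_measurable_norm_power2[OF K_meas]])
    show "(\<lambda>t. (1 / \<epsilon>) * h t) integrable_on {0..1}" by (rule integrable_on_mult_right[OF h_int])
    show "\<bar>(norm (K t))\<^sup>2\<bar> \<le> (1 / \<epsilon>) * h t" if "t \<in> {0..1}" for t
      using h_eq[OF that] KE0[of t] eps by (simp add: field_simps)
  qed
  have KE_int: "(\<lambda>t. trace (K t ** \<Phi> t ** \<Sigma>0 ** transpose (\<Phi> t) ** transpose (K t))) integrable_on {0..1}"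
  proof (rule integrable_on_dominated[OF _ h_int])
    have "(\<lambda>t. trace ((K t ** \<Phi> t) ** \<Sigma>0 ** transpose (K t ** \<Phi> t))) \<in> borel_measurable (lebesgue_on {0..1})"
      by (intro borel_measurable_trace_form borel_measurable_matrix_mult K_meas \<Phi>_meas) simp
    then show "(\<lambda>t. trace (K t ** \<Phi> t ** \<Sigma>0 ** transpose (\<Phi> t) ** transpose (K t))) \<in> borel_measurable (lebesgue_on {0..1})"
      by (simp add: matrix_transpose_mul matrix_mul_assoc)
    show "\<bar>trace (K t ** \<Phi> t ** \<Sigma>0 ** transpose (\<Phi> t) ** transpose (K t))\<bar> \<le> h t" if "t \<in> {0..1}" for t
      using h_eq[OF that] KE0[of t] eps by simp
  qed
  have K_int: "(\<lambda>t. trace (K t ** transpose (K t))) integrable_on {0..1}"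
    using K_sq by (simp add: trace_mult_transpose)
  have Ksi: "square_integrable_on {0..1} K"
    using K_meas K_sq by (simp add: square_integrable_on_iff)
  have track: "\<Phi> t ** Y 0 = Y t" if t: "t \<in> {0..1}" for t
  proof (rule LIMSEQ_unique)
    show "(\<lambda>j. \<Phi>s (r j) t ** Y 0) \<longlonglongrightarrow> \<Phi> t ** Y 0" by (intro tendsto_matrix_mult lim t tendsto_const)
    show "(\<lambda>j. \<Phi>s (r j) t ** Y 0) \<longlonglongrightarrow> Y t" using admissible_tracks[OF adm t] by simp
  qed
  have "admissible2 \<Sigma>0 \<Sigma>1 Y N K \<Phi>"
    unfolding admissible2_def
  proof (intro conjI ballI allI impI)
    show "\<Phi> 0 = mat 1"
    proof (rule LIMSEQ_unique)
      show "(\<lambda>j. \<Phi>s (r j) 0) \<longlonglongrightarrow> \<Phi> 0" by (rule lim) simp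
      show "(\<lambda>j. \<Phi>s (r j) 0) \<longlonglongrightarrow> mat 1" using adm by (simp add: admissible2_def)
    qed
    show "D' = K t ** \<Phi> t" if t: "t \<in> {0..1}" and D': "(\<Phi> has_vector_derivative D') (at t within {0..1})" for t D'
    proof -
      have "D t = D'"
        using vector_derivative_within_cbox[of 0 1 t \<Phi> D'] t D' by (simp add: D_def cbox_interval)
      then show ?thesis using K\<Phi>[OF t] by simp
    qed
    show "\<Phi> 1 ** \<Sigma>0 ** transpose (\<Phi> 1) = \<Sigma>1"
    proof (rule LIMSEQ_unique)
      show "(\<lambda>j. \<Phi>s (r j) 1 ** \<Sigma>0 ** transpose (\<Phi>s (r j) 1)) \<longlonglongrightarrow> \<Phi> 1 ** \<Sigma>0 ** transpose (\<Phi> 1)"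
        by (intro tendsto_matrix_mult tendsto_const lim bounded_linear.tendsto[OF bounded_linear_transpose]) auto
      show "(\<lambda>j. \<Phi>s (r j) 1 ** \<Sigma>0 ** transpose (\<Phi>s (r j) 1)) \<longlonglongrightarrow> \<Sigma>1" using adm by (simp add: admissible2_def)
    qed
    show "Y 1 = \<Phi> 1 ** Y 0" using track[of 1] by simp
    show "\<exists>R::real \<Rightarrow> real^'k^'n. square_integrable_on {0..1} R \<and>
        (\<exists>Z. negligible Z \<and> (\<forall>t\<in>{0..1} - Z. K t = Mcurve Y t + R t ** N t))"
    \<comment> \<open>The feedbacks of the minimizing sequence are not followed to a limit; a new
      one is built from the limiting control.\<close>
    proof (rule tracking_feedback[OF track Z _ Ksi])
      show "(\<Phi> has_vector_derivative K t ** \<Phi> t) (at t within {0..1})" if "t \<in> {0..1} - Z" for t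
        using der[OF that] K\<Phi>[of t] that by simp
    qed
  qed (use Ksi ac inv KE_int K_int in auto)
  moreover have "cost2 \<Sigma>0 \<epsilon> K \<Phi> \<le> c"
  proof -
    have "integral {0..1} (\<lambda>t. trace ((K t ** \<Phi> t) ** cost_weight \<Sigma>0 \<epsilon> (\<Phi> t) ** transpose (K t ** \<Phi> t))) = integral {0..1} h"
      by (rule integral_cong) (simp add: h_def P_def K\<Phi>)
    then show ?thesis using cost2_eq(2)[OF inv KE_int K_int, of \<epsilon>] h_le by simp
  qed
  moreover have "c \<le> cost2 \<Sigma>0 \<epsilon> K' \<Phi>'" if "admissible2 \<Sigma>0 \<Sigma>1 Y N K' \<Phi>'" for K' \<Phi>'
    using c_le[of "(K', \<Phi>')"] that by (simp add: A_def cost_def)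
  ultimately show ?thesis by (meson order_trans)
qed

end
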